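(* Let $k$ be a field, $P$ a finite connected poset, $T,C\in\mathrm{Int}(P)$ and $p\ge0$. The $k$-vector space $\mathrm{Ext}^p_{\Lambda_P}(\Delta(T),\mathsf L(C))$ is one-dimensional if $C$ is a relative upset of $T$ with extremal lower boundary in $T$ and $p=|\mathrm{Min}(T\setminus C)|$. It vanishes otherwise.
   Context: A subset $S\subseteq P$ is connected if any $x,y\in S$ are joined by a sequence $x=x_0,\dots,x_r=y$ in $S$ with $x_{i-1},x_i$ comparable for all $i$; convex if $x,y\in S$ and $x\le z\le y$ imply $z\in S$; an interval if it is nonempty, connected and convex. $\mathrm{Int}(P)$ is the set of intervals of $P$. Representations of $P$ are functors from $P$ to finite-dimensional $k$-vector spaces, with morphism spaces $\mathrm{Hom}_P$. For $S\in\mathrm{Int}(P)$, $\mathbb I_S$ is the representation with $\mathbb I_S(x)=k$ for $x\in S$ and $0$ otherwise, and $\mathbb I_S(x\le y)=\mathrm{id}$ if $x,y\in S$ and $0$ otherwise. Put $G_P=\bigoplus_{S\in\mathrm{Int}(P)}\mathbb I_S$ and $\Lambda_P=\mathrm{End}_P(G_P)^{\mathrm{op}}$; $e_S\in\Lambda_P$ is the idempotent of the summand $\mathbb I_S$, so $e_R\Lambda_Pe_S=\mathrm{Hom}_P(\mathbb I_R,\mathbb I_S)$. All modules are finitely generated left modules. $\mathsf P(S)=\Lambda_Pe_S$ and $\mathsf L(S)=\mathsf P(S)/\operatorname{rad}\mathsf P(S)$. $\Lambda_P$ carries the quasi-hereditary order on $\mathrm{Int}(P)$ given by $R\preceq S$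 iff $R=S$ or $|R|>|S|$. The standard module $\Delta(S)$ is the largest quotient of $\mathsf P(S)$ all of whose composition factors are of the form $\mathsf L(R)$ with $R\preceq S$. A subset $C\subseteq T$ is a relative upset of $T$ if $c\in C$, $x\in T$, $c\le x$ imply $x\in C$. For an interval $C$ that is a relative upset of the interval $T$, the lower boundary is $\partial_T^-C=\{x\in T\setminus C\mid x\lessdot c\text{ for some }c\in C\}$, where $\lessdot$ is the covering relation. $C$ has extremal lower boundary in $T$ if $\partial_T^-C=\mathrm{Min}(T\setminus C)$, where $\mathrm{Min}(X)$ is the set of minimal elements of $X$. In particular $T$ has extremal lower boundary in itself (both sets being empty). *)

theory Defs
  imports Complex_Main "HOL-Algebra.AbelCoset" "HOL-Algebra.Module" "HOL-Library.Function_Algebras"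
begin

section \<open>Intervals of a finite poset\<close>

text \<open>The poset is the universe of a type of class \<open>order\<close> (and \<open>finite\<close> in the theorem);
  the ground field is a type of class \<open>field\<close>.\<close>

definition poset_connected :: "'p::order set \<Rightarrow> bool" where
  "poset_connected S \<longleftrightarrow>
     (\<forall>x\<in>S. \<forall>y\<in>S. (x, y) \<in> {(a, b). a \<in> S \<and> b \<in> S \<and> (a \<le> b \<or> b \<le> a)}\<^sup>*)"

definition poset_convex :: "'p::order set \<Rightarrow> bool" where
  "poset_convex S \<longleftrightarrow> (\<forall>x\<in>S. \<forall>y\<in>S. \<forall>z. x \<le> z \<and> z \<le> y \<longrightarrow> z \<in> S)"

definition intervals :: "'p::order set set" where
  "intervals = {S. S \<noteq> {} \<and> poset_connected S \<and> poset_convex S}"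

definition interval_preceq :: "'p set \<Rightarrow> 'p set \<Rightarrow> bool" where
  "interval_preceq R S \<longleftrightarrow> R = S \<or> card R > card S"

definition covered_by :: "'p::order \<Rightarrow> 'p \<Rightarrow> bool" where
  "covered_by x y \<longleftrightarrow> x < y \<and> \<not> (\<exists>z. x < z \<and> z < y)"

definition minimal_elements :: "'p::order set \<Rightarrow> 'p set" where
  "minimal_elements S = {x \<in> S. \<not> (\<exists>y\<in>S. y < x)}"

definition relative_upset :: "'p::order set \<Rightarrow> 'p set \<Rightarrow> bool" where
  "relative_upset C T \<longleftrightarrow> C \<subseteq> T \<and> (\<forall>c\<in>C. \<forall>x\<in>T. c \<le> x \<longrightarrow> x \<in> C)"

definition lower_boundary :: "'p::order set \<Rightarrow> 'p set \<Rightarrow> 'p set" where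
  "lower_boundary T C = {x \<in> T - C. \<exists>c\<in>C. covered_by x c}"

definition extremal_lower_boundary :: "'p::order set \<Rightarrow> 'p set \<Rightarrow> bool" where
  "extremal_lower_boundary T C \<longleftrightarrow> lower_boundary T C = minimal_elements (T - C)"


section \<open>Representations of a poset\<close>

text \<open>The vector space at \<open>x\<close> is a subspace \<open>rspace V x\<close> of an ambient vector space \<open>'v\<close> with
  scalar multiplication \<open>rscale V\<close>; the map attached to \<open>x \<le> y\<close> is \<open>rmap V x y\<close>. Values of
  \<open>rmap V x y\<close> for \<open>x \<le> y\<close> failing, or outside \<open>rspace V x\<close>, are irrelevant.\<close>

record ('k, 'p, 'v) poset_rep =
  rspace :: "'p \<Rightarrow> 'v set"
  rscale :: "'k \<Rightarrow> 'v \<Rightarrow> 'v"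
  rmap :: "'p \<Rightarrow> 'p \<Rightarrow> 'v \<Rightarrow> 'v"

definition is_poset_rep :: "('k::field, 'p::order, 'v::ab_group_add) poset_rep \<Rightarrow> bool" where
  "is_poset_rep V \<longleftrightarrow>
     vector_space (rscale V) \<and>
     (\<forall>x. Modules.module.subspace (rscale V) (rspace V x)) \<and>
     (\<forall>x. \<exists>B. finite B \<and> rspace V x = Modules.module.span (rscale V) B) \<and>
     (\<forall>x y. x \<le> y \<longrightarrow> rmap V x y \<in> rspace V x \<rightarrow> rspace V y) \<and>
     (\<forall>x y. x \<le> y \<longrightarrow> (\<forall>v\<in>rspace V x. \<forall>w\<in>rspace V x.
        rmap V x y (v + w) = rmap V x y v + rmap V x y w)) \<and>
     (\<forall>x y. x \<le> y \<longrightarrow> (\<forall>c. \<forall>v\<in>rspace V x.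
        rmap V x y (rscale V c v) = rscale V c (rmap V x y v))) \<and>
     (\<forall>x. \<forall>v\<in>rspace V x. rmap V x x v = v) \<and>
     (\<forall>x y z. x \<le> y \<and> y \<le> z \<longrightarrow> (\<forall>v\<in>rspace V x. rmap V y z (rmap V x y v) = rmap V x z v))"

text \<open>To make equality of morphisms the equality of functions, the component at \<open>x\<close> is required
  to be \<open>0\<close> outside \<open>rspace V x\<close>.\<close>

definition rep_hom ::
  "('k, 'p::order, 'v::ab_group_add) poset_rep \<Rightarrow> ('k, 'p, 'w::ab_group_add) poset_rep \<Rightarrow>
    ('p \<Rightarrow> 'v \<Rightarrow> 'w) set" where
  "rep_hom V W = {f.
     (\<forall>x. f x \<in> rspace V x \<rightarrow> rspace W x) \<and>
     (\<forall>x v. v \<notin> rspace V x \<longrightarrow> f x v = 0) \<and>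
     (\<forall>x. \<forall>v\<in>rspace V x. \<forall>w\<in>rspace V x. f x (v + w) = f x v + f x w) \<and>
     (\<forall>x c. \<forall>v\<in>rspace V x. f x (rscale V c v) = rscale W c (f x v)) \<and>
     (\<forall>x y. x \<le> y \<longrightarrow> (\<forall>v\<in>rspace V x. f y (rmap V x y v) = rmap W x y (f x v)))}"

definition interval_rep :: "'p set \<Rightarrow> ('k::field, 'p, 'k) poset_rep" where
  "interval_rep S = \<lparr>
     rspace = (\<lambda>x. if x \<in> S then UNIV else {0}),
     rscale = (*),
     rmap = (\<lambda>x y v. if x \<in> S \<and> y \<in> S then v else 0)\<rparr>"

lemma is_poset_rep_interval_rep:
  assumes "S \<in> intervals"
  shows "is_poset_rep (interval_rep S :: ('k::field, 'p::order, 'k) poset_rep)"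
proof -
  interpret V: vector_space "(*) :: 'k \<Rightarrow> 'k \<Rightarrow> 'k"
    by unfold_locales (auto simp: algebra_simps)
  have "x \<in> V.span {1}" for x
    using V.span_scale[OF V.span_base[of 1 "{1}"], of x] by simp
  then have "UNIV = V.span {1}" by auto
  then have 1: "\<exists>B. finite B \<and> UNIV = V.span B" by (intro exI[of _ "{1}"]) simp
  have 2: "\<exists>B. finite B \<and> {0} = V.span B" by (rule exI[of _ "{}"]) simp
  have conv: "x \<in> S \<Longrightarrow> z \<in> S \<Longrightarrow> x \<le> y \<Longrightarrow> y \<le> z \<Longrightarrow> y \<in> S" for x y z
    using assms unfolding intervals_def poset_convex_def by blast
  show ?thesis
    unfolding is_poset_rep_def interval_rep_def
    by (auto simp: V.vector_space_axioms V.subspace_UNIV V.subspace_single_0 1 2 intro: conv)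
qed

text \<open>Direct sum of a family indexed by a finite set \<open>I\<close>.\<close>

definition rep_sum ::
  "'i set \<Rightarrow> ('i \<Rightarrow> ('k, 'p, 'v::ab_group_add) poset_rep) \<Rightarrow> ('k, 'p, 'i \<Rightarrow> 'v) poset_rep" where
  "rep_sum I F = \<lparr>
     rspace = (\<lambda>x. {v. (\<forall>i\<in>I. v i \<in> rspace (F i) x) \<and> (\<forall>i. i \<notin> I \<longrightarrow> v i = 0)}),
     rscale = (\<lambda>c v i. rscale (F i) c (v i)),
     rmap = (\<lambda>x y v i. if i \<in> I then rmap (F i) x y (v i) else 0)\<rparr>"

text \<open>The opposite of the endomorphism algebra: \<open>a \<otimes> b\<close> is the composite \<open>b \<circ> a\<close>. The ring
  structure and the action of the ground field are packed into one record.\<close>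

definition rep_End_op ::
  "('k, 'p::order, 'v::ab_group_add) poset_rep \<Rightarrow> ('k, 'p \<Rightarrow> 'v \<Rightarrow> 'v) module" where
  "rep_End_op V = \<lparr>
     carrier = rep_hom V V,
     mult = (\<lambda>a b x v. b x (a x v)),
     one = (\<lambda>x v. if v \<in> rspace V x then v else 0),
     zero = (\<lambda>x v. 0),
     add = (\<lambda>a b x v. a x v + b x v),
     smult = (\<lambda>c a x v. rscale V c (a x v))\<rparr>"

definition interval_generator ::
  "('k::field, 'p::order, 'p set \<Rightarrow> 'k) poset_rep" where
  "interval_generator = rep_sum intervals interval_rep"

lemma interval_generator_simps:
  "rspace interval_generator x = {v. \<forall>S. S \<notin> intervals \<or> x \<notin> S \<longrightarrow> v S = 0}"
  "rscale interval_generator c v = (\<lambda>S. c * v S)"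
  "rmap interval_generator x y v = (\<lambda>S. if S \<in> intervals \<and> x \<in> S \<and> y \<in> S then v S else 0)"
  by (auto simp: interval_generator_def rep_sum_def interval_rep_def fun_eq_iff split: if_splits)

lemma is_poset_rep_interval_generator:
  "is_poset_rep (interval_generator :: ('k::field, 'p::{finite, order}, _) poset_rep)"
proof -
  let ?G = "interval_generator :: ('k, 'p, 'p set \<Rightarrow> 'k) poset_rep"
  interpret V: vector_space "rscale ?G"
    by unfold_locales (auto simp: interval_generator_simps fun_eq_iff algebra_simps)
  have sub: "V.subspace (rspace ?G x)" for x
    by (simp add: V.subspace_def interval_generator_simps)
  have span: "\<exists>B. finite B \<and> rspace ?G x = V.span B" for x
  proof -
    let ?I = "{S \<in> intervals. x \<in> S}"
    let ?b = "\<lambda>S R. if R = S then 1 else (0::'k)"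
    have "v \<in> V.span (?b ` ?I)" if v: "v \<in> rspace ?G x" for v
    proof -
      have "v = (\<Sum>S\<in>?I. rscale ?G (v S) (?b S))"
      proof
        fix R
        have "(\<Sum>S\<in>J. rscale ?G (v S) (?b S)) R = (\<Sum>S\<in>J. v S * ?b S R)" if "finite J" for J
          using that by (induction J rule: finite_induct) (simp_all add: interval_generator_simps)
        then have "(\<Sum>S\<in>?I. rscale ?G (v S) (?b S)) R = (\<Sum>S\<in>?I. v S * ?b S R)" by simp
        also have "\<dots> = (\<Sum>S\<in>?I. if S = R then v S else 0)" by (rule sum.cong) auto
        also have "\<dots> = v R" using v by (auto simp: interval_generator_simps)
        finally show "v R = (\<Sum>S\<in>?I. rscale ?G (v S) (?b S)) R" by simp
      qed
      also have "\<dots> \<in> V.span (?b ` ?I)"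
        by (intro V.span_sum V.span_scale V.span_base) auto
      finally show ?thesis .
    qed
    moreover have "V.span (?b ` ?I) \<subseteq> rspace ?G x"
      by (rule V.span_minimal[OF _ sub]) (auto simp: interval_generator_simps)
    ultimately show ?thesis by (intro exI[of _ "?b ` ?I"]) auto
  qed
  have conv: "x \<in> S \<Longrightarrow> z \<in> S \<Longrightarrow> S \<in> intervals \<Longrightarrow> x \<le> y \<Longrightarrow> y \<le> z \<Longrightarrow> y \<in> S"
    for x y z :: 'p and S
    unfolding intervals_def poset_convex_def by blast
  have comp: "rmap ?G y z (rmap ?G x y v) = rmap ?G x z v" if "x \<le> y" "y \<le> z" for x y z v
  proof
    fix S show "rmap ?G y z (rmap ?G x y v) S = rmap ?G x z v S"
      using conv[of x S z y] that by (auto simp: interval_generator_simps)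
  qed
  have maps: "rmap ?G x y \<in> rspace ?G x \<rightarrow> rspace ?G y"
    "rmap ?G x y (v + w) = rmap ?G x y v + rmap ?G x y w"
    "rmap ?G x y (rscale ?G c v) = rscale ?G c (rmap ?G x y v)" for x y v w c
    by (simp_all add: interval_generator_simps fun_eq_iff)
  have unit: "rmap ?G x x v = v" if "v \<in> rspace ?G x" for x v
    using that by (auto simp: interval_generator_simps fun_eq_iff)
  show ?thesis
    unfolding is_poset_rep_def
    by (intro conjI allI impI ballI V.vector_space_axioms sub span maps comp unit) simp_all
qed

type_synonym ('k, 'p) interval_endo = "'p \<Rightarrow> ('p set \<Rightarrow> 'k) \<Rightarrow> ('p set \<Rightarrow> 'k)"

definition interval_algebra ::
  "('k::field, ('k, 'p::order) interval_endo) module" where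
  "interval_algebra = rep_End_op interval_generator"

definition interval_idem :: "'p::order set \<Rightarrow> ('k::field, 'p) interval_endo" where
  "interval_idem S = (\<lambda>x v. if v \<in> rspace interval_generator x
                            then (\<lambda>R. if R = S then v R else 0) else 0)"


section \<open>Left modules over a noncommutative ring\<close>

text \<open>The locale \<^locale>\<open>module\<close> of the library requires a commutative ring of scalars; the
  predicate \<^const>\<open>submodule\<close> does not, and is used as it stands. As usual in HOL-Algebra, the
  fields \<open>mult\<close> and \<open>one\<close> of a record representing a module play no role.\<close>

locale left_module = R?: ring R + M?: abelian_group M
  for R :: "('a, 'z) ring_scheme" (structure) and M :: "('a, 'm) module" (structure) +
  assumes smult_closed:
      "\<lbrakk>a \<in> carrier R; x \<in> carrier M\<rbrakk> \<Longrightarrow> a \<odot>\<^bsub>M\<^esub> x \<in> carrier M"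
    and smult_l_distr:
      "\<lbrakk>a \<in> carrier R; b \<in> carrier R; x \<in> carrier M\<rbrakk> \<Longrightarrow>
       (a \<oplus>\<^bsub>R\<^esub> b) \<odot>\<^bsub>M\<^esub> x = a \<odot>\<^bsub>M\<^esub> x \<oplus>\<^bsub>M\<^esub> b \<odot>\<^bsub>M\<^esub> x"
    and smult_r_distr:
      "\<lbrakk>a \<in> carrier R; x \<in> carrier M; y \<in> carrier M\<rbrakk> \<Longrightarrow>
       a \<odot>\<^bsub>M\<^esub> (x \<oplus>\<^bsub>M\<^esub> y) = a \<odot>\<^bsub>M\<^esub> x \<oplus>\<^bsub>M\<^esub> a \<odot>\<^bsub>M\<^esub> y"
    and smult_assoc1:
      "\<lbrakk>a \<in> carrier R; b \<in> carrier R; x \<in> carrier M\<rbrakk> \<Longrightarrow>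
       (a \<otimes>\<^bsub>R\<^esub> b) \<odot>\<^bsub>M\<^esub> x = a \<odot>\<^bsub>M\<^esub> (b \<odot>\<^bsub>M\<^esub> x)"
    and smult_one: "x \<in> carrier M \<Longrightarrow> \<one>\<^bsub>R\<^esub> \<odot>\<^bsub>M\<^esub> x = x"

definition quotient_module :: "('a, 'm) module \<Rightarrow> 'm set \<Rightarrow> ('a, 'm set) module" where
  "quotient_module M U = \<lparr>
     carrier = a_rcosets\<^bsub>M\<^esub> U,
     mult = undefined,
     one = undefined,
     zero = U,
     add = set_add M,
     smult = (\<lambda>a Y. \<Union>x\<in>Y. U +>\<^bsub>M\<^esub> (a \<odot>\<^bsub>M\<^esub> x))\<rparr>"

definition mod_hom ::
  "('a, 'z) ring_scheme \<Rightarrow> ('a, 'm) module \<Rightarrow> ('a, 'n) module \<Rightarrow> ('m \<Rightarrow> 'n) set" where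
  "mod_hom R M N = {f \<in> carrier M \<rightarrow>\<^sub>E carrier N.
     (\<forall>x\<in>carrier M. \<forall>y\<in>carrier M. f (x \<oplus>\<^bsub>M\<^esub> y) = f x \<oplus>\<^bsub>N\<^esub> f y) \<and>
     (\<forall>a\<in>carrier R. \<forall>x\<in>carrier M. f (a \<odot>\<^bsub>M\<^esub> x) = a \<odot>\<^bsub>N\<^esub> f x)}"

definition mod_iso ::
  "('a, 'z) ring_scheme \<Rightarrow> ('a, 'm) module \<Rightarrow> ('a, 'n) module \<Rightarrow> bool" where
  "mod_iso R M N \<longleftrightarrow> (\<exists>f\<in>mod_hom R M N. bij_betw f (carrier M) (carrier N))"

definition simple_module :: "('a, 'z) ring_scheme \<Rightarrow> ('a, 'm) module \<Rightarrow> bool" where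
  "simple_module R M \<longleftrightarrow> carrier M \<noteq> {\<zero>\<^bsub>M\<^esub>} \<and>
     (\<forall>U. submodule U R M \<longrightarrow> U = {\<zero>\<^bsub>M\<^esub>} \<or> U = carrier M)"

definition maximal_submodule ::
  "'m set \<Rightarrow> ('a, 'z) ring_scheme \<Rightarrow> ('a, 'm) module \<Rightarrow> bool" where
  "maximal_submodule U R M \<longleftrightarrow> submodule U R M \<and> U \<noteq> carrier M \<and>
     (\<forall>V. submodule V R M \<and> U \<subseteq> V \<longrightarrow> V = U \<or> V = carrier M)"

definition mod_radical :: "('a, 'z) ring_scheme \<Rightarrow> ('a, 'm) module \<Rightarrow> 'm set" where
  "mod_radical R M = {x \<in> carrier M. \<forall>U. maximal_submodule U R M \<longrightarrow> x \<in> U}"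

definition composition_series ::
  "('a, 'z) ring_scheme \<Rightarrow> ('a, 'm) module \<Rightarrow> 'm set list \<Rightarrow> bool" where
  "composition_series R M Us \<longleftrightarrow> Us \<noteq> [] \<and> hd Us = {\<zero>\<^bsub>M\<^esub>} \<and> last Us = carrier M \<and>
     (\<forall>U\<in>set Us. submodule U R M) \<and>
     (\<forall>i. Suc i < length Us \<longrightarrow> Us ! i \<subseteq> Us ! Suc i \<and>
        simple_module R (quotient_module (M\<lparr>carrier := Us ! Suc i\<rparr>) (Us ! i)))"

definition composition_factors ::
  "('a, 'z) ring_scheme \<Rightarrow> ('a, 'm) module \<Rightarrow> ('a, 'm set) module set" where
  "composition_factors R M =
     {quotient_module (M\<lparr>carrier := Us ! Suc i\<rparr>) (Us ! i) | Us i.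
        composition_series R M Us \<and> Suc i < length Us}"

definition regular_module :: "('a, 'z) ring_scheme \<Rightarrow> ('a, 'a) module" where
  "regular_module R = \<lparr>
     carrier = carrier R, mult = undefined, one = undefined,
     zero = \<zero>\<^bsub>R\<^esub>, add = (\<oplus>\<^bsub>R\<^esub>), smult = (\<otimes>\<^bsub>R\<^esub>)\<rparr>"

definition free_module :: "('a, 'z) ring_scheme \<Rightarrow> nat \<Rightarrow> ('a, nat \<Rightarrow> 'a) module" where
  "free_module R n = \<lparr>
     carrier = {..<n} \<rightarrow>\<^sub>E carrier R, mult = undefined, one = undefined,
     zero = (\<lambda>i\<in>{..<n}. \<zero>\<^bsub>R\<^esub>),
     add = (\<lambda>v w. \<lambda>i\<in>{..<n}. v i \<oplus>\<^bsub>R\<^esub> w i),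
     smult = (\<lambda>a v. \<lambda>i\<in>{..<n}. a \<otimes>\<^bsub>R\<^esub> v i)\<rparr>"

text \<open>Finitely generated projective modules: direct summands of free modules of finite rank.\<close>

definition fg_projective :: "('a, 'z) ring_scheme \<Rightarrow> ('a, 'm) module \<Rightarrow> bool" where
  "fg_projective R P \<longleftrightarrow> left_module R P \<and>
     (\<exists>n. \<exists>i\<in>mod_hom R P (free_module R n). \<exists>q\<in>mod_hom R (free_module R n) P.
        \<forall>x\<in>carrier P. q (i x) = x)"


section \<open>Ext spaces\<close>

text \<open>Resolutions are indexed as \<open>\<dots> \<rightarrow> P 2 \<rightarrow> P 1 \<rightarrow> P 0 \<rightarrow> M \<rightarrow> 0\<close> with differentials
  \<open>d n : P (n + 1) \<rightarrow> P n\<close> and augmentation \<open>e : P 0 \<rightarrow> M\<close>.\<close>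

definition projective_resolution ::
  "('a, 'z) ring_scheme \<Rightarrow> ('a, 'm) module \<Rightarrow> (nat \<Rightarrow> ('a, 'q) module) \<Rightarrow>
    (nat \<Rightarrow> 'q \<Rightarrow> 'q) \<Rightarrow> ('q \<Rightarrow> 'm) \<Rightarrow> bool" where
  "projective_resolution R M P d e \<longleftrightarrow>
     (\<forall>n. fg_projective R (P n)) \<and>
     (\<forall>n. d n \<in> mod_hom R (P (Suc n)) (P n)) \<and>
     e \<in> mod_hom R (P 0) M \<and>
     e ` carrier (P 0) = carrier M \<and>
     d 0 ` carrier (P 1) = {x \<in> carrier (P 0). e x = \<zero>\<^bsub>M\<^esub>} \<and>
     (\<forall>n. d (Suc n) ` carrier (P (Suc (Suc n))) = {x \<in> carrier (P (Suc n)). d n x = \<zero>\<^bsub>P n\<^esub>})"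

text \<open>Let \<open>A\<close> be an algebra over the field \<open>'k\<close>. A scalar \<open>c\<close> acts on a left \<open>A\<close>-module through
  the element \<open>c \<odot> \<one>\<close> of \<open>A\<close>; this makes \<open>Hom\<^sub>A(M, N)\<close> a vector space.\<close>

definition hom_space ::
  "('k, 'a) module \<Rightarrow> ('a, 'm) module \<Rightarrow> ('a, 'n) module \<Rightarrow> ('k, 'm \<Rightarrow> 'n) module" where
  "hom_space A M N = \<lparr>
     carrier = mod_hom A M N, mult = undefined, one = undefined,
     zero = (\<lambda>x\<in>carrier M. \<zero>\<^bsub>N\<^esub>),
     add = (\<lambda>f g. \<lambda>x\<in>carrier M. f x \<oplus>\<^bsub>N\<^esub> g x),
     smult = (\<lambda>c f. \<lambda>x\<in>carrier M. (c \<odot>\<^bsub>A\<^esub> \<one>\<^bsub>A\<^esub>) \<odot>\<^bsub>N\<^esub> f x)\<rparr>"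

definition coboundary_map ::
  "(nat \<Rightarrow> ('a, 'q) module) \<Rightarrow> (nat \<Rightarrow> 'q \<Rightarrow> 'q) \<Rightarrow> nat \<Rightarrow> ('q \<Rightarrow> 'n) \<Rightarrow> ('q \<Rightarrow> 'n)" where
  "coboundary_map P d n f = compose (carrier (P (Suc n))) f (d n)"

definition hom_cocycles ::
  "('k, 'a) module \<Rightarrow> (nat \<Rightarrow> ('a, 'q) module) \<Rightarrow> (nat \<Rightarrow> 'q \<Rightarrow> 'q) \<Rightarrow> ('a, 'n) module \<Rightarrow> nat \<Rightarrow>
    ('q \<Rightarrow> 'n) set" where
  "hom_cocycles A P d N n =
     {f \<in> mod_hom A (P n) N. coboundary_map P d n f = \<zero>\<^bsub>hom_space A (P (Suc n)) N\<^esub>}"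

definition hom_coboundaries ::
  "('k, 'a) module \<Rightarrow> (nat \<Rightarrow> ('a, 'q) module) \<Rightarrow> (nat \<Rightarrow> 'q \<Rightarrow> 'q) \<Rightarrow> ('a, 'n) module \<Rightarrow> nat \<Rightarrow>
    ('q \<Rightarrow> 'n) set" where
  "hom_coboundaries A P d N n =
     (case n of 0 \<Rightarrow> {\<zero>\<^bsub>hom_space A (P 0) N\<^esub>}
      | Suc m \<Rightarrow> coboundary_map P d m ` mod_hom A (P m) N)"

definition hom_cohomology ::
  "('k, 'a) module \<Rightarrow> (nat \<Rightarrow> ('a, 'q) module) \<Rightarrow> (nat \<Rightarrow> 'q \<Rightarrow> 'q) \<Rightarrow> ('a, 'n) module \<Rightarrow> nat \<Rightarrow>
    ('k, ('q \<Rightarrow> 'n) set) module" where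
  "hom_cohomology A P d N n =
     quotient_module ((hom_space A (P n) N)\<lparr>carrier := hom_cocycles A P d N n\<rparr>)
       (hom_coboundaries A P d N n)"

text \<open>\<open>Ext\<close> is computed from a chosen resolution by finitely generated projective modules. The
  terms of the resolution are carried by the type \<open>nat \<Rightarrow> 'a\<close>, which contains an isomorphic
  copy of every finitely generated projective \<open>A\<close>-module (a direct summand of some \<open>A\<^sup>n\<close>).\<close>

definition chosen_resolution ::
  "('k, 'a) module \<Rightarrow> ('a, 'm) module \<Rightarrow>
    (nat \<Rightarrow> ('a, nat \<Rightarrow> 'a) module) \<times> (nat \<Rightarrow> (nat \<Rightarrow> 'a) \<Rightarrow> (nat \<Rightarrow> 'a)) \<times> ((nat \<Rightarrow> 'a) \<Rightarrow> 'm)" where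
  "chosen_resolution A M = (SOME (P, d, e). projective_resolution A M P d e)"

definition Ext ::
  "('k, 'a) module \<Rightarrow> nat \<Rightarrow> ('a, 'm) module \<Rightarrow> ('a, 'n) module \<Rightarrow>
    ('k, ((nat \<Rightarrow> 'a) \<Rightarrow> 'n) set) module" where
  "Ext A p M N = (case chosen_resolution A M of (P, d, e) \<Rightarrow> hom_cohomology A P d N p)"

text \<open>\<open>V\<close> has a basis with \<open>n\<close> elements; the field of scalars is all of \<open>'k\<close>.\<close>

definition has_dimension :: "('k::field, 'v) module \<Rightarrow> nat \<Rightarrow> bool" where
  "has_dimension V n \<longleftrightarrow> (\<exists>b \<in> {..<n} \<rightarrow> carrier V. \<forall>v\<in>carrier V.
     \<exists>!c. c \<in> {..<n} \<rightarrow>\<^sub>E UNIV \<and> v = (\<Oplus>\<^bsub>V\<^esub>i\<in>{..<n}. c i \<odot>\<^bsub>V\<^esub> b i))"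


section \<open>Projective, simple and standard modules of the interval algebra\<close>

definition proj_module ::
  "'p::order set \<Rightarrow> (('k::field, 'p) interval_endo, ('k, 'p) interval_endo) module" where
  "proj_module S = (regular_module interval_algebra)
     \<lparr>carrier := {a \<otimes>\<^bsub>interval_algebra\<^esub> interval_idem S | a. a \<in> carrier interval_algebra}\<rparr>"

definition simple_top ::
  "'p::order set \<Rightarrow> (('k::field, 'p) interval_endo, ('k, 'p) interval_endo set) module" where
  "simple_top S = quotient_module (proj_module S) (mod_radical interval_algebra (proj_module S))"

definition factors_preceq ::
  "'p::order set \<Rightarrow> (('k::field, 'p) interval_endo, 'm) module \<Rightarrow> bool" where
  "factors_preceq S M \<longleftrightarrow>
     (\<forall>F \<in> composition_factors interval_algebra M.
        \<exists>R\<in>intervals. interval_preceq R S \<and> mod_iso interval_algebra F (simple_top R))"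

text \<open>The largest quotient with the required composition factors is the quotient by the least
  submodule whose quotient has these composition factors.\<close>

definition standard_module ::
  "'p::order set \<Rightarrow> (('k::field, 'p) interval_endo, ('k, 'p) interval_endo set) module" where
  "standard_module S = quotient_module (proj_module S)
     (LEAST U. submodule U interval_algebra (proj_module S) \<and>
        factors_preceq S (quotient_module (proj_module S) U))"

end

theory Submission
  imports Defs
begin

text \<open>A morphism \<open>I\<^sub>R \<rightarrow> I\<^sub>S\<close> is a scalar function on \<open>R \<inter> S\<close>, and composition is pointwise
  multiplication. A \<open>\<Lambda>\<close>-module homomorphism \<open>P(R) \<rightarrow> P(T)\<close> with \<open>R \<noteq> T\<close> and \<open>|R| \<le> |T|\<close> comes from a map
  whose image is a proper subrepresentation of \<open>I\<^sub>T\<close>, a sum of smaller intervals; hence \<open>\<Delta>(T)\<close> is the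
  quotient of \<open>P(T) = Hom(G, I\<^sub>T)\<close> by the maps that are not surjective. The sets \<open>A\<close> of minimal elements
  of \<open>T\<close> give subrepresentations \<open>I\<^bsub>T - A\<^esub>\<close> of \<open>I\<^sub>T\<close>, and the Koszul complex with terms
  \<open>\<Oplus>\<^bsub>|A| = p\<^esub> Hom(G, I\<^bsub>T - A\<^esub>)\<close> resolves \<open>\<Delta>(T)\<close>: near a point \<open>x\<close>, a non-surjective map \<open>I\<^sub>R \<rightarrow> I\<^sub>T\<close> misses
  some minimal element \<open>m\<close> of \<open>T\<close>, and adding or removing \<open>m\<close> contracts the complex. The terms are
  projective because \<open>I\<^bsub>T - A\<^esub>\<close> is the sum of the \<open>I\<^sub>Z\<close> over the components \<open>Z\<close> of \<open>T - A\<close>. So \<open>Hom(-, L(C))\<close>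
  has a basis indexed by those \<open>A\<close> for which \<open>C\<close> is a component of \<open>T - A\<close>, that is \<open>D \<subseteq> A \<subseteq> Min(T) - C\<close>
  with \<open>D\<close> the elements of \<open>T - C\<close> below \<open>C\<close>, for \<open>C\<close> a relative upset. This is the cochain complex of
  a Boolean lattice: it is contractible unless \<open>D = Min(T) - C\<close>, which is the extremality condition,
  and then it is a line in degree \<open>|D|\<close>.\<close>

section \<open>Left modules\<close>

text \<open>\<open>Ext\<close> is read off from one resolution picked by choice, with terms in
  \<open>nat \<Rightarrow> 'a\<close>, whereas the Koszul terms live in another type. So a
  resolution in any type is moved into the prescribed one, which shows that the choice is not void,
  and the comparison theorem carries the result over.

  The kernel of P(T) -> Delta(T) is caught from two sides. A composition factor L(R) of P(T) modulo
  the non-surjective maps forces T \<subseteq> R, hence R = T or |R| > |T|. Conversely, a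
  non-surjective map factors through intervals Z properly inside T, and e_Z kills every permitted
  factor.

  The contraction need not be Lambda-linear, as the avoided minimal element is chosen separately for
  each R and each component of R \<inter> T; exactness asks for no more. Leaving I_(T-A)
  undecomposed makes the differential a signed sum of identities, and the components of T - A enter
  only for projectivity and for maps into L(C). There L(C) is modelled by the field itself, with an
  element acting through its scalar entry at (C, C): every loop C -> U -> C with U \<noteq> C is
  zero.\<close>

definition lin_map ::
  "('a, 'z) ring_scheme \<Rightarrow> ('a, 'm) module \<Rightarrow> ('a, 'n) module \<Rightarrow> ('m \<Rightarrow> 'n) \<Rightarrow> bool" where
  "lin_map R M N f \<longleftrightarrow> f \<in> carrier M \<rightarrow> carrier N \<and>
     (\<forall>x\<in>carrier M. \<forall>y\<in>carrier M. f (x \<oplus>\<^bsub>M\<^esub> y) = f x \<oplus>\<^bsub>N\<^esub> f y) \<and>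
     (\<forall>a\<in>carrier R. \<forall>x\<in>carrier M. f (a \<odot>\<^bsub>M\<^esub> x) = a \<odot>\<^bsub>N\<^esub> f x)"

text \<open>\<open>lin_map\<close> omits the extensionality built into \<open>mod_hom\<close>, so
  that composites, sums and differences can be written as plain lambda terms; this is the way
  back.\<close>

lemma mod_hom_iff: "f \<in> mod_hom R M N \<longleftrightarrow> lin_map R M N f \<and> f \<in> extensional (carrier M)"
  by (auto simp: mod_hom_def lin_map_def PiE_def)

lemma lin_mapI:
  assumes "\<And>x. x \<in> carrier M \<Longrightarrow> f x \<in> carrier N"
    and "\<And>x y. x \<in> carrier M \<Longrightarrow> y \<in> carrier M \<Longrightarrow> f (x \<oplus>\<^bsub>M\<^esub> y) = f x \<oplus>\<^bsub>N\<^esub> f y"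
    and "\<And>a x. a \<in> carrier R \<Longrightarrow> x \<in> carrier M \<Longrightarrow> f (a \<odot>\<^bsub>M\<^esub> x) = a \<odot>\<^bsub>N\<^esub> f x"
  shows "lin_map R M N f"
  using assms by (auto simp: lin_map_def)

lemma lin_map_closed: "lin_map R M N f \<Longrightarrow> x \<in> carrier M \<Longrightarrow> f x \<in> carrier N"
  and lin_map_add: "lin_map R M N f \<Longrightarrow> x \<in> carrier M \<Longrightarrow> y \<in> carrier M \<Longrightarrow>
    f (x \<oplus>\<^bsub>M\<^esub> y) = f x \<oplus>\<^bsub>N\<^esub> f y"
  and lin_map_smult: "lin_map R M N f \<Longrightarrow> a \<in> carrier R \<Longrightarrow> x \<in> carrier M \<Longrightarrow>
    f (a \<odot>\<^bsub>M\<^esub> x) = a \<odot>\<^bsub>N\<^esub> f x"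
  by (auto simp: lin_map_def)

lemma lin_map_compose:
  "lin_map R M N f \<Longrightarrow> lin_map R N L g \<Longrightarrow> lin_map R M L (\<lambda>x. g (f x))"
  by (auto simp: lin_map_def Pi_iff)

lemma left_module_abelian_group: "left_module R M \<Longrightarrow> abelian_group M"
  and left_module_ring: "left_module R M \<Longrightarrow> ring R"
  by (auto simp: left_module_def)

lemma (in abelian_group) diff_eq_zero_iff:
  "x \<in> carrier G \<Longrightarrow> y \<in> carrier G \<Longrightarrow> x \<ominus> y = \<zero> \<longleftrightarrow> x = y"
  by (metis a_inv_closed add.inv_solve_right l_zero minus_eq zero_closed)

context left_module
begin

lemma smult_l_null: "x \<in> carrier M \<Longrightarrow> \<zero>\<^bsub>R\<^esub> \<odot>\<^bsub>M\<^esub> x = \<zero>\<^bsub>M\<^esub>"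
  using smult_l_distr[of "\<zero>\<^bsub>R\<^esub>" "\<zero>\<^bsub>R\<^esub>" x] smult_closed[of "\<zero>\<^bsub>R\<^esub>" x] by simp

lemma smult_r_null: "a \<in> carrier R \<Longrightarrow> a \<odot>\<^bsub>M\<^esub> \<zero>\<^bsub>M\<^esub> = \<zero>\<^bsub>M\<^esub>"
  using smult_r_distr[of a "\<zero>\<^bsub>M\<^esub>" "\<zero>\<^bsub>M\<^esub>"] smult_closed[of a "\<zero>\<^bsub>M\<^esub>"] by simp

lemma smult_minus_one: "x \<in> carrier M \<Longrightarrow> (\<ominus>\<^bsub>R\<^esub> \<one>\<^bsub>R\<^esub>) \<odot>\<^bsub>M\<^esub> x = \<ominus>\<^bsub>M\<^esub> x"
proof -
  assume x: "x \<in> carrier M"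
  have "(\<ominus>\<^bsub>R\<^esub> \<one>\<^bsub>R\<^esub>) \<odot>\<^bsub>M\<^esub> x \<oplus>\<^bsub>M\<^esub> x = (\<ominus>\<^bsub>R\<^esub> \<one>\<^bsub>R\<^esub> \<oplus>\<^bsub>R\<^esub> \<one>\<^bsub>R\<^esub>) \<odot>\<^bsub>M\<^esub> x"
    using x by (subst smult_l_distr) (auto simp: smult_one)
  also have "\<dots> = \<zero>\<^bsub>M\<^esub>" using x by (simp add: R.l_neg smult_l_null)
  finally show ?thesis using x by (simp add: M.minus_equality smult_closed)
qed

lemma smult_r_minus: "a \<in> carrier R \<Longrightarrow> x \<in> carrier M \<Longrightarrow> a \<odot>\<^bsub>M\<^esub> (\<ominus>\<^bsub>M\<^esub> x) = \<ominus>\<^bsub>M\<^esub> (a \<odot>\<^bsub>M\<^esub> x)"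
  by (metis M.a_inv_closed M.l_neg M.minus_equality smult_closed smult_r_distr smult_r_null)

text \<open>Negation is multiplication by minus one, so closure under inverses comes from closure
  under scalars.\<close>

lemma left_submoduleI:
  assumes "U \<subseteq> carrier M" "\<zero>\<^bsub>M\<^esub> \<in> U"
    and "\<And>x y. x \<in> U \<Longrightarrow> y \<in> U \<Longrightarrow> x \<oplus>\<^bsub>M\<^esub> y \<in> U"
    and sm: "\<And>a x. a \<in> carrier R \<Longrightarrow> x \<in> U \<Longrightarrow> a \<odot>\<^bsub>M\<^esub> x \<in> U"
  shows "submodule U R M"
proof -
  have "\<ominus>\<^bsub>M\<^esub> x \<in> U" if "x \<in> U" for x
    using sm[of "\<ominus>\<^bsub>R\<^esub> \<one>\<^bsub>R\<^esub>" x] that assms(1) smult_minus_one[of x] by auto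
  then show ?thesis
    using assms unfolding submodule_def submodule_axioms_def
    by (auto intro!: subgroup.intro simp: a_inv_def)
qed

lemma submodule_carrier: "submodule (carrier M) R M"
  by (rule left_submoduleI) (auto simp: smult_closed)

lemma submodule_zero: "submodule {\<zero>\<^bsub>M\<^esub>} R M"
  by (rule left_submoduleI) (auto simp: smult_r_null)

end

lemma submodule_subset: "submodule U R M \<Longrightarrow> U \<subseteq> carrier M"
  and submodule_zero_mem: "submodule U R M \<Longrightarrow> \<zero>\<^bsub>M\<^esub> \<in> U"
  and submodule_add: "submodule U R M \<Longrightarrow> x \<in> U \<Longrightarrow> y \<in> U \<Longrightarrow> x \<oplus>\<^bsub>M\<^esub> y \<in> U"
  and submodule_inv: "submodule U R M \<Longrightarrow> x \<in> U \<Longrightarrow> \<ominus>\<^bsub>M\<^esub> x \<in> U"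
  and submodule_smult: "submodule U R M \<Longrightarrow> a \<in> carrier R \<Longrightarrow> x \<in> U \<Longrightarrow> a \<odot>\<^bsub>M\<^esub> x \<in> U"
  by (auto simp: submodule_def submodule_axioms_def subgroup_def a_inv_def)

lemma left_module_submodule:
  assumes "left_module R M" "submodule U R M"
  shows "left_module R (M\<lparr>carrier := U\<rparr>)"
proof -
  interpret left_module R M by fact
  note sub = submodule_subset[OF assms(2)]
  have "abelian_group (M\<lparr>carrier := U\<rparr>)"
  proof (rule abelian_groupI)
    fix x assume "x \<in> carrier (M\<lparr>carrier := U\<rparr>)"
    then show "\<exists>y\<in>carrier (M\<lparr>carrier := U\<rparr>). y \<oplus>\<^bsub>M\<lparr>carrier := U\<rparr>\<^esub> x = \<zero>\<^bsub>M\<lparr>carrier := U\<rparr>\<^esub>"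
      using sub by (intro bexI[of _ "\<ominus>\<^bsub>M\<^esub> x"]) (auto simp: M.l_neg submodule_inv[OF assms(2)])
  qed (use sub in \<open>auto simp: submodule_add[OF assms(2)] submodule_zero_mem[OF assms(2)]
        M.a_ac subset_iff\<close>)
  moreover have "left_module_axioms R (M\<lparr>carrier := U\<rparr>)"
    using sub by unfold_locales (auto simp: submodule_smult[OF assms(2)] smult_l_distr
      smult_r_distr smult_assoc1 smult_one subset_iff)
  ultimately show ?thesis by (simp add: left_module_def R.ring_axioms)
qed

lemma submodule_restrict:
  assumes "left_module R M" "submodule U R M" "submodule V R M" "U \<subseteq> V"
  shows "submodule U R (M\<lparr>carrier := V\<rparr>)"
proof -
  interpret left_module R "M\<lparr>carrier := V\<rparr>" by (rule left_module_submodule) fact+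
  show ?thesis
    by (rule left_submoduleI)
      (use assms submodule_zero_mem[OF assms(2)] in
        \<open>auto simp: submodule_add[OF assms(2)] submodule_smult[OF assms(2)]\<close>)
qed

lemma lin_map_zero:
  assumes "left_module R M" "left_module R N" "lin_map R M N f"
  shows "f \<zero>\<^bsub>M\<^esub> = \<zero>\<^bsub>N\<^esub>"
proof -
  interpret M: left_module R M by fact
  interpret N: left_module R N by fact
  show ?thesis
    using lin_map_add[OF assms(3), of "\<zero>\<^bsub>M\<^esub>" "\<zero>\<^bsub>M\<^esub>"] lin_map_closed[OF assms(3), of "\<zero>\<^bsub>M\<^esub>"] by simp
qed

lemma lin_map_inv:
  assumes "left_module R M" "left_module R N" "lin_map R M N f" "x \<in> carrier M"
  shows "f (\<ominus>\<^bsub>M\<^esub> x) = \<ominus>\<^bsub>N\<^esub> f x"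
proof -
  interpret M: left_module R M by fact
  interpret N: left_module R N by fact
  have "f (\<ominus>\<^bsub>M\<^esub> x) \<oplus>\<^bsub>N\<^esub> f x = \<zero>\<^bsub>N\<^esub>"
    using lin_map_add[OF assms(3), of "\<ominus>\<^bsub>M\<^esub> x" x] assms(4) lin_map_zero[OF assms(1-3)]
    by (simp add: M.l_neg)
  then show ?thesis
    using lin_map_closed[OF assms(3)] assms(4) by (simp add: N.minus_equality)
qed

lemma lin_map_minus:
  assumes "left_module R M" "left_module R N" "lin_map R M N f" "x \<in> carrier M" "y \<in> carrier M"
  shows "f (x \<ominus>\<^bsub>M\<^esub> y) = f x \<ominus>\<^bsub>N\<^esub> f y"
proof -
  interpret M: left_module R M by fact
  show ?thesis
    using assms lin_map_add[OF assms(3), of x "\<ominus>\<^bsub>M\<^esub> y"] lin_map_inv[OF assms(1-3)]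
    by (simp add: a_minus_def)
qed

lemma lin_map_diff:
  assumes "left_module R M" "left_module R N" "lin_map R M N f" "lin_map R M N g"
  shows "lin_map R M N (\<lambda>x. f x \<ominus>\<^bsub>N\<^esub> g x)"
proof -
  interpret M: left_module R M by fact
  interpret N: left_module R N by fact
  note c = lin_map_closed[OF assms(3)] lin_map_closed[OF assms(4)]
  show ?thesis
  proof (rule lin_mapI)
    fix x y assume "x \<in> carrier M" "y \<in> carrier M"
    then show "f (x \<oplus>\<^bsub>M\<^esub> y) \<ominus>\<^bsub>N\<^esub> g (x \<oplus>\<^bsub>M\<^esub> y) = f x \<ominus>\<^bsub>N\<^esub> g x \<oplus>\<^bsub>N\<^esub> (f y \<ominus>\<^bsub>N\<^esub> g y)"
      using c by (simp add: lin_map_add[OF assms(3)] lin_map_add[OF assms(4)] a_minus_def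
          N.minus_add N.a_ac)
  qed (use c in \<open>auto simp: lin_map_smult[OF assms(3)] lin_map_smult[OF assms(4)] a_minus_def
          N.smult_r_distr N.smult_r_minus\<close>)
qed

lemma lin_map_sum:
  assumes "left_module R N" "lin_map R M N f" "lin_map R M N g"
  shows "lin_map R M N (\<lambda>x. f x \<oplus>\<^bsub>N\<^esub> g x)"
proof -
  interpret N: left_module R N by fact
  note c = lin_map_closed[OF assms(2)] lin_map_closed[OF assms(3)]
  show ?thesis
    by (rule lin_mapI) (use c in \<open>auto simp: lin_map_add[OF assms(2)] lin_map_add[OF assms(3)]
          lin_map_smult[OF assms(2)] lin_map_smult[OF assms(3)] N.smult_r_distr N.a_ac\<close>)
qed

lemma submodule_vimage:
  assumes "left_module R M" "left_module R N" "lin_map R M N f" "submodule U R N"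
  shows "submodule {x \<in> carrier M. f x \<in> U} R M"
proof -
  interpret M: left_module R M by fact
  show ?thesis
    by (rule M.left_submoduleI)
      (auto simp: lin_map_zero[OF assms(1-3)] submodule_zero_mem[OF assms(4)] M.smult_closed
        lin_map_add[OF assms(3)] lin_map_smult[OF assms(3)] submodule_add[OF assms(4)]
        submodule_smult[OF assms(4)])
qed

lemma submodule_image:
  assumes "left_module R M" "left_module R N" "lin_map R M N f" "submodule U R M"
  shows "submodule (f ` U) R N"
proof -
  interpret M: left_module R M by fact
  interpret N: left_module R N by fact
  note sub = subsetD[OF submodule_subset[OF assms(4)]]
  show ?thesis
  proof (rule N.left_submoduleI)
    show "f ` U \<subseteq> carrier N" using sub lin_map_closed[OF assms(3)] by auto
    show "\<zero>\<^bsub>N\<^esub> \<in> f ` U" using lin_map_zero[OF assms(1-3)] submodule_zero_mem[OF assms(4)] by force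
    fix x y assume "x \<in> f ` U" "y \<in> f ` U"
    then obtain u v where "u \<in> U" "v \<in> U" "x = f u" "y = f v" by auto
    then show "x \<oplus>\<^bsub>N\<^esub> y \<in> f ` U"
      using lin_map_add[OF assms(3) sub sub] submodule_add[OF assms(4)] by (metis image_eqI)
  next
    fix a x assume a: "a \<in> carrier R" and "x \<in> f ` U"
    then obtain u where "u \<in> U" "x = f u" by auto
    then show "a \<odot>\<^bsub>N\<^esub> x \<in> f ` U"
      using lin_map_smult[OF assms(3) a sub] submodule_smult[OF assms(4) a] by (metis image_eqI)
  qed
qed

subsection \<open>Quotients\<close>

lemma quotient_module_simps:
  "carrier (quotient_module M U) = a_rcosets\<^bsub>M\<^esub> U"
  "\<zero>\<^bsub>quotient_module M U\<^esub> = U"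
  "X \<oplus>\<^bsub>quotient_module M U\<^esub> Y = X <+>\<^bsub>M\<^esub> Y"
  "a \<odot>\<^bsub>quotient_module M U\<^esub> Y = (\<Union>x\<in>Y. U +>\<^bsub>M\<^esub> (a \<odot>\<^bsub>M\<^esub> x))"
  by (simp_all add: quotient_module_def)

lemma abelian_subgroupI_subgroup:
  assumes "abelian_group M" "subgroup U (add_monoid M)"
  shows "abelian_subgroup U M"
  using assms by (intro abelian_subgroupI3 additive_subgroupI)

lemma carrier_quotient_module:
  "carrier (quotient_module M U) = (\<lambda>x. U +>\<^bsub>M\<^esub> x) ` carrier M"
  by (auto simp: quotient_module_simps A_RCOSETS_def')

lemma abelian_group_quotient_module:
  assumes "abelian_group M" "subgroup U (add_monoid M)"
  shows "abelian_group (quotient_module M U)"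
proof -
  interpret abelian_subgroup U M by (rule abelian_subgroupI_subgroup) fact+
  have U: "U = U +>\<^bsub>M\<^esub> \<zero>\<^bsub>M\<^esub>" using a_subset by simp
  show ?thesis
  proof (rule abelian_groupI; (unfold carrier_quotient_module quotient_module_simps)?)
    fix X assume "X \<in> (\<lambda>x. U +>\<^bsub>M\<^esub> x) ` carrier M"
    then obtain x where "x \<in> carrier M" "X = U +>\<^bsub>M\<^esub> x" by auto
    then show "\<exists>Y\<in>(\<lambda>x. U +>\<^bsub>M\<^esub> x) ` carrier M. Y <+>\<^bsub>M\<^esub> X = U"
      using U by (intro bexI[of _ "U +>\<^bsub>M\<^esub> (\<ominus>\<^bsub>M\<^esub> x)"]) (auto simp: a_rcos_sum l_neg)
  next
    show "U \<in> (\<lambda>x. U +>\<^bsub>M\<^esub> x) ` carrier M" using U by blast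
  next
    fix X assume "X \<in> (\<lambda>x. U +>\<^bsub>M\<^esub> x) ` carrier M"
    then show "U <+>\<^bsub>M\<^esub> X = X" by (subst U) (auto simp: a_rcos_sum)
  qed (auto simp: a_rcos_sum a_ac)
qed

lemma quotient_module_add:
  assumes "abelian_group M" "subgroup U (add_monoid M)" "x \<in> carrier M" "y \<in> carrier M"
  shows "(U +>\<^bsub>M\<^esub> x) \<oplus>\<^bsub>quotient_module M U\<^esub> (U +>\<^bsub>M\<^esub> y) = U +>\<^bsub>M\<^esub> (x \<oplus>\<^bsub>M\<^esub> y)"
proof -
  interpret abelian_subgroup U M by (rule abelian_subgroupI_subgroup) fact+
  show ?thesis using assms by (simp add: quotient_module_simps a_rcos_sum)
qed

lemma coset_eq_iff:
  assumes "abelian_group M" "subgroup U (add_monoid M)" "x \<in> carrier M" "y \<in> carrier M"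
  shows "U +>\<^bsub>M\<^esub> x = U +>\<^bsub>M\<^esub> y \<longleftrightarrow> x \<ominus>\<^bsub>M\<^esub> y \<in> U"
proof -
  interpret abelian_subgroup U M by (rule abelian_subgroupI_subgroup) fact+
  show ?thesis
    using a_rcos_module[OF assms(4,3)] a_repr_independence'[of x y] a_repr_independenceD[of x y]
      assms(3,4)
    by (auto simp: minus_eq)
qed

lemma coset_eq_self_iff:
  assumes "abelian_group M" "subgroup U (add_monoid M)" "x \<in> carrier M"
  shows "U +>\<^bsub>M\<^esub> x = U \<longleftrightarrow> x \<in> U"
proof -
  interpret abelian_subgroup U M by (rule abelian_subgroupI_subgroup) fact+
  show ?thesis
    using assms(3) coset_eq_iff[OF assms, of "\<zero>\<^bsub>M\<^esub>"] a_subset minus_equality[of "\<zero>\<^bsub>M\<^esub>" "\<zero>\<^bsub>M\<^esub>"]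
    by (simp add: minus_eq)
qed

text \<open>All representatives of a coset yield the same coset after multiplication, so the union
  defining the scalar action collapses to one of its members.\<close>

lemma quotient_module_smult:
  assumes "abelian_group M" "subgroup U (add_monoid M)" "x \<in> carrier M"
    and cl: "\<And>x. x \<in> carrier M \<Longrightarrow> a \<odot>\<^bsub>M\<^esub> x \<in> carrier M"
    and d: "\<And>x y. x \<in> carrier M \<Longrightarrow> y \<in> carrier M \<Longrightarrow>
      a \<odot>\<^bsub>M\<^esub> (x \<oplus>\<^bsub>M\<^esub> y) = a \<odot>\<^bsub>M\<^esub> x \<oplus>\<^bsub>M\<^esub> a \<odot>\<^bsub>M\<^esub> y"
    and u: "\<And>x. x \<in> U \<Longrightarrow> a \<odot>\<^bsub>M\<^esub> x \<in> U"
  shows "a \<odot>\<^bsub>quotient_module M U\<^esub> (U +>\<^bsub>M\<^esub> x) = U +>\<^bsub>M\<^esub> (a \<odot>\<^bsub>M\<^esub> x)"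
proof -
  interpret abelian_subgroup U M by (rule abelian_subgroupI_subgroup) fact+
  have "U +>\<^bsub>M\<^esub> (a \<odot>\<^bsub>M\<^esub> y) = U +>\<^bsub>M\<^esub> (a \<odot>\<^bsub>M\<^esub> x)" if y: "y \<in> U +>\<^bsub>M\<^esub> x" for y
  proof -
    obtain w where w: "w \<in> U" "y = w \<oplus>\<^bsub>M\<^esub> x" using y by (auto simp: a_r_coset_def')
    have "a \<odot>\<^bsub>M\<^esub> y \<in> U +>\<^bsub>M\<^esub> (a \<odot>\<^bsub>M\<^esub> x)"
      using w u d assms(3) a_subset by (auto simp: a_r_coset_def')
    then show ?thesis using a_repr_independence'[OF _ cl[OF assms(3)]] by simp
  qed
  moreover have "x \<in> U +>\<^bsub>M\<^esub> x" using assms(3) by (rule a_rcos_self)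
  ultimately show ?thesis unfolding quotient_module_simps by blast
qed

lemma submodule_subgroup: "submodule U R M \<Longrightarrow> subgroup U (add_monoid M)"
  by (simp add: submodule_def)

context
  fixes R :: "('a, 'z) ring_scheme" and M :: "('a, 'm) module" and U
  assumes lm: "left_module R M" and su: "submodule U R M"
begin

lemma quotient_smult:
  "a \<in> carrier R \<Longrightarrow> x \<in> carrier M \<Longrightarrow>
    a \<odot>\<^bsub>quotient_module M U\<^esub> (U +>\<^bsub>M\<^esub> x) = U +>\<^bsub>M\<^esub> (a \<odot>\<^bsub>M\<^esub> x)"
  by (rule quotient_module_smult)
    (auto intro: lm su submodule_smult submodule_subgroup left_module_abelian_group
      left_module.smult_closed left_module.smult_r_distr)

lemma quotient_add:
  "x \<in> carrier M \<Longrightarrow> y \<in> carrier M \<Longrightarrow>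
    (U +>\<^bsub>M\<^esub> x) \<oplus>\<^bsub>quotient_module M U\<^esub> (U +>\<^bsub>M\<^esub> y) = U +>\<^bsub>M\<^esub> (x \<oplus>\<^bsub>M\<^esub> y)"
  by (rule quotient_module_add)
    (auto intro: lm su submodule_subgroup left_module_abelian_group)

lemma quotient_eq_zero_iff: "x \<in> carrier M \<Longrightarrow> U +>\<^bsub>M\<^esub> x = U \<longleftrightarrow> x \<in> U"
  by (rule coset_eq_self_iff) (auto intro: lm su submodule_subgroup left_module_abelian_group)

lemma quotient_eq_iff:
  "x \<in> carrier M \<Longrightarrow> y \<in> carrier M \<Longrightarrow> U +>\<^bsub>M\<^esub> x = U +>\<^bsub>M\<^esub> y \<longleftrightarrow> x \<ominus>\<^bsub>M\<^esub> y \<in> U"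
  by (rule coset_eq_iff) (auto intro: lm su submodule_subgroup left_module_abelian_group)

lemma lin_map_quotient: "lin_map R M (quotient_module M U) (\<lambda>x. U +>\<^bsub>M\<^esub> x)"
  by (rule lin_mapI) (auto simp: quotient_smult quotient_add carrier_quotient_module)

lemma left_module_quotient: "left_module R (quotient_module M U)"
proof -
  interpret left_module R M by (fact lm)
  have "left_module_axioms R (quotient_module M U)"
    by unfold_locales
      (auto simp: carrier_quotient_module quotient_smult quotient_add smult_closed smult_l_distr
        smult_r_distr smult_assoc1 smult_one)
  moreover have "abelian_group (quotient_module M U)"
    by (intro abelian_group_quotient_module submodule_subgroup[OF su] M.abelian_group_axioms)
  ultimately show ?thesis by (simp add: left_module_def R.ring_axioms)
qed

end

text \<open>First isomorphism theorem; the induced map evaluates \<open>f\<close> at a chosen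
  representative.\<close>

lemma mod_iso_quotient:
  assumes lm: "left_module R M" and ln: "left_module R N" and f: "lin_map R M N f"
    and sur: "f ` carrier M = carrier N"
  shows "mod_iso R (quotient_module M {x \<in> carrier M. f x = \<zero>\<^bsub>N\<^esub>}) N"
proof -
  let ?U = "{x \<in> carrier M. f x = \<zero>\<^bsub>N\<^esub>}"
  interpret M: left_module R M by fact
  interpret N: left_module R N by fact
  have su: "submodule ?U R M"
    using submodule_vimage[OF lm ln f N.submodule_zero] by simp
  interpret Q: left_module R "quotient_module M ?U" by (rule left_module_quotient[OF lm su])
  note q = carrier_quotient_module quotient_smult[OF lm su] quotient_add[OF lm su]
  define g where "g = (\<lambda>X\<in>carrier (quotient_module M ?U). f (SOME x. x \<in> X))"
  have eq: "?U +>\<^bsub>M\<^esub> x = ?U +>\<^bsub>M\<^esub> y \<longleftrightarrow> f x = f y" if "x \<in> carrier M" "y \<in> carrier M" for x y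
    using that lin_map_closed[OF f]
    by (auto simp: quotient_eq_iff[OF lm su] lin_map_minus[OF lm ln f] N.diff_eq_zero_iff)
  have g: "g (?U +>\<^bsub>M\<^esub> x) = f x" if x: "x \<in> carrier M" for x
  proof -
    interpret abelian_subgroup ?U M
      by (intro abelian_subgroupI_subgroup submodule_subgroup[OF su] M.abelian_group_axioms)
    let ?y = "SOME y. y \<in> ?U +>\<^bsub>M\<^esub> x"
    have y: "?y \<in> ?U +>\<^bsub>M\<^esub> x" using a_rcos_self[OF x] by (rule someI)
    then have yc: "?y \<in> carrier M" using x by (rule a_elemrcos_carrier[rotated])
    have "?U +>\<^bsub>M\<^esub> ?y = ?U +>\<^bsub>M\<^esub> x" using a_repr_independence'[OF y x] by (rule sym)
    then have "f ?y = f x" using eq[OF yc x] by (rule iffD1[rotated])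
    moreover have "?U +>\<^bsub>M\<^esub> x \<in> carrier (quotient_module M ?U)"
      unfolding carrier_quotient_module using x by (rule imageI)
    ultimately show ?thesis unfolding g_def by (simp only: restrict_apply if_True)
  qed
  have "lin_map R (quotient_module M ?U) N g"
    by (rule lin_mapI)
      (auto simp: q g lin_map_closed[OF f] lin_map_add[OF f] lin_map_smult[OF f] M.smult_closed)
  moreover have "g \<in> extensional (carrier (quotient_module M ?U))" by (simp add: g_def)
  moreover have "bij_betw g (carrier (quotient_module M ?U)) (carrier N)"
    unfolding bij_betw_def
  proof
    show "inj_on g (carrier (quotient_module M ?U))"
      by (auto simp: inj_on_def carrier_quotient_module g eq)
    show "g ` carrier (quotient_module M ?U) = carrier N"
      by (simp add: carrier_quotient_module image_image g flip: sur)
  qed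
  ultimately show ?thesis unfolding mod_iso_def by (auto simp: mod_hom_iff)
qed

lemma mod_isoE:
  assumes "mod_iso R M N"
  obtains f where "lin_map R M N f" "bij_betw f (carrier M) (carrier N)"
  using assms by (auto simp: mod_iso_def mod_hom_iff)

lemma lin_map_the_inv_into:
  assumes lm: "left_module R M" and f: "lin_map R M N f" and b: "bij_betw f (carrier M) (carrier N)"
  shows "lin_map R N M (the_inv_into (carrier M) f)"
proof -
  interpret M: left_module R M by fact
  let ?g = "the_inv_into (carrier M) f"
  have gf: "?g (f x) = x" if "x \<in> carrier M" for x
    using that b by (simp add: bij_betw_def the_inv_into_f_f)
  have N: "\<exists>u\<in>carrier M. x = f u" if "x \<in> carrier N" for x
    using b that by (auto simp: bij_betw_def)
  show ?thesis
  proof (rule lin_mapI)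
    show "?g x \<in> carrier M" if "x \<in> carrier N" for x using N[OF that] gf by auto
    show "?g (x \<oplus>\<^bsub>N\<^esub> y) = ?g x \<oplus>\<^bsub>M\<^esub> ?g y" if "x \<in> carrier N" "y \<in> carrier N" for x y
      using N[OF that(1)] N[OF that(2)] gf lin_map_add[OF f] by (metis M.add.m_closed)
    show "?g (a \<odot>\<^bsub>N\<^esub> x) = a \<odot>\<^bsub>M\<^esub> ?g x" if "a \<in> carrier R" "x \<in> carrier N" for a x
      using N[OF that(2)] that(1) gf lin_map_smult[OF f] M.smult_closed by metis
  qed
qed

lemma mod_iso_inverse:
  assumes lm: "left_module R M" and iso: "mod_iso R M N"
  obtains f g where "lin_map R M N f" "lin_map R N M g"
    "\<And>x. x \<in> carrier M \<Longrightarrow> g (f x) = x" "\<And>y. y \<in> carrier N \<Longrightarrow> f (g y) = y"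
proof -
  obtain f where f: "lin_map R M N f" and b: "bij_betw f (carrier M) (carrier N)"
    using iso by (rule mod_isoE)
  then show ?thesis
    using that[OF f lin_map_the_inv_into[OF lm f b]]
    by (simp add: bij_betw_def the_inv_into_f_f f_the_inv_into_f)
qed

lemma lin_map_cong:
  assumes "left_module R M" "lin_map R M N f" "\<And>x. x \<in> carrier M \<Longrightarrow> f x = g x"
  shows "lin_map R M N g"
proof -
  interpret left_module R M by fact
  show ?thesis
    by (rule lin_mapI)
      (simp_all add: assms(3)[symmetric] smult_closed lin_map_closed[OF assms(2)]
        lin_map_add[OF assms(2)] lin_map_smult[OF assms(2)])
qed

lemma mod_iso_sym:
  assumes lm: "left_module R M" and ln: "left_module R N" and iso: "mod_iso R M N"
  shows "mod_iso R N M"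
proof -
  obtain f g where f: "lin_map R M N f" and g: "lin_map R N M g"
    and gf: "\<And>x. x \<in> carrier M \<Longrightarrow> g (f x) = x" and fg: "\<And>y. y \<in> carrier N \<Longrightarrow> f (g y) = y"
    using mod_iso_inverse[OF lm iso] by metis
  let ?g = "restrict g (carrier N)"
  have "?g \<in> mod_hom R N M" using lin_map_cong[OF ln g, of ?g] by (simp add: mod_hom_iff)
  moreover have "bij_betw ?g (carrier N) (carrier M)"
    by (rule bij_betw_byWitness[where f' = f])
      (use gf fg lin_map_closed[OF f] lin_map_closed[OF g] in auto)
  ultimately show ?thesis unfolding mod_iso_def by (intro bexI[of _ ?g])
qed

subsection \<open>Projective modules\<close>

lemma free_module_simps:
  "carrier (free_module R n) = {..<n} \<rightarrow>\<^sub>E carrier R"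
  "\<zero>\<^bsub>free_module R n\<^esub> = (\<lambda>i\<in>{..<n}. \<zero>\<^bsub>R\<^esub>)"
  "v \<oplus>\<^bsub>free_module R n\<^esub> w = (\<lambda>i\<in>{..<n}. v i \<oplus>\<^bsub>R\<^esub> w i)"
  "a \<odot>\<^bsub>free_module R n\<^esub> v = (\<lambda>i\<in>{..<n}. a \<otimes>\<^bsub>R\<^esub> v i)"
  by (simp_all add: free_module_def)

lemma PiE_lessThan_iff:
  "v \<in> {..<n} \<rightarrow>\<^sub>E A \<longleftrightarrow> (\<forall>i<n. v i \<in> A) \<and> (\<forall>i. \<not> i < n \<longrightarrow> v i = undefined)"
  by (auto simp: PiE_def extensional_def Pi_iff)

lemma left_module_free_module:
  assumes "ring R"
  shows "left_module R (free_module R n)"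
proof -
  interpret ring R by fact
  note mem = PiE_lessThan_iff[of _ n "carrier R"]
  have "abelian_group (free_module R n)"
  proof (rule abelian_groupI; unfold free_module_simps)
    fix x assume x: "x \<in> {..<n} \<rightarrow>\<^sub>E carrier R"
    show "\<exists>y\<in>{..<n} \<rightarrow>\<^sub>E carrier R. (\<lambda>i\<in>{..<n}. y i \<oplus>\<^bsub>R\<^esub> x i) = (\<lambda>i\<in>{..<n}. \<zero>\<^bsub>R\<^esub>)"
      by (rule bexI[of _ "\<lambda>i\<in>{..<n}. \<ominus>\<^bsub>R\<^esub> x i"])
        (use x in \<open>auto simp: l_neg mem fun_eq_iff restrict_def\<close>)
  qed (simp_all add: mem a_ac fun_eq_iff restrict_def)
  moreover have "left_module_axioms R (free_module R n)"
    by unfold_locales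
      (simp_all add: free_module_simps mem l_distr r_distr m_assoc fun_eq_iff restrict_def)
  ultimately show ?thesis using assms by (simp add: left_module_def)
qed

text \<open>Induction on \<open>j\<close> lifts \<open>f\<close> precomposed with the truncation
  \<open>t j\<close> to the first \<open>j\<close> coordinates; each step adds the multiple of a
  preimage of \<open>f (e j)\<close> by the \<open>j\<close>-th coordinate, and \<open>t n\<close>
  is the identity.\<close>

lemma free_module_lift:
  assumes lm: "left_module R M" and ln: "left_module R N"
    and f: "lin_map R (free_module R n) N f" and g: "lin_map R M N g"
    and im: "f ` carrier (free_module R n) \<subseteq> g ` carrier M"
  shows "\<exists>h. lin_map R (free_module R n) M h \<and> (\<forall>v\<in>carrier (free_module R n). g (h v) = f v)"
proof -
  let ?F = "free_module R n"
  interpret M: left_module R M by fact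
  interpret N: left_module R N by fact
  have lF: "left_module R ?F" by (rule left_module_free_module) (rule M.R.ring_axioms)
  define e where "e j = (\<lambda>i\<in>{..<n}. if i = j then \<one>\<^bsub>R\<^esub> else \<zero>\<^bsub>R\<^esub>)" for j
  define t where "t j v = (\<lambda>i\<in>{..<n}. if i < j then v i else \<zero>\<^bsub>R\<^esub>)" for j and v :: "nat \<Rightarrow> 'a"
  have e: "e j \<in> carrier ?F" for j by (simp add: e_def free_module_simps PiE_lessThan_iff)
  have t: "t j v \<in> carrier ?F" if "v \<in> carrier ?F" for j v
    using that by (simp add: t_def free_module_simps PiE_lessThan_iff)
  have "j \<le> n \<Longrightarrow> \<exists>h. lin_map R ?F M h \<and> (\<forall>v\<in>carrier ?F. g (h v) = f (t j v))" for j
  proof (induction j)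
    case 0
    have "lin_map R ?F M (\<lambda>v. \<zero>\<^bsub>M\<^esub>)" by (rule lin_mapI) (auto simp: M.smult_r_null)
    moreover have "t 0 v = \<zero>\<^bsub>?F\<^esub>" for v by (simp add: t_def free_module_simps)
    ultimately show ?case using lin_map_zero[OF lF ln f] lin_map_zero[OF lm ln g] by auto
  next
    case (Suc j)
    then obtain h where h: "lin_map R ?F M h" "\<And>v. v \<in> carrier ?F \<Longrightarrow> g (h v) = f (t j v)" by auto
    obtain m where m: "m \<in> carrier M" "g m = f (e j)" using im e[of j] by (metis image_iff subsetD)
    from Suc.prems have j: "j < n" by simp
    have s: "lin_map R ?F M (\<lambda>v. v j \<odot>\<^bsub>M\<^esub> m)"
      by (rule lin_mapI)
        (auto simp: free_module_simps PiE_lessThan_iff j m M.smult_l_distr M.smult_assoc1 intro!: M.smult_closed)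
    have "g (h v \<oplus>\<^bsub>M\<^esub> v j \<odot>\<^bsub>M\<^esub> m) = f (t (Suc j) v)" if v: "v \<in> carrier ?F" for v
    proof -
      have vj: "v j \<in> carrier R" using v j by (simp add: free_module_simps PiE_lessThan_iff)
      have "t (Suc j) v = t j v \<oplus>\<^bsub>?F\<^esub> (v j \<odot>\<^bsub>?F\<^esub> e j)"
        using v vj j by (auto simp: t_def e_def free_module_simps PiE_lessThan_iff less_Suc_eq fun_eq_iff restrict_def)
      then have "f (t (Suc j) v) = f (t j v) \<oplus>\<^bsub>N\<^esub> v j \<odot>\<^bsub>N\<^esub> f (e j)"
        using t[OF v] vj e by (simp add: lin_map_add[OF f] lin_map_smult[OF f] left_module.smult_closed[OF lF])
      then show ?thesis
        using v vj m lin_map_closed[OF h(1)] by (simp add: lin_map_add[OF g] lin_map_smult[OF g] h(2) M.smult_closed)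
    qed
    then show ?case using lin_map_sum[OF lm h(1) s] by blast
  qed
  from this[of n] obtain h where "lin_map R ?F M h" "\<And>v. v \<in> carrier ?F \<Longrightarrow> g (h v) = f (t n v)" by auto
  moreover have "t n v = v" if "v \<in> carrier ?F" for v
    using that by (auto simp: t_def free_module_simps fun_eq_iff restrict_def PiE_lessThan_iff)
  ultimately show ?thesis by auto
qed

text \<open>Lift \<open>f\<close> after the retraction \<open>q\<close> over the free module, then
  precompose with the section \<open>i\<close>. Inclusion of images instead of surjectivity of
  \<open>g\<close> is what exactness of a resolution provides.\<close>

lemma fg_projective_lift:
  assumes P: "fg_projective R P" and lm: "left_module R M" and ln: "left_module R N"
    and f: "lin_map R P N f" and g: "lin_map R M N g" and im: "f ` carrier P \<subseteq> g ` carrier M"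
  shows "\<exists>h. lin_map R P M h \<and> (\<forall>x\<in>carrier P. g (h x) = f x)"
proof -
  obtain n i q where i: "lin_map R P (free_module R n) i" and q: "lin_map R (free_module R n) P q"
    and qi: "\<And>x. x \<in> carrier P \<Longrightarrow> q (i x) = x"
    using P by (auto simp: fg_projective_def mod_hom_iff)
  have "\<exists>h. lin_map R (free_module R n) M h \<and> (\<forall>v\<in>carrier (free_module R n). g (h v) = f (q v))"
    by (rule free_module_lift[OF lm ln lin_map_compose[OF q f] g])
      (use im lin_map_closed[OF q] in auto)
  then obtain h where h: "lin_map R (free_module R n) M h"
    "\<And>v. v \<in> carrier (free_module R n) \<Longrightarrow> g (h v) = f (q v)" by auto
  then show ?thesis
    using lin_map_compose[OF i h(1)] lin_map_closed[OF i] qi by (intro exI[of _ "\<lambda>x. h (i x)"]) auto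
qed

subsection \<open>Comparison of projective resolutions\<close>

lemma projective_resolutionD:
  assumes "projective_resolution R M P d e"
  shows "fg_projective R (P n)" "left_module R (P n)" "lin_map R (P (Suc n)) (P n) (d n)"
    "lin_map R (P 0) M e" "e ` carrier (P 0) = carrier M"
    "d 0 ` carrier (P (Suc 0)) = {x \<in> carrier (P 0). e x = \<zero>\<^bsub>M\<^esub>}"
    "d (Suc n) ` carrier (P (Suc (Suc n))) = {x \<in> carrier (P (Suc n)). d n x = \<zero>\<^bsub>P n\<^esub>}"
  using assms by (auto simp: projective_resolution_def mod_hom_iff fg_projective_def)

lemma projective_resolution_comp_zero:
  assumes "projective_resolution R M P d e"
  shows "x \<in> carrier (P (Suc 0)) \<Longrightarrow> e (d 0 x) = \<zero>\<^bsub>M\<^esub>"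
    and "x \<in> carrier (P (Suc (Suc n))) \<Longrightarrow> d n (d (Suc n) x) = \<zero>\<^bsub>P n\<^esub>"
  using projective_resolutionD(6,7)[OF assms] by blast+

lemma resolution_lift:
  assumes lm: "left_module R M"
    and P: "projective_resolution R M P d e" and Q: "projective_resolution R M Q d' e'"
  shows "\<exists>\<phi>. (\<forall>n. lin_map R (P n) (Q n) (\<phi> n)) \<and> (\<forall>x\<in>carrier (P 0). e' (\<phi> 0 x) = e x) \<and>
    (\<forall>n. \<forall>x\<in>carrier (P (Suc n)). \<phi> n (d n x) = d' n (\<phi> (Suc n) x))"
proof -
  note p = projective_resolutionD[OF P] and q = projective_resolutionD[OF Q]
  \<comment> \<open>The invariant of the recursion contains the inclusion of images that the next
    lifting step requires; compatibility with the augmentations concerns only the start.\<close>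
  have "\<exists>\<phi>. \<forall>n. (lin_map R (P n) (Q n) (\<phi> n) \<and> (n = 0 \<longrightarrow> (\<forall>x\<in>carrier (P 0). e' (\<phi> n x) = e x)) \<and>
      (\<forall>x\<in>carrier (P (Suc n)). \<phi> n (d n x) \<in> d' n ` carrier (Q (Suc n)))) \<and>
    (\<forall>x\<in>carrier (P (Suc n)). \<phi> n (d n x) = d' n (\<phi> (Suc n) x))"
  proof (rule dependent_nat_choice)
    obtain f where f: "lin_map R (P 0) (Q 0) f" "\<forall>x\<in>carrier (P 0). e' (f x) = e x"
      using fg_projective_lift[OF p(1) q(2) lm p(4) q(4)] p(5) q(5) by blast
    have "f (d 0 x) \<in> d' 0 ` carrier (Q (Suc 0))" if "x \<in> carrier (P (Suc 0))" for x
      unfolding q(6) using f that projective_resolution_comp_zero(1)[OF P]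
        lin_map_closed[OF f(1)] lin_map_closed[OF p(3)] by auto
    with f show "\<exists>f. lin_map R (P 0) (Q 0) f \<and> (0 = 0 \<longrightarrow> (\<forall>x\<in>carrier (P 0). e' (f x) = e x)) \<and>
      (\<forall>x\<in>carrier (P (Suc 0)). f (d 0 x) \<in> d' 0 ` carrier (Q (Suc 0)))" by blast
  next
    fix f n assume f: "lin_map R (P n) (Q n) f \<and> (n = 0 \<longrightarrow> (\<forall>x\<in>carrier (P 0). e' (f x) = e x)) \<and>
      (\<forall>x\<in>carrier (P (Suc n)). f (d n x) \<in> d' n ` carrier (Q (Suc n)))"
    obtain f' where f': "lin_map R (P (Suc n)) (Q (Suc n)) f'"
      "\<forall>x\<in>carrier (P (Suc n)). d' n (f' x) = f (d n x)"
      using fg_projective_lift[OF p(1) q(2) q(2) lin_map_compose[OF p(3)] q(3), of n n f] f by blast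
    have "f' (d (Suc n) x) \<in> d' (Suc n) ` carrier (Q (Suc (Suc n)))"
      if x: "x \<in> carrier (P (Suc (Suc n)))" for x
    proof -
      have "d' n (f' (d (Suc n) x)) = f (d n (d (Suc n) x))"
        using f' lin_map_closed[OF p(3) x] by auto
      also have "\<dots> = \<zero>\<^bsub>Q n\<^esub>"
        using f projective_resolution_comp_zero(2)[OF P x] lin_map_zero[OF p(2) q(2)] by simp
      finally show ?thesis
        unfolding q(7) using lin_map_closed[OF f'(1) lin_map_closed[OF p(3) x]] by auto
    qed
    with f' show "\<exists>f'. (lin_map R (P (Suc n)) (Q (Suc n)) f' \<and>
      (Suc n = 0 \<longrightarrow> (\<forall>x\<in>carrier (P 0). e' (f' x) = e x)) \<and>
      (\<forall>x\<in>carrier (P (Suc (Suc n))). f' (d (Suc n) x) \<in> d' (Suc n) ` carrier (Q (Suc (Suc n))))) \<and>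
      (\<forall>x\<in>carrier (P (Suc n)). f (d n x) = d' n (f' x))" by (intro exI[of _ f']) simp
  qed
  then show ?thesis by (rule ex_forward) simp
qed

text \<open>The difference \<theta> of the two lifts induces zero on \<open>M\<close>. At each stage
  \<theta> minus the previous homotopy after \<open>d\<close> is a cycle, hence lies in the image of
  the next differential and can be lifted along it.\<close>

lemma resolution_homotopy:
  assumes lm: "left_module R M"
    and P: "projective_resolution R M P d e" and Q: "projective_resolution R M Q d' e'"
    and a: "\<And>n. lin_map R (P n) (Q n) (\<alpha> n)"
      "\<And>n x. x \<in> carrier (P (Suc n)) \<Longrightarrow> \<alpha> n (d n x) = d' n (\<alpha> (Suc n) x)"
    and b: "\<And>n. lin_map R (P n) (Q n) (\<beta> n)"
      "\<And>n x. x \<in> carrier (P (Suc n)) \<Longrightarrow> \<beta> n (d n x) = d' n (\<beta> (Suc n) x)"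
    and ab: "\<And>x. x \<in> carrier (P 0) \<Longrightarrow> e' (\<alpha> 0 x) = e' (\<beta> 0 x)"
  shows "\<exists>h. (\<forall>n. lin_map R (P n) (Q (Suc n)) (h n)) \<and>
    (\<forall>x\<in>carrier (P 0). \<alpha> 0 x \<ominus>\<^bsub>Q 0\<^esub> \<beta> 0 x = d' 0 (h 0 x)) \<and>
    (\<forall>n. \<forall>x\<in>carrier (P (Suc n)). \<alpha> (Suc n) x \<ominus>\<^bsub>Q (Suc n)\<^esub> \<beta> (Suc n) x =
       d' (Suc n) (h (Suc n) x) \<oplus>\<^bsub>Q (Suc n)\<^esub> h n (d n x))"
proof -
  note p = projective_resolutionD[OF P] and q = projective_resolutionD[OF Q]
  define \<theta> where "\<theta> n x = \<alpha> n x \<ominus>\<^bsub>Q n\<^esub> \<beta> n x" for n x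
  have t: "lin_map R (P n) (Q n) (\<theta> n)" for n
    unfolding \<theta>_def by (rule lin_map_diff[OF p(2) q(2) a(1) b(1)])
  have td: "\<theta> n (d n x) = d' n (\<theta> (Suc n) x)" if "x \<in> carrier (P (Suc n))" for n x
    unfolding \<theta>_def using that a b lin_map_closed[OF a(1)] lin_map_closed[OF b(1)]
    by (simp add: lin_map_minus[OF q(2) q(2) q(3)])
  have t0: "\<theta> 0 x \<in> d' 0 ` carrier (Q (Suc 0))" if "x \<in> carrier (P 0)" for x
  proof -
    interpret M: left_module R M by fact
    have "e' (\<theta> 0 x) = \<zero>\<^bsub>M\<^esub>"
      unfolding \<theta>_def using that ab lin_map_closed[OF a(1)] lin_map_closed[OF b(1)] lin_map_closed[OF q(4)]
      by (simp add: lin_map_minus[OF q(2) lm q(4)] M.M.diff_eq_zero_iff)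
    then show ?thesis unfolding q(6) using lin_map_closed[OF t that] by auto
  qed
  have "\<exists>h. \<forall>n. (lin_map R (P n) (Q (Suc n)) (h n) \<and>
      (n = 0 \<longrightarrow> (\<forall>x\<in>carrier (P 0). \<theta> 0 x = d' 0 (h n x))) \<and>
      (\<forall>x\<in>carrier (P (Suc n)). \<theta> (Suc n) x \<ominus>\<^bsub>Q (Suc n)\<^esub> h n (d n x) \<in>
        d' (Suc n) ` carrier (Q (Suc (Suc n))))) \<and>
    (\<forall>x\<in>carrier (P (Suc n)). \<theta> (Suc n) x = d' (Suc n) (h (Suc n) x) \<oplus>\<^bsub>Q (Suc n)\<^esub> h n (d n x))"
  proof (rule dependent_nat_choice)
    obtain f where f: "lin_map R (P 0) (Q (Suc 0)) f" "\<forall>x\<in>carrier (P 0). d' 0 (f x) = \<theta> 0 x"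
      using fg_projective_lift[OF p(1) q(2) q(2) t q(3), of 0] t0 by blast
    have "\<theta> (Suc 0) x \<ominus>\<^bsub>Q (Suc 0)\<^esub> f (d 0 x) \<in> d' (Suc 0) ` carrier (Q (Suc (Suc 0)))"
      if x: "x \<in> carrier (P (Suc 0))" for x
    proof -
      interpret Q0: left_module R "Q 0" by (rule q(2))
      interpret Q1: left_module R "Q (Suc 0)" by (rule q(2))
      have c: "\<theta> (Suc 0) x \<in> carrier (Q (Suc 0))" "f (d 0 x) \<in> carrier (Q (Suc 0))"
        using x lin_map_closed[OF t] lin_map_closed[OF f(1)] lin_map_closed[OF p(3)] by auto
      have "d' 0 (\<theta> (Suc 0) x) = d' 0 (f (d 0 x))"
        using f(2) lin_map_closed[OF p(3) x] td[OF x] by simp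
      then have "d' 0 (\<theta> (Suc 0) x \<ominus>\<^bsub>Q (Suc 0)\<^esub> f (d 0 x)) = \<zero>\<^bsub>Q 0\<^esub>"
        using c lin_map_closed[OF q(3)] by (simp add: lin_map_minus[OF q(2) q(2) q(3)] Q0.M.diff_eq_zero_iff)
      then show ?thesis unfolding q(7) using c by simp
    qed
    with f show "\<exists>f. lin_map R (P 0) (Q (Suc 0)) f \<and>
      (0 = 0 \<longrightarrow> (\<forall>x\<in>carrier (P 0). \<theta> 0 x = d' 0 (f x))) \<and>
      (\<forall>x\<in>carrier (P (Suc 0)). \<theta> (Suc 0) x \<ominus>\<^bsub>Q (Suc 0)\<^esub> f (d 0 x) \<in>
        d' (Suc 0) ` carrier (Q (Suc (Suc 0))))" by auto
  next
    fix f n assume f: "lin_map R (P n) (Q (Suc n)) f \<and>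
      (n = 0 \<longrightarrow> (\<forall>x\<in>carrier (P 0). \<theta> 0 x = d' 0 (f x))) \<and>
      (\<forall>x\<in>carrier (P (Suc n)). \<theta> (Suc n) x \<ominus>\<^bsub>Q (Suc n)\<^esub> f (d n x) \<in>
        d' (Suc n) ` carrier (Q (Suc (Suc n))))"
    then have fl: "lin_map R (P n) (Q (Suc n)) f" by simp
    interpret Qn: left_module R "Q (Suc n)" by (rule q(2))
    obtain f' where f': "lin_map R (P (Suc n)) (Q (Suc (Suc n))) f'"
      "\<And>x. x \<in> carrier (P (Suc n)) \<Longrightarrow> d' (Suc n) (f' x) = \<theta> (Suc n) x \<ominus>\<^bsub>Q (Suc n)\<^esub> f (d n x)"
      using fg_projective_lift[OF p(1) q(2) q(2) lin_map_diff[OF p(2) q(2) t lin_map_compose[OF p(3) fl]] q(3)]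
        f by blast
    have cl: "\<theta> (Suc n) x \<in> carrier (Q (Suc n))" "f (d n x) \<in> carrier (Q (Suc n))"
      if "x \<in> carrier (P (Suc n))" for x
      using that lin_map_closed[OF t] lin_map_closed[OF fl] lin_map_closed[OF p(3)] by auto
    have 1: "\<theta> (Suc n) x = d' (Suc n) (f' x) \<oplus>\<^bsub>Q (Suc n)\<^esub> f (d n x)" if x: "x \<in> carrier (P (Suc n))" for x
      using f'(2)[OF x] cl[OF x] by (simp add: a_minus_def Qn.M.a_assoc Qn.M.l_neg)
    have "\<theta> (Suc (Suc n)) x \<ominus>\<^bsub>Q (Suc (Suc n))\<^esub> f' (d (Suc n) x) \<in>
        d' (Suc (Suc n)) ` carrier (Q (Suc (Suc (Suc n))))" if x: "x \<in> carrier (P (Suc (Suc n)))" for x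
    proof -
      interpret Q2: left_module R "Q (Suc (Suc n))" by (rule q(2))
      have c: "\<theta> (Suc (Suc n)) x \<in> carrier (Q (Suc (Suc n)))" "f' (d (Suc n) x) \<in> carrier (Q (Suc (Suc n)))"
        "d (Suc n) x \<in> carrier (P (Suc n))"
        using x lin_map_closed[OF t] lin_map_closed[OF f'(1)] lin_map_closed[OF p(3)] by auto
      have "f (d n (d (Suc n) x)) = \<zero>\<^bsub>Q (Suc n)\<^esub>"
        using projective_resolution_comp_zero(2)[OF P x] lin_map_zero[OF p(2) q(2) fl] by simp
      then have "d' (Suc n) (\<theta> (Suc (Suc n)) x) = d' (Suc n) (f' (d (Suc n) x))"
        using 1[OF c(3)] td[OF x] c lin_map_closed[OF q(3)] by simp
      then have "d' (Suc n) (\<theta> (Suc (Suc n)) x \<ominus>\<^bsub>Q (Suc (Suc n))\<^esub> f' (d (Suc n) x)) = \<zero>\<^bsub>Q (Suc n)\<^esub>"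
        using c lin_map_closed[OF q(3)] by (simp add: lin_map_minus[OF q(2) q(2) q(3)] Qn.M.diff_eq_zero_iff)
      then show ?thesis unfolding q(7) using c by simp
    qed
    with f' 1 show "\<exists>f'. (lin_map R (P (Suc n)) (Q (Suc (Suc n))) f' \<and>
      (Suc n = 0 \<longrightarrow> (\<forall>x\<in>carrier (P 0). \<theta> 0 x = d' 0 (f' x))) \<and>
      (\<forall>x\<in>carrier (P (Suc (Suc n))). \<theta> (Suc (Suc n)) x \<ominus>\<^bsub>Q (Suc (Suc n))\<^esub> f' (d (Suc n) x) \<in>
        d' (Suc (Suc n)) ` carrier (Q (Suc (Suc (Suc n)))))) \<and>
      (\<forall>x\<in>carrier (P (Suc n)). \<theta> (Suc n) x = d' (Suc n) (f' x) \<oplus>\<^bsub>Q (Suc n)\<^esub> f (d n x))"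
      by (intro exI[of _ f']) simp
  qed
  then show ?thesis unfolding \<theta>_def by (rule ex_forward) simp
qed

lemma (in abelian_group) diff_diff_diff:
  assumes "x \<in> carrier G" "y \<in> carrier G" "z \<in> carrier G"
  shows "x \<ominus> z = x \<ominus> y \<ominus> (z \<ominus> y)"
proof -
  have "\<ominus> (z \<ominus> y) = y \<oplus> \<ominus> z" using assms by (simp add: minus_eq minus_add a_comm)
  then show ?thesis using assms by (simp add: minus_eq a_assoc r_neg1)
qed

subsection \<open>Cohomology of Hom complexes\<close>

text \<open>Together with \<open>cobound\<close> this describes cocycles through their values on the
  carriers alone, without normalising them outside; only the final passage to \<open>Ext\<close>
  restricts representatives.\<close>

definition cocyc ::
  "('a, 'z) ring_scheme \<Rightarrow> (nat \<Rightarrow> ('a, 'q) module) \<Rightarrow> (nat \<Rightarrow> 'q \<Rightarrow> 'q) \<Rightarrow> ('a, 'n) module \<Rightarrow>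
    nat \<Rightarrow> ('q \<Rightarrow> 'n) \<Rightarrow> bool" where
  "cocyc R P d N n f \<longleftrightarrow> lin_map R (P n) N f \<and> (\<forall>x\<in>carrier (P (Suc n)). f (d n x) = \<zero>\<^bsub>N\<^esub>)"

definition cobound ::
  "('a, 'z) ring_scheme \<Rightarrow> (nat \<Rightarrow> ('a, 'q) module) \<Rightarrow> (nat \<Rightarrow> 'q \<Rightarrow> 'q) \<Rightarrow> ('a, 'n) module \<Rightarrow>
    nat \<Rightarrow> ('q \<Rightarrow> 'n) \<Rightarrow> bool" where
  "cobound R P d N n f \<longleftrightarrow> (case n of 0 \<Rightarrow> \<forall>x\<in>carrier (P 0). f x = \<zero>\<^bsub>N\<^esub>
     | Suc m \<Rightarrow> \<exists>g. lin_map R (P m) N g \<and> (\<forall>x\<in>carrier (P n). f x = g (d m x)))"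

definition chain_map ::
  "('a, 'z) ring_scheme \<Rightarrow> (nat \<Rightarrow> ('a, 'q) module) \<Rightarrow> (nat \<Rightarrow> 'q \<Rightarrow> 'q) \<Rightarrow>
    (nat \<Rightarrow> ('a, 'r) module) \<Rightarrow> (nat \<Rightarrow> 'r \<Rightarrow> 'r) \<Rightarrow> (nat \<Rightarrow> 'q \<Rightarrow> 'r) \<Rightarrow> bool" where
  "chain_map R P d Q d' \<phi> \<longleftrightarrow> (\<forall>n. lin_map R (P n) (Q n) (\<phi> n)) \<and>
     (\<forall>n. \<forall>x\<in>carrier (P (Suc n)). \<phi> n (d n x) = d' n (\<phi> (Suc n) x))"

lemma cobound_cong:
  "cobound R P d N n f \<Longrightarrow> (\<And>x. x \<in> carrier (P n) \<Longrightarrow> f x = g x) \<Longrightarrow> cobound R P d N n g"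
  by (cases n) (simp_all add: cobound_def)

lemma cocyc_chain_map:
  assumes "chain_map R P d Q d' \<phi>" "cocyc R Q d' N n f"
  shows "cocyc R P d N n (\<lambda>x. f (\<phi> n x))"
  using assms lin_map_compose[of R "P n" "Q n" "\<phi> n" N f] lin_map_closed[of R "P (Suc n)" "Q (Suc n)" "\<phi> (Suc n)"]
  by (auto simp: chain_map_def cocyc_def)

lemma cobound_chain_map:
  assumes "chain_map R P d Q d' \<phi>" "cobound R Q d' N n f"
  shows "cobound R P d N n (\<lambda>x. f (\<phi> n x))"
proof (cases n)
  case 0
  then show ?thesis using assms lin_map_closed[of R "P 0" "Q 0" "\<phi> 0"] by (auto simp: chain_map_def cobound_def)
next
  case (Suc m)
  with assms obtain g where g: "lin_map R (Q m) N g" "\<forall>x\<in>carrier (Q n). f x = g (d' m x)"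
    by (auto simp: cobound_def)
  have "lin_map R (P m) N (\<lambda>x. g (\<phi> m x))"
    using assms(1) g(1) lin_map_compose[of R "P m" "Q m" "\<phi> m"] by (auto simp: chain_map_def)
  moreover have "f (\<phi> n x) = g (\<phi> m (d m x))" if "x \<in> carrier (P n)" for x
    using that assms(1) g(2) lin_map_closed[of R "P n" "Q n" "\<phi> n" x] by (auto simp: chain_map_def Suc)
  ultimately show ?thesis by (auto simp: cobound_def Suc)
qed

lemma cobound_diff:
  assumes lP: "\<And>n. left_module R (P n)" and lN: "left_module R N"
    and "cobound R P d N n f" "cobound R P d N n g"
  shows "cobound R P d N n (\<lambda>x. f x \<ominus>\<^bsub>N\<^esub> g x)"
proof -
  interpret N: left_module R N by fact
  show ?thesis
  proof (cases n)
    case 0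
    then show ?thesis using assms(3,4) by (simp add: cobound_def a_minus_def N.M.r_neg)
  next
    case (Suc m)
    with assms(3,4) obtain f' g' where
      "lin_map R (P m) N f'" "\<forall>x\<in>carrier (P n). f x = f' (d m x)"
      "lin_map R (P m) N g'" "\<forall>x\<in>carrier (P n). g x = g' (d m x)"
      by (auto simp: cobound_def)
    then show ?thesis
      using lin_map_diff[OF lP lN, of m f' g'] unfolding Suc cobound_def by (auto simp: Suc)
  qed
qed

lemma cobound_lin_map:
  assumes lN: "left_module R N" and lN': "left_module R N'" and s: "lin_map R N N' s" and "cobound R P d N n f"
  shows "cobound R P d N' n (\<lambda>x. s (f x))"
proof (cases n)
  case 0
  then show ?thesis using assms(4) lin_map_zero[OF lN lN' s] by (simp add: cobound_def)
next
  case (Suc m)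
  with assms(4) obtain f' where "lin_map R (P m) N f'" "\<forall>x\<in>carrier (P n). f x = f' (d m x)"
    by (auto simp: cobound_def)
  then show ?thesis
    using lin_map_compose[OF _ s, of "P m" f'] unfolding Suc cobound_def by (auto simp: Suc)
qed

lemma cocyc_lin_map:
  assumes lN: "left_module R N" and lN': "left_module R N'" and s: "lin_map R N N' s" and "cocyc R P d N n f"
  shows "cocyc R P d N' n (\<lambda>x. s (f x))"
  using assms(4) lin_map_compose[OF _ s, of "P n" f] lin_map_zero[OF lN lN' s] by (auto simp: cocyc_def)

lemma cocyc_diff:
  assumes lP: "\<And>n. left_module R (P n)" and lN: "left_module R N"
    and "cocyc R P d N n f" "cocyc R P d N n g"
  shows "cocyc R P d N n (\<lambda>x. f x \<ominus>\<^bsub>N\<^esub> g x)"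
proof -
  interpret N: left_module R N by fact
  show ?thesis
    using assms(3,4) lin_map_diff[OF lP lN] by (auto simp: cocyc_def a_minus_def N.M.r_neg)
qed

text \<open>Write \<open>f\<close> as (f - g) - (0 - g), so that closure of coboundaries under
  differences suffices.\<close>

lemma cobound_cancel:
  assumes lP: "\<And>n. left_module R (P n)" and lN: "left_module R N"
    and lin: "lin_map R (P n) N f" "lin_map R (P n) N g"
    and cob: "cobound R P d N n (\<lambda>x. f x \<ominus>\<^bsub>N\<^esub> g x)" "cobound R P d N n g"
  shows "cobound R P d N n f"
proof -
  interpret N: left_module R N by (fact lN)
  have z: "cobound R P d N n (\<lambda>x. \<zero>\<^bsub>N\<^esub>)"
    using cob(2) lin_mapI[of "P m" "\<lambda>x. \<zero>\<^bsub>N\<^esub>" N R for m]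
    by (cases n) (auto simp: cobound_def N.smult_r_null)
  have "cobound R P d N n (\<lambda>x. f x \<ominus>\<^bsub>N\<^esub> g x \<ominus>\<^bsub>N\<^esub> (\<zero>\<^bsub>N\<^esub> \<ominus>\<^bsub>N\<^esub> g x))"
    by (intro cobound_diff lP lN cob z)
  moreover have "f x \<ominus>\<^bsub>N\<^esub> g x \<ominus>\<^bsub>N\<^esub> (\<zero>\<^bsub>N\<^esub> \<ominus>\<^bsub>N\<^esub> g x) = f x" if "x \<in> carrier (P n)" for x
    using lin_map_closed[OF lin(1) that] lin_map_closed[OF lin(2) that]
    by (simp add: a_minus_def N.M.a_assoc N.M.l_neg)
  ultimately show ?thesis by (rule cobound_cong)
qed

text \<open>Apply \<open>f\<close> to \<alpha> - \<beta> = d' h + h d: the first term dies because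
  \<open>f\<close> is a cocycle, and the second is the coboundary of \<open>f\<close> after
  \<open>h\<close>.\<close>

lemma cocyc_homotopic_cobound:
  assumes lM: "left_module R M" and lN: "left_module R N"
    and P: "projective_resolution R M P d e" and Q: "projective_resolution R M Q d' e'"
    and a: "chain_map R P d Q d' \<alpha>" and b: "chain_map R P d Q d' \<beta>"
    and ab: "\<And>x. x \<in> carrier (P 0) \<Longrightarrow> e' (\<alpha> 0 x) = e' (\<beta> 0 x)"
    and f: "cocyc R Q d' N n f"
  shows "cobound R P d N n (\<lambda>x. f (\<alpha> n x) \<ominus>\<^bsub>N\<^esub> f (\<beta> n x))"
proof -
  note p = projective_resolutionD[OF P] and q = projective_resolutionD[OF Q]
  interpret N: left_module R N by fact
  have al: "lin_map R (P n) (Q n) (\<alpha> n)" and bl: "lin_map R (P n) (Q n) (\<beta> n)" for n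
    using a b by (auto simp: chain_map_def)
  have ad: "\<alpha> n (d n x) = d' n (\<alpha> (Suc n) x)" and bd: "\<beta> n (d n x) = d' n (\<beta> (Suc n) x)"
    if "x \<in> carrier (P (Suc n))" for n x
    using a b that by (auto simp: chain_map_def)
  have "\<exists>h. (\<forall>n. lin_map R (P n) (Q (Suc n)) (h n)) \<and>
    (\<forall>x\<in>carrier (P 0). \<alpha> 0 x \<ominus>\<^bsub>Q 0\<^esub> \<beta> 0 x = d' 0 (h 0 x)) \<and>
    (\<forall>n. \<forall>x\<in>carrier (P (Suc n)). \<alpha> (Suc n) x \<ominus>\<^bsub>Q (Suc n)\<^esub> \<beta> (Suc n) x =
       d' (Suc n) (h (Suc n) x) \<oplus>\<^bsub>Q (Suc n)\<^esub> h n (d n x))"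
    by (rule resolution_homotopy[where \<alpha> = \<alpha> and \<beta> = \<beta>, OF lM P Q])
      (use al bl ad bd ab in auto)
  then obtain h where hh: "(\<forall>n. lin_map R (P n) (Q (Suc n)) (h n)) \<and>
    (\<forall>x\<in>carrier (P 0). \<alpha> 0 x \<ominus>\<^bsub>Q 0\<^esub> \<beta> 0 x = d' 0 (h 0 x)) \<and>
    (\<forall>n. \<forall>x\<in>carrier (P (Suc n)). \<alpha> (Suc n) x \<ominus>\<^bsub>Q (Suc n)\<^esub> \<beta> (Suc n) x =
       d' (Suc n) (h (Suc n) x) \<oplus>\<^bsub>Q (Suc n)\<^esub> h n (d n x))" by (rule exE)
  note h = hh[THEN conjunct1, rule_format] hh[THEN conjunct2, THEN conjunct1, rule_format]
    hh[THEN conjunct2, THEN conjunct2, rule_format]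
  have fl: "lin_map R (Q n) N f" and f0: "\<And>x. x \<in> carrier (Q (Suc n)) \<Longrightarrow> f (d' n x) = \<zero>\<^bsub>N\<^esub>"
    using f by (auto simp: cocyc_def)
  have m: "f (\<alpha> n x) \<ominus>\<^bsub>N\<^esub> f (\<beta> n x) = f (\<alpha> n x \<ominus>\<^bsub>Q n\<^esub> \<beta> n x)" if "x \<in> carrier (P n)" for x
    using that lin_map_closed[OF al] lin_map_closed[OF bl] by (simp add: lin_map_minus[OF q(2) lN fl])
  show ?thesis
  proof (cases n)
    case 0
    then show ?thesis
      using m h(2) f0 lin_map_closed[OF h(1)] by (auto simp: cobound_def)
  next
    case (Suc k)
    have "f (\<alpha> n x) \<ominus>\<^bsub>N\<^esub> f (\<beta> n x) = f (h k (d k x))" if x: "x \<in> carrier (P n)" for x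
    proof -
      have c: "h k (d k x) \<in> carrier (Q n)" "h n x \<in> carrier (Q (Suc n))" "d' n (h n x) \<in> carrier (Q n)"
        using x lin_map_closed[OF h(1)] lin_map_closed[OF p(3)] lin_map_closed[OF q(3)] by (auto simp: Suc)
      have "f (\<alpha> n x \<ominus>\<^bsub>Q n\<^esub> \<beta> n x) = f (d' n (h n x)) \<oplus>\<^bsub>N\<^esub> f (h k (d k x))"
        using x c h(3) by (simp add: Suc lin_map_add[OF fl, unfolded Suc])
      then show ?thesis using m[OF x] f0[OF c(2)] c lin_map_closed[OF fl] by simp
    qed
    moreover have "lin_map R (P k) N (\<lambda>x. f (h k x))"
      using lin_map_compose[OF h(1)] fl by (auto simp: Suc)
    ultimately show ?thesis by (auto simp: cobound_def Suc)
  qed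
qed

section \<open>Independence of the cohomology from the resolution\<close>

lemma chain_map_compose:
  assumes "chain_map R P d Q d' \<phi>" "chain_map R Q d' L d'' \<psi>"
  shows "chain_map R P d L d'' (\<lambda>n x. \<psi> n (\<phi> n x))"
  using assms lin_map_compose lin_map_closed unfolding chain_map_def by metis

lemma chain_map_id:
  assumes "projective_resolution R M P d e"
  shows "chain_map R P d P d (\<lambda>n x. x)"
  using projective_resolutionD(2)[OF assms] by (auto simp: chain_map_def lin_map_def)

text \<open>One-dimensionality expressed by cocycles: a nonzero class of which every class is a
  multiple under the scalar action \<open>s\<close>. Over a field, uniqueness of the multiple
  follows since \<open>b\<close> is not a coboundary.\<close>

definition cohomology_line where
  "cohomology_line R P d N s n \<longleftrightarrow> (\<exists>b. cocyc R P d N n b \<and> \<not> cobound R P d N n b \<and>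
     (\<forall>f. cocyc R P d N n f \<longrightarrow> (\<exists>c. cobound R P d N n (\<lambda>x. f x \<ominus>\<^bsub>N\<^esub> s c (b x)))))"

context
  fixes R :: "('a, 'z) ring_scheme" and M :: "('a, 'm) module" and N :: "('a, 'n) module"
    and P :: "nat \<Rightarrow> ('a, 'q) module" and Q :: "nat \<Rightarrow> ('a, 'r) module" and d d' e e'
  assumes lM: "left_module R M" and lN: "left_module R N"
    and P: "projective_resolution R M P d e" and Q: "projective_resolution R M Q d' e'"
begin

text \<open>Both composites lift the identity of \<open>M\<close>, just as the identity chain maps
  do, so cocycles change only by coboundaries under them.\<close>

lemma comparison_maps:
  "\<exists>\<phi> \<psi>. chain_map R P d Q d' \<phi> \<and> chain_map R Q d' P d \<psi> \<and>
    (\<forall>n f. cocyc R P d N n f \<longrightarrow> cobound R P d N n (\<lambda>x. f x \<ominus>\<^bsub>N\<^esub> f (\<psi> n (\<phi> n x)))) \<and>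
    (\<forall>n f. cocyc R Q d' N n f \<longrightarrow> cobound R Q d' N n (\<lambda>x. f x \<ominus>\<^bsub>N\<^esub> f (\<phi> n (\<psi> n x))))"
proof -
  obtain \<phi> where \<phi>: "chain_map R P d Q d' \<phi>" "\<And>x. x \<in> carrier (P 0) \<Longrightarrow> e' (\<phi> 0 x) = e x"
    using resolution_lift[OF lM P Q] unfolding chain_map_def by blast
  obtain \<psi> where \<psi>: "chain_map R Q d' P d \<psi>" "\<And>x. x \<in> carrier (Q 0) \<Longrightarrow> e (\<psi> 0 x) = e' x"
    using resolution_lift[OF lM Q P] unfolding chain_map_def by blast
  have c: "\<phi> 0 x \<in> carrier (Q 0)" if "x \<in> carrier (P 0)" for x
    using \<phi>(1) that lin_map_closed unfolding chain_map_def by metis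
  have c': "\<psi> 0 x \<in> carrier (P 0)" if "x \<in> carrier (Q 0)" for x
    using \<psi>(1) that lin_map_closed unfolding chain_map_def by metis
  show ?thesis
  proof (intro exI[of _ \<phi>] exI[of _ \<psi>] conjI allI impI \<phi>(1) \<psi>(1))
    show "cobound R P d N n (\<lambda>x. f x \<ominus>\<^bsub>N\<^esub> f (\<psi> n (\<phi> n x)))" if "cocyc R P d N n f" for n f
      using cocyc_homotopic_cobound[OF lM lN P P chain_map_id[OF P] chain_map_compose[OF \<phi>(1) \<psi>(1)] _ that]
      using \<phi>(2) \<psi>(2) c by simp
    show "cobound R Q d' N n (\<lambda>x. f x \<ominus>\<^bsub>N\<^esub> f (\<phi> n (\<psi> n x)))" if "cocyc R Q d' N n f" for n f
      using cocyc_homotopic_cobound[OF lM lN Q Q chain_map_id[OF Q] chain_map_compose[OF \<psi>(1) \<phi>(1)] _ that]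
      using \<phi>(2) \<psi>(2) c' by simp
  qed
qed

text \<open>Pulled back to \<open>Q\<close> the cocycle bounds; pulled back again to
  \<open>P\<close> it still bounds and differs from \<open>f\<close> by a coboundary.\<close>

lemma cohomology_vanish_transfer:
  assumes "\<And>f. cocyc R Q d' N n f \<Longrightarrow> cobound R Q d' N n f" and f: "cocyc R P d N n f"
  shows "cobound R P d N n f"
proof -
  obtain \<phi> \<psi> where cm: "chain_map R P d Q d' \<phi> \<and> chain_map R Q d' P d \<psi> \<and>
    (\<forall>n f. cocyc R P d N n f \<longrightarrow> cobound R P d N n (\<lambda>x. f x \<ominus>\<^bsub>N\<^esub> f (\<psi> n (\<phi> n x)))) \<and>
    (\<forall>n f. cocyc R Q d' N n f \<longrightarrow> cobound R Q d' N n (\<lambda>x. f x \<ominus>\<^bsub>N\<^esub> f (\<phi> n (\<psi> n x))))"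
    using comparison_maps by (elim exE) (rule that)
  note \<phi> = cm[THEN conjunct1] and \<psi> = cm[THEN conjunct2, THEN conjunct1]
    and h = cm[THEN conjunct2, THEN conjunct2, THEN conjunct1, rule_format]
  have "cobound R P d N n (\<lambda>x. f (\<psi> n (\<phi> n x)))"
    using cobound_chain_map[OF \<phi> assms(1)[OF cocyc_chain_map[OF \<psi> f]]] .
  moreover have "lin_map R (P n) N f" "lin_map R (P n) N (\<lambda>x. f (\<psi> n (\<phi> n x)))"
    using cocyc_chain_map[OF chain_map_compose[OF \<phi> \<psi>] f] f by (auto simp: cocyc_def)
  ultimately show ?thesis using cobound_cancel[where P = P, OF projective_resolutionD(2)[OF P] lN _ _ h[OF f]] by blast
qed

lemma cohomology_line_transfer:
  assumes "cohomology_line R Q d' N s n" and s: "\<And>c. lin_map R N N (s c)"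
  shows "cohomology_line R P d N s n"
proof -
  obtain \<phi> \<psi> where cm: "chain_map R P d Q d' \<phi> \<and> chain_map R Q d' P d \<psi> \<and>
    (\<forall>n f. cocyc R P d N n f \<longrightarrow> cobound R P d N n (\<lambda>x. f x \<ominus>\<^bsub>N\<^esub> f (\<psi> n (\<phi> n x)))) \<and>
    (\<forall>n f. cocyc R Q d' N n f \<longrightarrow> cobound R Q d' N n (\<lambda>x. f x \<ominus>\<^bsub>N\<^esub> f (\<phi> n (\<psi> n x))))"
    using comparison_maps by (elim exE) (rule that)
  note \<phi> = cm[THEN conjunct1] and \<psi> = cm[THEN conjunct2, THEN conjunct1]
    and h = cm[THEN conjunct2, THEN conjunct2, THEN conjunct1, rule_format]
    and h' = cm[THEN conjunct2, THEN conjunct2, THEN conjunct2, rule_format]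
  interpret N: left_module R N by (fact lN)
  note lP = projective_resolutionD(2)[OF P]
  obtain b where b: "cocyc R Q d' N n b" and nb: "\<not> cobound R Q d' N n b"
    and gen: "\<And>f. cocyc R Q d' N n f \<Longrightarrow> \<exists>c. cobound R Q d' N n (\<lambda>x. f x \<ominus>\<^bsub>N\<^esub> s c (b x))"
    using assms(1) unfolding cohomology_line_def by blast
  let ?b = "\<lambda>x. b (\<phi> n x)"
  have b': "cocyc R P d N n ?b" by (rule cocyc_chain_map[OF \<phi> b])
  have "\<not> cobound R P d N n ?b"
  proof
    assume "cobound R P d N n ?b"
    then have "cobound R Q d' N n (\<lambda>x. b (\<phi> n (\<psi> n x)))" by (rule cobound_chain_map[OF \<psi>])
    moreover have "lin_map R (Q n) N b" "lin_map R (Q n) N (\<lambda>x. b (\<phi> n (\<psi> n x)))"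
      using cocyc_chain_map[OF chain_map_compose[OF \<psi> \<phi>] b] b by (auto simp: cocyc_def)
    ultimately show False using cobound_cancel[where P = Q, OF projective_resolutionD(2)[OF Q] lN _ _ h'[OF b]] nb by blast
  qed
  moreover have "\<exists>c. cobound R P d N n (\<lambda>x. f x \<ominus>\<^bsub>N\<^esub> s c (?b x))" if f: "cocyc R P d N n f" for f
  proof -
    obtain c where c: "cobound R Q d' N n (\<lambda>x. f (\<psi> n x) \<ominus>\<^bsub>N\<^esub> s c (b x))"
      using gen[OF cocyc_chain_map[OF \<psi> f]] by blast
    let ?g = "\<lambda>x. f (\<psi> n (\<phi> n x)) \<ominus>\<^bsub>N\<^esub> s c (?b x)"
    have 1: "cobound R P d N n ?g" using cobound_chain_map[OF \<phi> c] .
    have f': "cocyc R P d N n (\<lambda>x. f (\<psi> n (\<phi> n x)))"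
      by (rule cocyc_chain_map[OF chain_map_compose[OF \<phi> \<psi>] f])
    have sb: "cocyc R P d N n (\<lambda>x. s c (?b x))" by (rule cocyc_lin_map[OF lN lN s b'])
    have fs: "cocyc R P d N n (\<lambda>x. f x \<ominus>\<^bsub>N\<^esub> s c (?b x))" by (rule cocyc_diff[OF lP lN f sb])
    have g: "cocyc R P d N n ?g" by (rule cocyc_diff[OF lP lN f' sb])
    \<comment> \<open>The wanted difference and the coboundary \<open>?g\<close> differ by a known
      coboundary, so the former is a coboundary as well.\<close>
    have eq: "f x \<ominus>\<^bsub>N\<^esub> f (\<psi> n (\<phi> n x)) = f x \<ominus>\<^bsub>N\<^esub> s c (?b x) \<ominus>\<^bsub>N\<^esub> ?g x" if x: "x \<in> carrier (P n)" for x
    proof -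
      have c: "f x \<in> carrier N" "s c (?b x) \<in> carrier N" "f (\<psi> n (\<phi> n x)) \<in> carrier N"
        using f f' sb by (auto simp: cocyc_def dest: lin_map_closed[OF _ x])
      then show ?thesis
        by (rule N.M.diff_diff_diff)
    qed
    have "cobound R P d N n (\<lambda>x. f x \<ominus>\<^bsub>N\<^esub> s c (?b x) \<ominus>\<^bsub>N\<^esub> ?g x)"
      using h[OF f] eq by (rule cobound_cong)
    then have "cobound R P d N n (\<lambda>x. f x \<ominus>\<^bsub>N\<^esub> s c (?b x))"
      using cobound_cancel[where P = P, OF lP lN _ _ _ 1] fs g by (auto simp: cocyc_def)
    then show ?thesis ..
  qed
  ultimately show ?thesis using b' unfolding cohomology_line_def by blast
qed

end

text \<open>Every term embeds into a free module, so that a resolution with terms in an arbitrary type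
  can be moved into the type \<open>nat \<Rightarrow> 'a\<close> used by \<^const>\<open>chosen_resolution\<close>.\<close>

lemma projective_resolution_transport:
  fixes Q :: "nat \<Rightarrow> ('a, 'q) module"
  assumes Q: "projective_resolution R M Q d e"
  shows "\<exists>(P :: nat \<Rightarrow> ('a, nat \<Rightarrow> 'a) module) d' e'. projective_resolution R M P d' e'"
proof -
  note q = projective_resolutionD[OF Q]
  have rR: "ring R" using q(2) by (rule left_module_ring)
  have "\<forall>n. \<exists>k i p. lin_map R (Q n) (free_module R k) i \<and> lin_map R (free_module R k) (Q n) p \<and>
      (\<forall>x\<in>carrier (Q n). p (i x) = x)"
  proof
    fix n show "\<exists>k i p. lin_map R (Q n) (free_module R k) i \<and> lin_map R (free_module R k) (Q n) p \<and>
      (\<forall>x\<in>carrier (Q n). p (i x) = x)"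
      using q(1)[of n] unfolding fg_projective_def Bex_def mod_hom_iff by blast
  qed
  then obtain k i p where i: "\<And>n. lin_map R (Q n) (free_module R (k n)) (i n)"
    and p: "\<And>n. lin_map R (free_module R (k n)) (Q n) (p n)"
    and pi: "\<And>n x. x \<in> carrier (Q n) \<Longrightarrow> p n (i n x) = x" by metis
  \<comment> \<open>As \<open>p n\<close> retracts \<open>i n\<close>, the image of
    \<open>i n\<close> is a copy of \<open>Q n\<close> inside a free module, on which
    \<open>p n\<close> is the inverse isomorphism.\<close>
  define P where "P n = (free_module R (k n))\<lparr>carrier := i n ` carrier (Q n)\<rparr>" for n
  define d' where "d' n = (\<lambda>x\<in>carrier (P (Suc n)). i n (d n (p (Suc n) x)))" for n
  define e' where "e' = (\<lambda>x\<in>carrier (P 0). e (p 0 x))"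
  note lF = left_module_free_module[OF rR]
  have Pc: "carrier (P n) = i n ` carrier (Q n)" for n by (simp add: P_def)
  have sub: "submodule (i n ` carrier (Q n)) R (free_module R (k n))" for n
    by (rule submodule_image[OF q(2) lF i left_module.submodule_carrier[OF q(2)]])
  have lP: "left_module R (P n)" for n
    unfolding P_def by (rule left_module_submodule[OF lF sub])
  have pP: "lin_map R (P n) (Q n) (p n)" for n
    using lin_map_closed[OF i] by (auto simp: P_def lin_map_closed[OF p] lin_map_add[OF p] lin_map_smult[OF p] intro!: lin_mapI)
  have iP: "lin_map R (Q n) (P n) (i n)" for n
    using i[of n] by (auto simp: lin_map_def P_def)
  have inj: "i n x = \<zero>\<^bsub>P n\<^esub> \<longleftrightarrow> x = \<zero>\<^bsub>Q n\<^esub>" if "x \<in> carrier (Q n)" for n x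
    using pi[OF that] lin_map_zero[OF q(2) lP iP] lin_map_zero[OF lP q(2) pP] by metis
  have "fg_projective R (P n)" for n
  proof -
    have "(\<lambda>x\<in>carrier (P n). x) \<in> mod_hom R (P n) (free_module R (k n))"
      using submodule_subset[OF sub, of n] submodule_add[OF sub, of _ n] submodule_smult[OF sub, of _ _ n]
      by (auto simp: mod_hom_iff lin_map_def P_def subset_iff)
    moreover have "(\<lambda>x\<in>carrier (free_module R (k n)). i n (p n x)) \<in> mod_hom R (free_module R (k n)) (P n)"
      using lin_map_compose[OF p[of n] iP[of n]] left_module.smult_closed[OF lF[of "k n"]]
        abelian_monoid.a_closed[OF abelian_group.axioms(1)[OF left_module_abelian_group[OF lF[of "k n"]]]]
      by (auto simp: mod_hom_iff lin_map_def Pi_iff)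
    moreover have "i n (p n x) = x" if "x \<in> carrier (P n)" for x
      using that pi by (auto simp: P_def)
    ultimately show ?thesis
      unfolding fg_projective_def using lP lin_map_closed[OF i[of n]]
      by (intro conjI exI[of _ "k n"] bexI) (auto simp: Pc)
  qed
  moreover have restr: "restrict f (carrier (P n)) \<in> mod_hom R (P n) L" if "lin_map R (P n) L f"
    for n f and L :: "('a, 'l) module"
    using that left_module.smult_closed[OF lP[of n]]
      abelian_monoid.a_closed[OF abelian_group.axioms(1)[OF left_module_abelian_group[OF lP[of n]]]]
    by (auto simp: mod_hom_iff lin_map_def)
  have "d' n \<in> mod_hom R (P (Suc n)) (P n)" for n
    unfolding d'_def by (rule restr) (intro lin_map_compose[OF pP] lin_map_compose[OF q(3)] iP)
  moreover have "e' \<in> mod_hom R (P 0) M"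
    using restrict_extensional[of "\<lambda>x. e (p 0 x)" "carrier (P 0)"]
      lin_map_compose[OF pP q(4)] left_module.smult_closed[OF lP[of 0]]
      abelian_monoid.a_closed[OF abelian_group.axioms(1)[OF left_module_abelian_group[OF lP[of 0]]]]
    by (auto simp: mod_hom_iff lin_map_def e'_def)
  moreover have d': "d' n (i (Suc n) x) = i n (d n x)" if "x \<in> carrier (Q (Suc n))" for n x
    using that pi by (simp add: d'_def Pc)
  moreover have e': "e' (i 0 x) = e x" if "x \<in> carrier (Q 0)" for x
    using that pi by (simp add: e'_def Pc)
  have dim: "d' n ` carrier (P (Suc n)) = i n ` d n ` carrier (Q (Suc n))" for n
    unfolding Pc image_image using d' by (rule image_cong[OF refl])
  have "e' ` carrier (P 0) = carrier M"
    unfolding Pc image_image q(5)[symmetric] using e' by (rule image_cong[OF refl])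
  moreover have "d' 0 ` carrier (P 1) = {x \<in> carrier (P 0). e' x = \<zero>\<^bsub>M\<^esub>}"
    unfolding One_nat_def dim q(6) using e' by (auto simp: Pc)
  moreover have "d' (Suc n) ` carrier (P (Suc (Suc n))) = {x \<in> carrier (P (Suc n)). d' n x = \<zero>\<^bsub>P n\<^esub>}" for n
    unfolding dim q(7) using d' inj[OF lin_map_closed[OF q(3)]] lin_map_zero[OF q(2) lP iP] by (auto simp: Pc)
  ultimately have "projective_resolution R M P d' e'" by (simp add: projective_resolution_def)
  then show ?thesis by blast
qed

subsection \<open>Ext spaces from an arbitrary resolution\<close>

text \<open>Turns vector spaces over \<open>'k\<close> into instances of \<open>left_module\<close>,
  so that the quotient lemmas also serve the cohomology spaces.\<close>

definition field_ring :: "'k::field ring" where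
  "field_ring = \<lparr>carrier = UNIV, mult = (*), one = 1, zero = 0, add = (+)\<rparr>"

lemma field_ring_simps [simp]:
  "carrier field_ring = UNIV" "c \<otimes>\<^bsub>field_ring\<^esub> c' = c * c'" "\<one>\<^bsub>field_ring\<^esub> = 1"
  "\<zero>\<^bsub>field_ring\<^esub> = 0" "c \<oplus>\<^bsub>field_ring\<^esub> c' = c + c'"
  by (simp_all add: field_ring_def)

lemma ring_field_ring: "ring (field_ring :: 'k::field ring)"
proof -
  have "\<exists>y. y + x = (0::'k)" for x by (rule exI[of _ "- x"]) simp
  then show ?thesis
    by (intro ringI abelian_groupI) (auto simp: algebra_simps intro!: monoid.intro)
qed

lemma lin_map_cobound:
  assumes "\<And>n. left_module R (P n)" "\<And>n. lin_map R (P (Suc n)) (P n) (d n)" and lN: "left_module R N"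
    and "cobound R P d N n f"
  shows "lin_map R (P n) N f"
proof (cases n)
  case 0
  interpret N: left_module R N by fact
  interpret P: left_module R "P 0" by (rule assms)
  show ?thesis
    by (rule lin_mapI) (use assms(4) in \<open>auto simp: 0 cobound_def P.smult_closed N.smult_r_null\<close>)
next
  case (Suc m)
  interpret P: left_module R "P n" by (rule assms)
  obtain g where g: "lin_map R (P m) N g" "\<And>x. x \<in> carrier (P n) \<Longrightarrow> f x = g (d m x)"
    using assms(4) by (auto simp: Suc cobound_def)
  have l: "lin_map R (P n) N (\<lambda>x. g (d m x))"
    using lin_map_compose[OF assms(2) g(1)] by (simp add: Suc)
  show ?thesis
    by (rule lin_mapI)
      (simp_all add: g(2) P.smult_closed lin_map_closed[OF l] lin_map_add[OF l] lin_map_smult[OF l])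
qed

lemma cocyc_closed: "cocyc R P d N n f \<Longrightarrow> x \<in> carrier (P n) \<Longrightarrow> f x \<in> carrier N"
  unfolding cocyc_def by (blast intro: lin_map_closed)

text \<open>Collects what is asked of the elements through which the field acts on modules. Their
  centrality makes multiplication by a scalar an endomorphism of every module.\<close>

locale scalar_algebra = ring A for A :: "('k::field, 'a) module" (structure) +
  assumes scalar_closed: "c \<odot>\<^bsub>A\<^esub> \<one> \<in> carrier A"
    and scalar_central: "a \<in> carrier A \<Longrightarrow> a \<otimes> (c \<odot>\<^bsub>A\<^esub> \<one>) = (c \<odot>\<^bsub>A\<^esub> \<one>) \<otimes> a"
    and scalar_add: "(c + c') \<odot>\<^bsub>A\<^esub> \<one> = (c \<odot>\<^bsub>A\<^esub> \<one>) \<oplus> (c' \<odot>\<^bsub>A\<^esub> \<one>)"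
    and scalar_mult: "(c * c') \<odot>\<^bsub>A\<^esub> \<one> = (c \<odot>\<^bsub>A\<^esub> \<one>) \<otimes> (c' \<odot>\<^bsub>A\<^esub> \<one>)"
    and scalar_one: "1 \<odot>\<^bsub>A\<^esub> \<one> = \<one>"
begin

definition scal :: "('a, 'n) module \<Rightarrow> 'k \<Rightarrow> 'n \<Rightarrow> 'n" where
  "scal N c y = (c \<odot>\<^bsub>A\<^esub> \<one>) \<odot>\<^bsub>N\<^esub> y"

context
  fixes N :: "('a, 'n) module"
  assumes lN: "left_module A N"
begin

interpretation N: left_module A N by (fact lN)

lemma lin_map_scal: "lin_map A N N (scal N c)"
  unfolding scal_def
  by (rule lin_mapI)
    (auto simp: scalar_closed N.smult_closed N.smult_r_distr scalar_central simp flip: N.smult_assoc1)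

lemma scal_simps:
  "y \<in> carrier N \<Longrightarrow> scal N c y \<in> carrier N"
  "y \<in> carrier N \<Longrightarrow> scal N (c + c') y = scal N c y \<oplus>\<^bsub>N\<^esub> scal N c' y"
  "y \<in> carrier N \<Longrightarrow> scal N (c * c') y = scal N c (scal N c' y)"
  "y \<in> carrier N \<Longrightarrow> scal N 1 y = y"
  "y \<in> carrier N \<Longrightarrow> y' \<in> carrier N \<Longrightarrow> scal N c (y \<oplus>\<^bsub>N\<^esub> y') = scal N c y \<oplus>\<^bsub>N\<^esub> scal N c y'"
  by (simp_all add: scal_def scalar_closed scalar_add scalar_mult scalar_one N.smult_closed
      N.smult_l_distr N.smult_r_distr N.smult_assoc1 N.smult_one)

lemma left_module_hom_space:
  assumes lM: "left_module A M"
  shows "left_module field_ring (hom_space A M N)"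
proof -
  interpret M: left_module A M by (fact lM)
  note mh = mod_hom_iff
  have cl: "f x \<in> carrier N" if "f \<in> mod_hom A M N" "x \<in> carrier M" for f x
    using that by (auto simp: mh lin_map_closed)
  have ext: "f = g" if "f \<in> mod_hom A M N" "g \<in> extensional (carrier M)"
    "\<And>x. x \<in> carrier M \<Longrightarrow> f x = g x" for f g
    using that by (auto simp: mh intro: extensionalityI)
  have restr: "(\<lambda>x\<in>carrier M. f x) \<in> mod_hom A M N" if "lin_map A M N f" for f
    using lin_map_cong[OF lM that, of "\<lambda>x\<in>carrier M. f x"] by (simp add: mh)
  have zero: "(\<lambda>x\<in>carrier M. \<zero>\<^bsub>N\<^esub>) \<in> mod_hom A M N"
    by (intro restr lin_mapI) (auto simp: N.smult_r_null)
  have add: "(\<lambda>x\<in>carrier M. f x \<oplus>\<^bsub>N\<^esub> g x) \<in> mod_hom A M N"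
    if "f \<in> mod_hom A M N" "g \<in> mod_hom A M N" for f g
    using that by (intro restr lin_map_sum[OF lN]) (auto simp: mh)
  have sc: "(\<lambda>x\<in>carrier M. scal N c (f x)) \<in> mod_hom A M N" if "f \<in> mod_hom A M N" for f c
    using that by (intro restr lin_map_compose[OF _ lin_map_scal]) (auto simp: mh)
  have ab: "abelian_group (hom_space A M N)"
  proof (rule abelian_groupI; unfold hom_space_def; simp)
    fix f g h
    assume f: "f \<in> mod_hom A M N" and g: "g \<in> mod_hom A M N" and h: "h \<in> mod_hom A M N"
    show "(\<lambda>x\<in>carrier M. (if x \<in> carrier M then f x \<oplus>\<^bsub>N\<^esub> g x else undefined) \<oplus>\<^bsub>N\<^esub> h x) =
      (\<lambda>x\<in>carrier M. f x \<oplus>\<^bsub>N\<^esub> (if x \<in> carrier M then g x \<oplus>\<^bsub>N\<^esub> h x else undefined))"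
      using cl[OF f] cl[OF g] cl[OF h] by (auto simp: fun_eq_iff N.M.a_assoc restrict_def)
  next
    fix f g
    assume f: "f \<in> mod_hom A M N" and g: "g \<in> mod_hom A M N"
    show "(\<lambda>x\<in>carrier M. f x \<oplus>\<^bsub>N\<^esub> g x) \<in> mod_hom A M N" by (rule add[OF f g])
    show "(\<lambda>x\<in>carrier M. f x \<oplus>\<^bsub>N\<^esub> g x) = (\<lambda>x\<in>carrier M. g x \<oplus>\<^bsub>N\<^esub> f x)"
      using cl[OF f] cl[OF g] by (auto simp: fun_eq_iff N.M.a_comm restrict_def)
  next
    show "(\<lambda>x\<in>carrier M. \<zero>\<^bsub>N\<^esub>) \<in> mod_hom A M N" by (rule zero)
  next
    fix f assume f: "f \<in> mod_hom A M N"
    show "(\<lambda>x\<in>carrier M. (if x \<in> carrier M then \<zero>\<^bsub>N\<^esub> else undefined) \<oplus>\<^bsub>N\<^esub> f x) = f"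
      by (rule sym, rule ext[OF f]) (use cl[OF f] in auto)
    have "lin_map A M N (\<lambda>x. \<zero>\<^bsub>N\<^esub> \<ominus>\<^bsub>N\<^esub> f x)"
    proof (rule lin_map_diff[OF lM lN])
      show "lin_map A M N (\<lambda>x. \<zero>\<^bsub>N\<^esub>)" by (rule lin_mapI) (auto simp: N.smult_r_null)
      show "lin_map A M N f" using f by (simp add: mh)
    qed
    then show "\<exists>g\<in>mod_hom A M N. (\<lambda>x\<in>carrier M. g x \<oplus>\<^bsub>N\<^esub> f x) = (\<lambda>x\<in>carrier M. \<zero>\<^bsub>N\<^esub>)"
      using cl[OF f] by (intro bexI[OF _ restr]) (auto simp: fun_eq_iff restrict_def a_minus_def N.M.l_neg)
  qed
  have hs: "carrier (hom_space A M N) = mod_hom A M N"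
    "f \<oplus>\<^bsub>hom_space A M N\<^esub> g = (\<lambda>x\<in>carrier M. f x \<oplus>\<^bsub>N\<^esub> g x)"
    "c \<odot>\<^bsub>hom_space A M N\<^esub> f = (\<lambda>x\<in>carrier M. scal N c (f x))" for f g c
    by (simp_all add: hom_space_def scal_def)
  have "left_module_axioms field_ring (hom_space A M N)"
  proof (rule left_module_axioms.intro; unfold hs field_ring_simps)
    fix f g c c' assume f: "f \<in> mod_hom A M N"
    note c = cl[OF f]
    show "(\<lambda>x\<in>carrier M. scal N c (f x)) \<in> mod_hom A M N" by (rule sc[OF f])
    show "(\<lambda>x\<in>carrier M. scal N (c + c') (f x)) = (\<lambda>x\<in>carrier M.
      (\<lambda>x\<in>carrier M. scal N c (f x)) x \<oplus>\<^bsub>N\<^esub> (\<lambda>x\<in>carrier M. scal N c' (f x)) x)"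
      by (rule restrict_ext) (simp add: c scal_simps)
    show "(\<lambda>x\<in>carrier M. scal N (c * c') (f x)) =
      (\<lambda>x\<in>carrier M. scal N c ((\<lambda>x\<in>carrier M. scal N c' (f x)) x))"
      by (rule restrict_ext) (simp add: c scal_simps)
    show "(\<lambda>x\<in>carrier M. scal N 1 (f x)) = f"
      by (rule sym, rule ext[OF f]) (simp_all add: c scal_simps)
    assume g: "g \<in> mod_hom A M N"
    show "(\<lambda>x\<in>carrier M. scal N c ((\<lambda>x\<in>carrier M. f x \<oplus>\<^bsub>N\<^esub> g x) x)) = (\<lambda>x\<in>carrier M.
      (\<lambda>x\<in>carrier M. scal N c (f x)) x \<oplus>\<^bsub>N\<^esub> (\<lambda>x\<in>carrier M. scal N c (g x)) x)"
      by (rule restrict_ext) (simp add: c cl[OF g] scal_simps)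
  qed
  with ab show ?thesis by (simp add: left_module_def ring_field_ring)
qed

lemma hom_cocycles_iff:
  assumes "lin_map A (P (Suc n)) (P n) (d n)"
  shows "f \<in> hom_cocycles A P d N n \<longleftrightarrow> cocyc A P d N n f \<and> f \<in> extensional (carrier (P n))"
  using lin_map_closed[OF assms]
  by (auto simp: hom_cocycles_def cocyc_def mod_hom_iff coboundary_map_def hom_space_def compose_def
      fun_eq_iff restrict_def)

lemma hom_coboundaries_iff:
  assumes lP: "\<And>n. left_module A (P n)" and d: "\<And>n. lin_map A (P (Suc n)) (P n) (d n)"
  shows "f \<in> hom_coboundaries A P d N n \<longleftrightarrow> cobound A P d N n f \<and> f \<in> extensional (carrier (P n))"
proof (cases n)
  case 0
  then show ?thesis
    by (auto simp: hom_coboundaries_def cobound_def hom_space_def intro: extensionalityI)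
next
  case (Suc m)
  show ?thesis
  proof
    assume "f \<in> hom_coboundaries A P d N n"
    then show "cobound A P d N n f \<and> f \<in> extensional (carrier (P n))"
      by (auto simp: Suc hom_coboundaries_def cobound_def coboundary_map_def mod_hom_iff compose_def)
  next
    assume f: "cobound A P d N n f \<and> f \<in> extensional (carrier (P n))"
    then obtain g where g: "lin_map A (P m) N g" "\<And>x. x \<in> carrier (P n) \<Longrightarrow> f x = g (d m x)"
      by (auto simp: Suc cobound_def)
    let ?g = "restrict g (carrier (P m))"
    have "?g \<in> mod_hom A (P m) N"
      using lin_map_cong[OF lP g(1), of ?g] by (simp add: mod_hom_iff)
    moreover have "f = compose (carrier (P n)) ?g (d m)"
      using f g(2) lin_map_closed[OF d, of _ m] by (auto simp: Suc compose_def intro: extensionalityI)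
    ultimately show "f \<in> hom_coboundaries A P d N n"
      by (auto simp: Suc hom_coboundaries_def coboundary_map_def)
  qed
qed

context
  fixes M :: "('a, 'm) module" and Q :: "nat \<Rightarrow> ('a, 'q) module" and dQ eQ
  assumes lM: "left_module A M" and Q: "projective_resolution A M Q dQ eQ"
begin

text \<open>The answer found on any resolution \<open>Q\<close> is carried to the chosen one; the
  cosets forming \<open>Ext\<close> are then compared by means of \<open>cobound\<close>.\<close>

lemma
  shows Ext_vanishes:
      "(\<And>f. cocyc A Q dQ N n f \<Longrightarrow> cobound A Q dQ N n f) \<Longrightarrow>
       carrier (Ext A n M N) = {\<zero>\<^bsub>Ext A n M N\<^esub>}"
    and Ext_line: "cohomology_line A Q dQ N (scal N) n \<Longrightarrow> has_dimension (Ext A n M N) 1"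
proof -
  obtain P d e where ch: "chosen_resolution A M = (P, d, e)" by (metis prod_cases3)
  \<comment> \<open>The choice operator yields a resolution only once one is known to exist in its
    own type.\<close>
  obtain P' :: "nat \<Rightarrow> ('a, nat \<Rightarrow> 'a) module" and d' e' where
    "projective_resolution A M P' d' e'"
    using projective_resolution_transport[OF Q] by (elim exE) (rule that)
  then have "case chosen_resolution A M of (P, d, e) \<Rightarrow> projective_resolution A M P d e"
    unfolding chosen_resolution_def by (intro someI[of "\<lambda>(P, d, e). projective_resolution A M P d e" "(P', d', e')"]) (simp only: prod.case)
  then have P: "projective_resolution A M P d e" by (simp add: ch)
  note p = projective_resolutionD[OF P]
  have lP: "\<And>n. left_module A (P n)" and d: "\<And>n. lin_map A (P (Suc n)) (P n) (d n)" by (rule p)+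
  define H where "H = hom_space A (P n) N"
  define Z where "Z = hom_cocycles A P d N n"
  define B where "B = hom_coboundaries A P d N n"
  define G where "G = H\<lparr>carrier := Z\<rparr>"
  define E where "E = quotient_module G B"
  have E: "Ext A n M N = E" by (simp add: Ext_def ch hom_cohomology_def E_def G_def H_def Z_def B_def)
  have Z: "f \<in> Z \<longleftrightarrow> cocyc A P d N n f \<and> f \<in> extensional (carrier (P n))" for f
    unfolding Z_def by (rule hom_cocycles_iff) (rule d)
  have B: "f \<in> B \<longleftrightarrow> cobound A P d N n f \<and> f \<in> extensional (carrier (P n))" for f
    unfolding B_def by (rule hom_coboundaries_iff) (rule lP d)+
  have Hs: "carrier H = mod_hom A (P n) N" "\<zero>\<^bsub>H\<^esub> = (\<lambda>x\<in>carrier (P n). \<zero>\<^bsub>N\<^esub>)"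
    "f \<oplus>\<^bsub>H\<^esub> g = (\<lambda>x\<in>carrier (P n). f x \<oplus>\<^bsub>N\<^esub> g x)"
    "c \<odot>\<^bsub>H\<^esub> f = (\<lambda>x\<in>carrier (P n). scal N c (f x))" for f g c
    by (simp_all add: H_def hom_space_def scal_def)
  interpret H: left_module field_ring H unfolding H_def by (rule left_module_hom_space[OF lP])
  have ccong: "cocyc A P d N n g" if "cocyc A P d N n f" "\<And>x. x \<in> carrier (P n) \<Longrightarrow> f x = g x" for f g
    using that lin_map_cong[OF lP, of n N f g] lin_map_closed[OF d] by (auto simp: cocyc_def)
  have zc: "cocyc A P d N n (\<lambda>x. \<zero>\<^bsub>N\<^esub>)"
    by (auto simp: cocyc_def N.smult_r_null intro!: lin_mapI)
  have zb: "cobound A P d N n (\<lambda>x. \<zero>\<^bsub>N\<^esub>)"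
    using lin_mapI[of "P m" "\<lambda>x. \<zero>\<^bsub>N\<^esub>" N A for m]
    by (cases n) (auto simp: cobound_def N.smult_r_null)
  have add_diff: "y \<ominus>\<^bsub>N\<^esub> (\<zero>\<^bsub>N\<^esub> \<ominus>\<^bsub>N\<^esub> y') = y \<oplus>\<^bsub>N\<^esub> y'" if "y \<in> carrier N" "y' \<in> carrier N" for y y'
    using that by (simp add: a_minus_def)
  have sum: "cocyc A P d N n (\<lambda>x. f x \<oplus>\<^bsub>N\<^esub> g x)" if "cocyc A P d N n f" "cocyc A P d N n g" for f g
  proof (rule ccong[OF cocyc_diff[where P = P, OF lP lN that(1) cocyc_diff[where P = P, OF lP lN zc that(2)]]])
    fix x assume "x \<in> carrier (P n)"
    then show "f x \<ominus>\<^bsub>N\<^esub> (\<zero>\<^bsub>N\<^esub> \<ominus>\<^bsub>N\<^esub> g x) = f x \<oplus>\<^bsub>N\<^esub> g x"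
      by (intro add_diff cocyc_closed[OF that(1)] cocyc_closed[OF that(2)])
  qed
  have bl: "lin_map A (P n) N f" if "cobound A P d N n f" for f
    by (rule lin_map_cobound[where P = P and d = d, OF lP d lN that])
  have sumb: "cobound A P d N n (\<lambda>x. f x \<oplus>\<^bsub>N\<^esub> g x)" if "cobound A P d N n f" "cobound A P d N n g" for f g
  proof (rule cobound_cong[OF cobound_diff[where P = P, OF lP lN that(1) cobound_diff[where P = P, OF lP lN zb that(2)]]])
    fix x assume "x \<in> carrier (P n)"
    then show "f x \<ominus>\<^bsub>N\<^esub> (\<zero>\<^bsub>N\<^esub> \<ominus>\<^bsub>N\<^esub> g x) = f x \<oplus>\<^bsub>N\<^esub> g x"
      by (intro add_diff lin_map_closed[OF bl[OF that(1)]] lin_map_closed[OF bl[OF that(2)]])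
  qed
  have r: "restrict f (carrier (P n)) \<in> Z" if "cocyc A P d N n f" for f
    using ccong[OF that, of "restrict f (carrier (P n))"] by (simp add: Z)
  have rb: "restrict f (carrier (P n)) \<in> B" if "cobound A P d N n f" for f
    using cobound_cong[OF that, of "restrict f (carrier (P n))"] by (simp add: B)
  have sZ: "submodule Z field_ring H"
  proof (rule H.left_submoduleI)
    show "Z \<subseteq> carrier H" by (auto simp: Z Hs mod_hom_iff cocyc_def)
    show "\<zero>\<^bsub>H\<^esub> \<in> Z" unfolding Hs by (rule r[OF zc])
    fix f assume f: "f \<in> Z"
    show "c \<odot>\<^bsub>H\<^esub> f \<in> Z" for c
      unfolding Hs using f by (intro r cocyc_lin_map[OF lN lN lin_map_scal]) (simp add: Z)
    show "f \<oplus>\<^bsub>H\<^esub> g \<in> Z" if "g \<in> Z" for g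
      unfolding Hs using f that by (intro r sum) (simp_all add: Z)
  qed
  have sB': "submodule B field_ring H"
  proof (rule H.left_submoduleI)
    show "B \<subseteq> carrier H" by (auto simp: B Hs mod_hom_iff bl)
    show "\<zero>\<^bsub>H\<^esub> \<in> B" unfolding Hs by (rule rb[OF zb])
    fix f assume f: "f \<in> B"
    show "c \<odot>\<^bsub>H\<^esub> f \<in> B" for c
      unfolding Hs using f by (intro rb cobound_lin_map[OF lN lN lin_map_scal]) (simp add: B)
    show "f \<oplus>\<^bsub>H\<^esub> g \<in> B" if "g \<in> B" for g
      unfolding Hs using f that by (intro rb sumb) (simp_all add: B)
  qed
  have "cocyc A P d N n f" if "cobound A P d N n f" for f
  proof (cases n)
    case 0
    with that bl[OF that] lin_map_closed[OF d] show ?thesis by (auto simp: cobound_def cocyc_def)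
  next
    case (Suc m)
    with that bl[OF that] lin_map_closed[OF d] show ?thesis
      by (auto simp: cobound_def cocyc_def projective_resolution_comp_zero(2)[OF P]
          lin_map_zero[OF lP lN])
  qed
  then have BZ: "B \<subseteq> Z" by (auto simp: B Z)
  have lG: "left_module field_ring G" unfolding G_def by (rule left_module_submodule[OF H.left_module_axioms sZ])
  have sB: "submodule B field_ring G" unfolding G_def
    by (rule submodule_restrict[OF H.left_module_axioms sB' sZ BZ])
  interpret G: left_module field_ring G by (fact lG)
  interpret EE: left_module field_ring E unfolding E_def by (rule left_module_quotient[OF lG sB])
  have Gs: "carrier G = Z" "f \<oplus>\<^bsub>G\<^esub> g = (\<lambda>x\<in>carrier (P n). f x \<oplus>\<^bsub>N\<^esub> g x)"
    "c \<odot>\<^bsub>G\<^esub> f = (\<lambda>x\<in>carrier (P n). scal N c (f x))" for f g c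
    by (simp_all add: G_def Hs)
  have Ec: "carrier E = (\<lambda>f. B +>\<^bsub>G\<^esub> f) ` Z" by (simp add: E_def carrier_quotient_module Gs)
  have E0: "\<zero>\<^bsub>E\<^esub> = B" by (simp add: E_def quotient_module_simps)
  have cos: "B +>\<^bsub>G\<^esub> f = B +>\<^bsub>G\<^esub> g \<longleftrightarrow> cobound A P d N n (\<lambda>x. f x \<ominus>\<^bsub>N\<^esub> g x)"
    if f: "f \<in> Z" and g: "g \<in> Z" for f g
  proof -
    let ?h = "f \<ominus>\<^bsub>G\<^esub> g"
    have h: "?h \<in> Z" using f g G.M.minus_closed by (simp add: Gs)
    have fg: "f \<in> carrier G" "g \<in> carrier G" using f g by (simp_all add: Gs(1))
    then have eqf: "f = ?h \<oplus>\<^bsub>G\<^esub> g" by (simp add: a_minus_def G.M.a_assoc G.M.l_neg)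
    have fx: "f x = ?h x \<oplus>\<^bsub>N\<^esub> g x" if "x \<in> carrier (P n)" for x
      using fun_cong[OF eqf, of x] that unfolding Gs(2) by (simp only: restrict_apply if_True)
    have sub: "y' = y \<oplus>\<^bsub>N\<^esub> y'' \<Longrightarrow> y = y' \<ominus>\<^bsub>N\<^esub> y''"
      if "y \<in> carrier N" "y' \<in> carrier N" "y'' \<in> carrier N" for y y' y''
      using that by (simp add: a_minus_def N.M.a_assoc N.M.r_neg)
    have eq: "?h x = f x \<ominus>\<^bsub>N\<^esub> g x" if "x \<in> carrier (P n)" for x
      by (rule sub[OF _ _ _ fx[OF that]])
        (use f g h in \<open>auto simp: Z intro: cocyc_closed[where P = P, OF _ that]\<close>)
    have "B +>\<^bsub>G\<^esub> f = B +>\<^bsub>G\<^esub> g \<longleftrightarrow> ?h \<in> B"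
      by (rule quotient_eq_iff[OF lG sB]) (use f g in \<open>simp_all add: Gs\<close>)
    also have "\<dots> \<longleftrightarrow> cobound A P d N n ?h" using h by (auto simp: B Z)
    also have "\<dots> \<longleftrightarrow> cobound A P d N n (\<lambda>x. f x \<ominus>\<^bsub>N\<^esub> g x)"
      by (rule iffI; erule cobound_cong) (simp_all add: eq)
    finally show ?thesis .
  qed
  {
    assume "\<And>f. cocyc A Q dQ N n f \<Longrightarrow> cobound A Q dQ N n f"
    then have "cobound A P d N n f" if "cocyc A P d N n f" for f
      using cohomology_vanish_transfer[OF lM lN P Q _ that] by blast
    then have "Z = B" using BZ by (auto simp: Z B)
    then have "B +>\<^bsub>G\<^esub> f = B" if "f \<in> Z" for f
      using that quotient_eq_zero_iff[OF lG sB, of f] by (simp add: Gs)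
    moreover have "Z \<noteq> {}" using r[OF zc] by blast
    ultimately show "carrier (Ext A n M N) = {\<zero>\<^bsub>Ext A n M N\<^esub>}"
      unfolding E Ec E0 by auto
  }
  assume "cohomology_line A Q dQ N (scal N) n"
  then have "cohomology_line A P d N (scal N) n"
    by (rule cohomology_line_transfer[OF lM lN P Q]) (rule lin_map_scal)
  then obtain b where b: "cocyc A P d N n b" and nb: "\<not> cobound A P d N n b"
    and gen: "\<And>f. cocyc A P d N n f \<Longrightarrow> \<exists>c. cobound A P d N n (\<lambda>x. f x \<ominus>\<^bsub>N\<^esub> scal N c (b x))"
    unfolding cohomology_line_def by blast
  let ?b = "restrict b (carrier (P n))"
  have bZ: "?b \<in> Z" by (rule r[OF b])
  have bN: "b x \<in> carrier N" if "x \<in> carrier (P n)" for x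
    by (rule cocyc_closed[OF b that])
  have smZ: "(\<lambda>x\<in>carrier (P n). scal N c (?b x)) \<in> Z" for c
    using submodule_smult[OF sZ, of c ?b] bZ by (simp add: Hs)
  have sm: "c \<odot>\<^bsub>E\<^esub> (B +>\<^bsub>G\<^esub> ?b) = B +>\<^bsub>G\<^esub> (\<lambda>x\<in>carrier (P n). scal N c (?b x))" for c
    unfolding E_def using quotient_smult[OF lG sB, of c ?b] bZ by (simp add: Gs)
  have key: "B +>\<^bsub>G\<^esub> f = c \<odot>\<^bsub>E\<^esub> (B +>\<^bsub>G\<^esub> ?b) \<longleftrightarrow> cobound A P d N n (\<lambda>x. f x \<ominus>\<^bsub>N\<^esub> scal N c (b x))"
    if f: "f \<in> Z" for f c
    unfolding sm cos[OF f smZ]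
    by (rule iffI; erule cobound_cong) simp_all
  \<comment> \<open>Two different scalars would make (c' - c) b a coboundary, and after division
    also \<open>b\<close>.\<close>
  have uniq: "c = c'" if f: "f \<in> Z" and 1: "cobound A P d N n (\<lambda>x. f x \<ominus>\<^bsub>N\<^esub> scal N c (b x))"
    and 2: "cobound A P d N n (\<lambda>x. f x \<ominus>\<^bsub>N\<^esub> scal N c' (b x))" for f c c'
  proof (rule ccontr)
    assume ne: "c \<noteq> c'"
    have "cobound A P d N n (\<lambda>x. scal N (inverse (c' - c))
        (f x \<ominus>\<^bsub>N\<^esub> scal N c (b x) \<ominus>\<^bsub>N\<^esub> (f x \<ominus>\<^bsub>N\<^esub> scal N c' (b x))))"
      by (rule cobound_lin_map[OF lN lN lin_map_scal cobound_diff[where P = P, OF lP lN 1 2]])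
    then have "cobound A P d N n b"
    proof (rule cobound_cong)
      fix x assume x: "x \<in> carrier (P n)"
      have fx: "f x \<in> carrier N" using cocyc_closed[where P = P and n = n, OF _ x] f by (auto simp: Z)
      let ?u = "scal N c (b x)" and ?v = "scal N c' (b x)"
      have uv: "?u \<in> carrier N" "?v \<in> carrier N" using bN[OF x] by (auto simp: scal_simps)
      have "\<ominus>\<^bsub>N\<^esub> (f x \<ominus>\<^bsub>N\<^esub> ?v) = ?v \<oplus>\<^bsub>N\<^esub> \<ominus>\<^bsub>N\<^esub> f x"
        using fx uv by (simp add: a_minus_def N.M.minus_add N.M.a_comm)
      then have "f x \<ominus>\<^bsub>N\<^esub> ?u \<ominus>\<^bsub>N\<^esub> (f x \<ominus>\<^bsub>N\<^esub> ?v) = (f x \<oplus>\<^bsub>N\<^esub> \<ominus>\<^bsub>N\<^esub> f x) \<oplus>\<^bsub>N\<^esub> (?v \<oplus>\<^bsub>N\<^esub> \<ominus>\<^bsub>N\<^esub> ?u)"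
        using fx uv by (simp add: a_minus_def N.M.a_ac)
      also have "\<dots> = ?v \<oplus>\<^bsub>N\<^esub> \<ominus>\<^bsub>N\<^esub> ?u" using fx uv by (simp add: N.M.r_neg)
      also have "?v \<oplus>\<^bsub>N\<^esub> \<ominus>\<^bsub>N\<^esub> ?u = scal N (c' - c) (b x)"
      proof -
        have "?v = scal N (c' - c) (b x) \<oplus>\<^bsub>N\<^esub> ?u"
          using scal_simps(2)[OF bN[OF x], of "c' - c" c] by simp
        then show ?thesis
          using uv(1) scal_simps(1)[OF bN[OF x], of "c' - c"] by (simp add: N.M.a_assoc N.M.r_neg)
      qed
      finally have "f x \<ominus>\<^bsub>N\<^esub> ?u \<ominus>\<^bsub>N\<^esub> (f x \<ominus>\<^bsub>N\<^esub> ?v) = scal N (c' - c) (b x)" .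
      then show "scal N (inverse (c' - c)) (f x \<ominus>\<^bsub>N\<^esub> ?u \<ominus>\<^bsub>N\<^esub> (f x \<ominus>\<^bsub>N\<^esub> ?v)) = b x"
        using bN[OF x] ne by (simp flip: scal_simps(3) add: scal_simps(4))
    qed
    with nb show False ..
  qed
  have bE: "B +>\<^bsub>G\<^esub> ?b \<in> carrier E" using bZ by (auto simp: Ec)
  show "has_dimension (Ext A n M N) 1"
    unfolding E has_dimension_def
  proof (intro bexI[of _ "\<lambda>_. B +>\<^bsub>G\<^esub> ?b"] ballI)
    fix v assume "v \<in> carrier E"
    then obtain f where f: "f \<in> Z" "v = B +>\<^bsub>G\<^esub> f" by (auto simp: Ec)
    have fs: "(\<Oplus>\<^bsub>E\<^esub>i\<in>{..<1::nat}. c i \<odot>\<^bsub>E\<^esub> (B +>\<^bsub>G\<^esub> ?b)) = c 0 \<odot>\<^bsub>E\<^esub> (B +>\<^bsub>G\<^esub> ?b)" for c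
    proof -
      have "{..<1::nat} = insert 0 {}" by auto
      then show ?thesis using bE EE.smult_closed by (simp only: EE.M.finsum_insert finite.emptyI) simp
    qed
    obtain c where c: "cobound A P d N n (\<lambda>x. f x \<ominus>\<^bsub>N\<^esub> scal N c (b x))"
      using gen f by (auto simp: Z)
    show "\<exists>!c. c \<in> {..<1::nat} \<rightarrow>\<^sub>E UNIV \<and> v = (\<Oplus>\<^bsub>E\<^esub>i\<in>{..<1::nat}. c i \<odot>\<^bsub>E\<^esub> (B +>\<^bsub>G\<^esub> ?b))"
    proof (rule ex1I[of _ "\<lambda>i\<in>{..<1::nat}. c"])
      show "(\<lambda>i\<in>{..<1::nat}. c) \<in> {..<1::nat} \<rightarrow>\<^sub>E UNIV \<and>
        v = (\<Oplus>\<^bsub>E\<^esub>i\<in>{..<1::nat}. (\<lambda>i\<in>{..<1::nat}. c) i \<odot>\<^bsub>E\<^esub> (B +>\<^bsub>G\<^esub> ?b))"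
        using key[OF f(1), of c] c f(2) by (subst fs) simp
    next
      fix c' :: "nat \<Rightarrow> 'k"
      assume "c' \<in> {..<1::nat} \<rightarrow>\<^sub>E UNIV \<and> v = (\<Oplus>\<^bsub>E\<^esub>i\<in>{..<1::nat}. c' i \<odot>\<^bsub>E\<^esub> (B +>\<^bsub>G\<^esub> ?b))"
      then have c': "c' \<in> {..<1::nat} \<rightarrow>\<^sub>E UNIV" "v = c' 0 \<odot>\<^bsub>E\<^esub> (B +>\<^bsub>G\<^esub> ?b)" unfolding fs[of c'] by auto
      then have "c' 0 = c" using key[OF f(1)] c f uniq[OF f(1)] by simp
      then show "c' = (\<lambda>i\<in>{..<1::nat}. c)" using c'(1) by (intro extensionalityI[of _ "{..<1::nat}"]) (auto simp: PiE_def)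
    qed
  qed (use bE in auto)
qed

end

end

end

section \<open>The interval algebra in coordinates\<close>

text \<open>\<open>hom_fun R S\<close> describes \<open>Hom(I\<^sub>R, I\<^sub>S)\<close>: a morphism is a function \<open>c\<close>, acting at \<open>x\<close> as
  multiplication by \<open>c x\<close>, so that composition becomes the pointwise product.\<close>

definition hom_fun :: "'p::order set \<Rightarrow> 'p set \<Rightarrow> ('p \<Rightarrow> 'k::field) set" where
  "hom_fun R S = {c. (\<forall>x. x \<notin> R \<inter> S \<longrightarrow> c x = 0) \<and> (\<forall>x\<in>R. \<forall>y\<in>S. x \<le> y \<longrightarrow> c x = c y)}"

lemma hom_fun_supp: "c \<in> hom_fun R S \<Longrightarrow> x \<notin> R \<or> x \<notin> S \<Longrightarrow> c x = 0"
  and hom_fun_eq: "c \<in> hom_fun R S \<Longrightarrow> x \<in> R \<Longrightarrow> y \<in> S \<Longrightarrow> x \<le> y \<Longrightarrow> c x = c y"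
  by (auto simp: hom_fun_def)

lemma hom_funI:
  "(\<And>x. x \<notin> R \<or> x \<notin> S \<Longrightarrow> c x = 0) \<Longrightarrow> (\<And>x y. x \<in> R \<Longrightarrow> y \<in> S \<Longrightarrow> x \<le> y \<Longrightarrow> c x = c y) \<Longrightarrow>
    c \<in> hom_fun R S"
  by (auto simp: hom_fun_def)

lemma hom_fun_zero: "(\<lambda>x. 0) \<in> hom_fun R S"
  and hom_fun_add: "c \<in> hom_fun R S \<Longrightarrow> c' \<in> hom_fun R S \<Longrightarrow> (\<lambda>x. c x + c' x) \<in> hom_fun R S"
  and hom_fun_scale: "c \<in> hom_fun R S \<Longrightarrow> (\<lambda>x. t * c x) \<in> hom_fun R S"
  and hom_fun_id: "(\<lambda>x. if x \<in> R then 1 else 0) \<in> hom_fun R R"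
  by (auto simp: hom_fun_def)

lemma hom_fun_sum:
  "(\<And>i. i \<in> I \<Longrightarrow> c i \<in> hom_fun R S) \<Longrightarrow> (\<lambda>x. \<Sum>i\<in>I. c i x) \<in> hom_fun R S"
proof (induction I rule: infinite_finite_induct)
  case (insert i I)
  then show ?case using hom_fun_add[of "c i" R S "\<lambda>x. \<Sum>i\<in>I. c i x"] by simp
qed (simp_all add: hom_fun_zero)

text \<open>For \<open>x \<le> y\<close> with both points in \<open>U\<close> each factor is
  preserved. If one point is outside \<open>U\<close>, both products vanish: one factor is zero
  there by support, and naturality makes the same factor zero at the other point.\<close>

lemma hom_fun_mult:
  assumes c: "c \<in> hom_fun R U" and c': "c' \<in> hom_fun U S"
  shows "(\<lambda>x. c x * c' x) \<in> hom_fun R S"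
proof (rule hom_funI)
  show "c x * c' x = 0" if "x \<notin> R \<or> x \<notin> S" for x
    using that hom_fun_supp[OF c] hom_fun_supp[OF c'] by auto
  fix x y assume xy: "x \<in> R" "y \<in> S" "x \<le> y"
  show "c x * c' x = c y * c' y"
    using hom_fun_supp[OF c] hom_fun_supp[OF c'] hom_fun_eq[OF c xy(1) _ xy(3)] hom_fun_eq[OF c' _ xy(2,3)]
    by (metis mult_eq_0_iff)
qed

text \<open>Both ends of each comparability in \<open>W\<close> lie in \<open>R\<close> and in
  \<open>S\<close>, so naturality applies in whichever direction the order points.\<close>

lemma hom_fun_const:
  assumes c: "c \<in> hom_fun R S" and W: "poset_connected W" "W \<subseteq> R" "W \<subseteq> S" and "x \<in> W" "y \<in> W"
  shows "c x = c y"
proof -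
  have "(x, y) \<in> {(a, b). a \<in> W \<and> b \<in> W \<and> (a \<le> b \<or> b \<le> a)}\<^sup>*"
    using W assms(5,6) by (auto simp: poset_connected_def)
  then show ?thesis
  proof (induction rule: rtrancl_induct)
    case (step y z)
    then have "y \<in> W" "z \<in> W" "y \<le> z \<or> z \<le> y" by auto
    then have "c y = c z"
      using hom_fun_eq[OF c subsetD[OF W(2)] subsetD[OF W(3)]] by metis
    with step.IH show ?case by (rule trans)
  qed simp
qed

lemma intervals_connected: "S \<in> intervals \<Longrightarrow> poset_connected S"
  by (simp add: intervals_def)

text \<open>The endomorphism ring of \<open>I\<^sub>C\<close> is \<open>k\<close>, and a nonzero composite \<open>I\<^sub>C \<rightarrow> I\<^sub>U \<rightarrow> I\<^sub>C\<close> forces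
  \<open>U\<close> to be closed under comparability with elements of \<open>C\<close>.\<close>

lemma hom_fun_loop_zero:
  assumes C: "C \<in> intervals" and U: "U \<in> intervals" and ne: "U \<noteq> C"
    and c: "c \<in> hom_fun C U" and c': "c' \<in> hom_fun U C"
  shows "c x * c' x = 0"
proof (rule ccontr)
  assume nz: "c x * c' x \<noteq> 0"
  have x: "x \<in> C" "x \<in> U" using nz hom_fun_supp[OF c, of x] by auto
  have nzC: "c y * c' y \<noteq> 0" if "y \<in> C" for y
    using hom_fun_const[OF hom_fun_mult[OF c c'] intervals_connected[OF C] order_refl order_refl x(1) that] nz
    by simp
  then have CU: "C \<subseteq> U" using hom_fun_supp[OF c] by fastforce
  moreover have "U \<subseteq> C"
  proof
    fix y assume "y \<in> U"
    then have "(x, y) \<in> {(a, b). a \<in> U \<and> b \<in> U \<and> (a \<le> b \<or> b \<le> a)}\<^sup>*"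
      using intervals_connected[OF U] x by (auto simp: poset_connected_def)
    then show "y \<in> C"
    proof (induction rule: rtrancl_induct)
      case (step y z)
      then have yz: "y \<in> C" "y \<in> U" "z \<in> U" "y \<le> z \<or> z \<le> y" by auto
      \<comment> \<open>Going up from \<open>y\<close> uses naturality of \<open>c\<close>, going
        down that of \<open>c'\<close>; either way some factor survives at \<open>z\<close>, which
        therefore lies in \<open>C\<close>.\<close>
      then have "c z \<noteq> 0 \<or> c' z \<noteq> 0"
        using hom_fun_eq[OF c, of y z] hom_fun_eq[OF c', of z y] nzC[of y] by auto
      then show ?case using hom_fun_supp[OF c] hom_fun_supp[OF c'] by metis
    qed (rule x(1))
  qed
  ultimately show False using ne by blast
qed

definition unit_vec :: "'p set \<Rightarrow> 'p set \<Rightarrow> 'k::field" where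
  "unit_vec R = (\<lambda>Q. if Q = R then 1 else 0)"

text \<open>The matrix entry from I_R to I_S at \<open>x\<close>. For \<open>x\<close> outside
  \<open>R\<close> the unit vector is outside the space at \<open>x\<close>, where a morphism is
  zero by convention, so the entry vanishes there as it should.\<close>

definition coord :: "('k::field, 'p::order) interval_endo \<Rightarrow> 'p set \<Rightarrow> 'p set \<Rightarrow> 'p \<Rightarrow> 'k" where
  "coord a R S x = a x (unit_vec R) S"

definition is_mat :: "('p::order set \<Rightarrow> 'p set \<Rightarrow> 'p \<Rightarrow> 'k::field) \<Rightarrow> bool" where
  "is_mat c \<longleftrightarrow> (\<forall>R S. c R S \<in> hom_fun R S) \<and> (\<forall>R S x. R \<notin> intervals \<or> S \<notin> intervals \<longrightarrow> c R S x = 0)"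

text \<open>The sum may run over all sets, because \<open>is_mat\<close> makes the entries at
  non-intervals vanish.\<close>

definition of_mat :: "('p::{finite,order} set \<Rightarrow> 'p set \<Rightarrow> 'p \<Rightarrow> 'k::field) \<Rightarrow> ('k, 'p) interval_endo" where
  "of_mat c = (\<lambda>x v. if v \<in> rspace interval_generator x then (\<lambda>S. \<Sum>R\<in>UNIV. c R S x * v R) else 0)"

abbreviation "\<Lambda> \<equiv> interval_algebra"

section \<open>The ring structure of the interval algebra\<close>

lemma interval_algebra_simps:
  "carrier \<Lambda> = rep_hom interval_generator interval_generator"
  "a \<otimes>\<^bsub>\<Lambda>\<^esub> b = (\<lambda>x v. b x (a x v))"
  "\<one>\<^bsub>\<Lambda>\<^esub> = (\<lambda>x v. if v \<in> rspace interval_generator x then v else 0)"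
  "\<zero>\<^bsub>\<Lambda>\<^esub> = (\<lambda>x v. 0)"
  "a \<oplus>\<^bsub>\<Lambda>\<^esub> b = (\<lambda>x v. a x v + b x v)"
  "c \<odot>\<^bsub>\<Lambda>\<^esub> a = (\<lambda>x v S. c * a x v S)"
  by (simp_all add: interval_algebra_def rep_End_op_def interval_generator_simps)

abbreviation gspace :: "'p::order \<Rightarrow> ('p set \<Rightarrow> 'k::field) set" where
  "gspace \<equiv> rspace interval_generator"

lemma gspace_iff: "v \<in> gspace x \<longleftrightarrow> (\<forall>S. S \<notin> intervals \<or> x \<notin> S \<longrightarrow> v S = 0)"
  by (simp add: interval_generator_simps)

lemma carrier_interval_algebra_iff:
  "a \<in> carrier \<Lambda> \<longleftrightarrow>
    (\<forall>x. \<forall>v\<in>gspace x. a x v \<in> gspace x) \<and>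
    (\<forall>x v. v \<notin> gspace x \<longrightarrow> a x v = 0) \<and>
    (\<forall>x. \<forall>v\<in>gspace x. \<forall>w\<in>gspace x. a x (v + w) = a x v + a x w) \<and>
    (\<forall>x c. \<forall>v\<in>gspace x. a x (\<lambda>S. c * v S) = (\<lambda>S. c * a x v S)) \<and>
    (\<forall>x y. x \<le> y \<longrightarrow> (\<forall>v\<in>gspace x.
       a y (\<lambda>S. if S \<in> intervals \<and> x \<in> S \<and> y \<in> S then v S else 0) =
       (\<lambda>S. if S \<in> intervals \<and> x \<in> S \<and> y \<in> S then a x v S else 0)))"
  by (simp add: interval_algebra_simps rep_hom_def interval_generator_simps(2,3) Pi_iff)

lemma gspace_zero: "0 \<in> gspace x"
  and gspace_add: "v \<in> gspace x \<Longrightarrow> w \<in> gspace x \<Longrightarrow> v + w \<in> gspace x"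
  and gspace_scale: "v \<in> gspace x \<Longrightarrow> (\<lambda>S. c * v S) \<in> gspace x"
  and gspace_uminus: "v \<in> gspace x \<Longrightarrow> (\<lambda>S. - v S) \<in> gspace x"
  and gspace_map: "v \<in> gspace x \<Longrightarrow> (\<lambda>S. if S \<in> intervals \<and> x \<in> S \<and> y \<in> S then v S else 0) \<in> gspace y"
  and gspace_unit_vec: "unit_vec R \<in> gspace x \<longleftrightarrow> R \<in> intervals \<and> x \<in> R"
  by (auto simp: gspace_iff unit_vec_def)

context
  fixes a :: "('k::field, 'p::order) interval_endo"
  assumes a: "a \<in> carrier \<Lambda>"
begin

lemma endo_closed: "v \<in> gspace x \<Longrightarrow> a x v \<in> gspace x"
  and endo_outside: "v \<notin> gspace x \<Longrightarrow> a x v = 0"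
  and endo_add: "v \<in> gspace x \<Longrightarrow> w \<in> gspace x \<Longrightarrow> a x (v + w) = a x v + a x w"
  and endo_scale: "v \<in> gspace x \<Longrightarrow> a x (\<lambda>S. c * v S) = (\<lambda>S. c * a x v S)"
  and endo_natural: "x \<le> y \<Longrightarrow> v \<in> gspace x \<Longrightarrow>
       a y (\<lambda>S. if S \<in> intervals \<and> x \<in> S \<and> y \<in> S then v S else 0) =
       (\<lambda>S. if S \<in> intervals \<and> x \<in> S \<and> y \<in> S then a x v S else 0)"
proof -
  note e = a[unfolded carrier_interval_algebra_iff]
  note e2 = e[THEN conjunct2] and e3 = e[THEN conjunct2, THEN conjunct2]
  show "v \<in> gspace x \<Longrightarrow> a x v \<in> gspace x" by (rule e[THEN conjunct1, rule_format])
  show "v \<notin> gspace x \<Longrightarrow> a x v = 0" by (rule e2[THEN conjunct1, rule_format])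
  show "v \<in> gspace x \<Longrightarrow> w \<in> gspace x \<Longrightarrow> a x (v + w) = a x v + a x w"
    by (rule e3[THEN conjunct1, rule_format])
  show "v \<in> gspace x \<Longrightarrow> a x (\<lambda>S. c * v S) = (\<lambda>S. c * a x v S)"
    by (rule e3[THEN conjunct2, THEN conjunct1, rule_format])
  show "x \<le> y \<Longrightarrow> v \<in> gspace x \<Longrightarrow>
       a y (\<lambda>S. if S \<in> intervals \<and> x \<in> S \<and> y \<in> S then v S else 0) =
       (\<lambda>S. if S \<in> intervals \<and> x \<in> S \<and> y \<in> S then a x v S else 0)"
    by (rule e3[THEN conjunct2, THEN conjunct2, rule_format])
qed

lemma endo_zero: "a x 0 = 0"
  using endo_add[OF gspace_zero gspace_zero, of x] by simp

lemma endo_in_gspace: "a x v \<in> gspace x"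
  using endo_closed[of v x] endo_outside[of v x] gspace_zero by (cases "v \<in> gspace x") simp_all

end

lemma ring_interval_algebra: "ring (\<Lambda> :: ('k::field, ('k, 'p::order) interval_endo) module)"
proof -
  have "abelian_group (\<Lambda> :: ('k, ('k, 'p) interval_endo) module)"
  proof (rule abelian_groupI; unfold interval_algebra_simps(4,5))
    fix a b :: "('k, 'p) interval_endo" assume a: "a \<in> carrier \<Lambda>"
    show "(\<lambda>x v. a x v + b x v) \<in> carrier \<Lambda>" if b: "b \<in> carrier \<Lambda>"
      unfolding carrier_interval_algebra_iff
      by (auto simp: endo_closed[OF a] endo_closed[OF b] gspace_add endo_outside[OF a] endo_outside[OF b]
        endo_add[OF a] endo_add[OF b] endo_scale[OF a] endo_scale[OF b] endo_natural[OF a]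
        endo_natural[OF b] fun_eq_iff algebra_simps)
    have "(\<lambda>x v S. - a x v S) \<in> carrier \<Lambda>"
      unfolding carrier_interval_algebra_iff
      by (auto simp: gspace_uminus endo_closed[OF a] endo_outside[OF a] endo_add[OF a] endo_scale[OF a]
        endo_natural[OF a] fun_eq_iff)
    moreover have "(\<lambda>x v. (\<lambda>S. - a x v S) + a x v) = (\<lambda>x v. 0)" by (simp add: fun_eq_iff)
    ultimately show "\<exists>b\<in>carrier \<Lambda>. (\<lambda>x v. b x v + a x v) = (\<lambda>x v. 0)"
      by (intro bexI[of _ "\<lambda>x v S. - a x v S"])
  next
    show "(\<lambda>x v. 0) \<in> carrier (\<Lambda> :: ('k, ('k, 'p) interval_endo) module)"
      unfolding carrier_interval_algebra_iff
      by (intro conjI allI ballI impI ext) (simp_all add: gspace_zero)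
  qed (auto simp: algebra_simps)
  moreover have "Group.monoid (\<Lambda> :: ('k, ('k, 'p) interval_endo) module)"
  proof (rule monoidI; unfold interval_algebra_simps(2,3))
    fix a b :: "('k, 'p) interval_endo" assume a: "a \<in> carrier \<Lambda>"
    show "(\<lambda>x v. b x (a x v)) \<in> carrier \<Lambda>" if b: "b \<in> carrier \<Lambda>"
      unfolding carrier_interval_algebra_iff
      by (simp add: endo_closed[OF a] endo_closed[OF b] gspace_add endo_outside[OF a] endo_zero[OF b]
        endo_add[OF a] endo_add[OF b] endo_scale[OF a] endo_scale[OF b] endo_natural[OF a]
        endo_natural[OF b])
    show "(\<lambda>x v. a x (if v \<in> gspace x then v else 0)) = a"
      by (auto simp: fun_eq_iff endo_zero[OF a] endo_outside[OF a])
    show "(\<lambda>x v. if a x v \<in> gspace x then a x v else 0) = a"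
      by (simp add: endo_in_gspace[OF a])
  next
    show "(\<lambda>x v. if v \<in> gspace x then v else 0) \<in>
      carrier (\<Lambda> :: ('k, ('k, 'p) interval_endo) module)"
      unfolding carrier_interval_algebra_iff
      by (intro conjI allI ballI impI) (simp_all add: gspace_add gspace_scale gspace_map)
  qed simp
  ultimately show ?thesis
    by (intro ringI) (simp_all add: interval_algebra_simps(2,5) endo_add endo_in_gspace fun_eq_iff)
qed

lemma left_module_regular_interval:
  "left_module \<Lambda> (regular_module (\<Lambda> :: ('k::field, ('k, 'p::order) interval_endo) module))"
proof -
  interpret ring "\<Lambda> :: ('k, ('k, 'p) interval_endo) module" by (rule ring_interval_algebra)
  let ?M = "regular_module (\<Lambda> :: ('k, ('k, 'p) interval_endo) module)"
  have s: "carrier ?M = carrier \<Lambda>" "\<zero>\<^bsub>?M\<^esub> = \<zero>\<^bsub>\<Lambda>\<^esub>"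
    "x \<oplus>\<^bsub>?M\<^esub> y = x \<oplus>\<^bsub>\<Lambda>\<^esub> y" "x \<odot>\<^bsub>?M\<^esub> y = x \<otimes>\<^bsub>\<Lambda>\<^esub> y" for x y
    by (simp_all add: regular_module_def)
  have "abelian_group ?M"
    by (rule abelian_groupI) (auto simp: s a_ac intro: add.l_inv_ex)
  moreover have "left_module_axioms \<Lambda> ?M"
    by unfold_locales (auto simp: s l_distr r_distr m_assoc)
  ultimately show ?thesis by (simp add: left_module_def ring_axioms)
qed

section \<open>Endomorphisms as matrices of scalar functions\<close>

lemma gspace_sum: "(\<And>i. i \<in> J \<Longrightarrow> f i \<in> gspace x) \<Longrightarrow> (\<Sum>i\<in>J. f i) \<in> gspace x"
  by (induction J rule: infinite_finite_induct) (auto simp: gspace_zero gspace_add)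

lemma sum_apply: "(\<Sum>i\<in>I. f i) x = (\<Sum>i\<in>I. f i x)"
  by (induction I rule: infinite_finite_induct) simp_all

context
  fixes a :: "('k::field, 'p::{finite,order}) interval_endo"
  assumes a: "a \<in> carrier \<Lambda>"
begin

lemma endo_sum: "finite J \<Longrightarrow> (\<And>i. i \<in> J \<Longrightarrow> f i \<in> gspace x) \<Longrightarrow> a x (\<Sum>i\<in>J. f i) = (\<Sum>i\<in>J. a x (f i))"
proof (induction J rule: finite_induct)
  case (insert i J)
  have "a x (sum f (insert i J)) = a x (f i + sum f J)" by (simp only: sum.insert[OF insert(1,2)])
  also have "\<dots> = a x (f i) + a x (sum f J)"
    using insert(4) by (intro endo_add[OF a] gspace_sum) auto
  also have "a x (sum f J) = (\<Sum>i\<in>J. a x (f i))" using insert(4) by (intro insert(3)) auto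
  also have "a x (f i) + (\<Sum>i\<in>J. a x (f i)) = (\<Sum>i\<in>insert i J. a x (f i))"
    by (simp only: sum.insert[OF insert(1,2)])
  finally show ?case .
qed (simp add: endo_zero[OF a])

lemma coord_zero: "R \<notin> intervals \<or> x \<notin> R \<Longrightarrow> coord a R S x = 0"
  using endo_outside[OF a, of "unit_vec R" x] by (auto simp: coord_def gspace_unit_vec)

lemma coord_zero': "S \<notin> intervals \<or> x \<notin> S \<Longrightarrow> coord a R S x = 0"
  using endo_closed[OF a, of "unit_vec R" x] endo_outside[OF a, of "unit_vec R" x]
  by (cases "unit_vec R \<in> (gspace x :: ('p set \<Rightarrow> 'k) set)") (auto simp: coord_def gspace_iff)

lemma endo_expand:
  assumes v: "v \<in> gspace x"
  shows "a x v S = (\<Sum>R\<in>UNIV. coord a R S x * v R)"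
proof -
  let ?I = "{R. R \<in> intervals \<and> x \<in> R}"
  have ve: "v = (\<Sum>R\<in>?I. (\<lambda>S. v R * unit_vec R S))"
  proof
    fix Q
    have "(\<Sum>R\<in>?I. (\<lambda>S. v R * unit_vec R S)) Q = (\<Sum>R\<in>?I. v R * unit_vec R Q)"
      by (rule sum_apply)
    also have "\<dots> = (\<Sum>R\<in>?I. if R = Q then v R else 0)" by (rule sum.cong) (auto simp: unit_vec_def)
    also have "\<dots> = v Q" using v by (auto simp: gspace_iff)
    finally show "v Q = (\<Sum>R\<in>?I. (\<lambda>S. v R * unit_vec R S)) Q" by simp
  qed
  have "a x v S = a x (\<Sum>R\<in>?I. (\<lambda>S. v R * unit_vec R S)) S"
    by (rule arg_cong[OF ve, of "\<lambda>v. a x v S"])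
  also have "\<dots> = (\<Sum>R\<in>?I. a x (\<lambda>S. v R * unit_vec R S)) S"
    by (subst endo_sum) (auto intro!: gspace_scale simp: gspace_unit_vec)
  also have "\<dots> = (\<Sum>R\<in>?I. (\<lambda>S. v R * a x (unit_vec R) S)) S"
    by (rule arg_cong[where f = "\<lambda>f. f S"], rule sum.cong) (auto simp: gspace_unit_vec endo_scale[OF a])
  also have "\<dots> = (\<Sum>R\<in>?I. v R * a x (unit_vec R) S)"
    by (simp add: sum_apply)
  also have "\<dots> = (\<Sum>R\<in>UNIV. coord a R S x * v R)"
    by (rule sum.mono_neutral_cong_left) (auto simp: coord_zero coord_def[symmetric])
  finally show ?thesis .
qed

text \<open>Naturality evaluated at the unit vector of \<open>R\<close>. If \<open>y\<close> is
  outside \<open>R\<close>, the structure map kills this vector, so the equation of entries at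
  \<open>x\<close> and \<open>y\<close> also covers the forced zeros.\<close>

lemma coord_is_mat: "is_mat (coord a)"
  unfolding is_mat_def
proof (intro conjI allI impI)
  fix R S
  show "coord a R S \<in> hom_fun R S"
  proof (rule hom_funI)
    show "coord a R S x = 0" if "x \<notin> R \<or> x \<notin> S" for x using that coord_zero coord_zero' by blast
    fix x y assume xy: "x \<in> R" "y \<in> S" "x \<le> y"
    show "coord a R S x = coord a R S y"
    proof (cases "R \<in> intervals \<and> S \<in> intervals")
      case True
      let ?f = "\<lambda>v Q. if Q \<in> intervals \<and> x \<in> Q \<and> y \<in> Q then v Q else (0::'k)"
      have "a y (?f (unit_vec R)) S = ?f (a x (unit_vec R)) S"
        using endo_natural[OF a xy(3), of "unit_vec R"] True xy by (simp add: gspace_unit_vec)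
      moreover have "?f (unit_vec R) = (if y \<in> R then unit_vec R else 0)"
        using True xy by (auto simp: unit_vec_def fun_eq_iff)
      moreover have "?f (a x (unit_vec R)) S = coord a R S x"
        using xy coord_zero'[of S x R] by (auto simp: coord_def)
      ultimately show ?thesis using coord_zero[of R y S] endo_zero[OF a] by (auto simp: coord_def split: if_splits)
    qed (use coord_zero coord_zero' in auto)
  qed
  show "coord a R S x = 0" if "R \<notin> intervals \<or> S \<notin> intervals" for x
    using that coord_zero coord_zero' by blast
qed

lemma of_mat_coord: "of_mat (coord a) = a"
  by (auto simp: of_mat_def fun_eq_iff endo_outside[OF a] endo_expand)

end

lemma of_mat_closed:
  assumes "is_mat c"
  shows "of_mat c \<in> carrier \<Lambda>"
proof -
  have z: "c R S x = 0" if "S \<notin> intervals \<or> R \<notin> intervals \<or> x \<notin> S \<or> x \<notin> R" for R S x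
    using assms that hom_fun_supp[of "c R S" R S x] by (auto simp: is_mat_def)
  have n: "c R S x = c R S y" if "x \<in> R" "y \<in> S" "x \<le> y" for R S x y
    using assms that hom_fun_eq[of "c R S" R S x y] by (auto simp: is_mat_def)
  show ?thesis
    unfolding carrier_interval_algebra_iff
  proof (intro conjI allI ballI impI)
    fix x y and v :: "'a set \<Rightarrow> 'b" assume xy: "x \<le> y" and v: "v \<in> gspace x"
    show "of_mat c y (\<lambda>S. if S \<in> intervals \<and> x \<in> S \<and> y \<in> S then v S else 0) =
       (\<lambda>S. if S \<in> intervals \<and> x \<in> S \<and> y \<in> S then of_mat c x v S else 0)"
    proof
      fix S
      have "(\<Sum>R\<in>UNIV. c R S y * (if R \<in> intervals \<and> x \<in> R \<and> y \<in> R then v R else 0)) =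
        (\<Sum>R\<in>UNIV. if S \<in> intervals \<and> x \<in> S \<and> y \<in> S then c R S x * v R else 0)"
      proof (rule sum.cong[OF refl])
        fix R
        have v0: "v R = 0" if "R \<notin> intervals \<or> x \<notin> R" using that v by (auto simp: gspace_iff)
        show "c R S y * (if R \<in> intervals \<and> x \<in> R \<and> y \<in> R then v R else 0) =
          (if S \<in> intervals \<and> x \<in> S \<and> y \<in> S then c R S x * v R else 0)"
        proof (cases "R \<in> intervals \<and> x \<in> R \<and> S \<in> intervals \<and> y \<in> S")
          case True
          then have "c R S x = c R S y" using n xy by blast
          moreover have "x \<notin> S \<Longrightarrow> c R S x = 0" "y \<notin> R \<Longrightarrow> c R S y = 0" by (auto intro: z)
          ultimately show ?thesis using True by auto
        next
          case False
          then show ?thesis using v0 z[of S R y] by auto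
        qed
      qed
      then show "of_mat c y (\<lambda>S. if S \<in> intervals \<and> x \<in> S \<and> y \<in> S then v S else 0) S =
         (if S \<in> intervals \<and> x \<in> S \<and> y \<in> S then of_mat c x v S else 0)"
        using v gspace_map[OF v]
        by (cases "S \<in> intervals \<and> x \<in> S \<and> y \<in> S") (auto simp: of_mat_def)
    qed
  qed (auto simp: of_mat_def gspace_add gspace_scale gspace_iff z fun_eq_iff algebra_simps
        sum.distrib sum_distrib_left)
qed

lemma coord_of_mat:
  assumes "is_mat c"
  shows "coord (of_mat c) = c"
proof (intro ext)
  fix R S x
  have z: "c R S x = 0" if "R \<notin> intervals \<or> x \<notin> R"
    using assms that hom_fun_supp[of "c R S" R S x] by (auto simp: is_mat_def)
  have "(\<Sum>Q\<in>UNIV. c Q S x * unit_vec R Q) = (\<Sum>Q\<in>UNIV. if Q = R then c Q S x else 0)"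
    by (rule sum.cong) (auto simp: unit_vec_def)
  then show "coord (of_mat c) R S x = c R S x"
    using z by (auto simp: coord_def of_mat_def gspace_unit_vec)
qed

lemma coord_inj:
  fixes a b :: "('k::field, 'p::{finite,order}) interval_endo"
  shows "a \<in> carrier \<Lambda> \<Longrightarrow> b \<in> carrier \<Lambda> \<Longrightarrow> coord a = coord b \<Longrightarrow> a = b"
  by (metis of_mat_coord)

text \<open>In the opposite algebra the left factor acts first, so this is the ordinary
  row-by-column rule without transposition, applied separately at each point.\<close>

lemma coord_mult:
  fixes a b :: "('k::field, 'p::{finite,order}) interval_endo"
  assumes "a \<in> carrier \<Lambda>" "b \<in> carrier \<Lambda>"
  shows "coord (a \<otimes>\<^bsub>\<Lambda>\<^esub> b) R S x = (\<Sum>U\<in>UNIV. coord a R U x * coord b U S x)"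
proof (cases "unit_vec R \<in> (gspace x :: ('p set \<Rightarrow> 'k) set)")
  case True
  then show ?thesis
    using endo_expand[OF assms(2) endo_closed[OF assms(1) True], of S]
    by (simp add: interval_algebra_simps coord_def mult.commute)
next
  case False
  then show ?thesis
    using endo_outside[OF assms(1) False] endo_zero[OF assms(2)]
    by (simp add: interval_algebra_simps coord_def)
qed

lemma coord_add: "coord (a \<oplus>\<^bsub>\<Lambda>\<^esub> b) R S x = coord a R S x + coord b R S x"
  and coord_zero_elem: "coord \<zero>\<^bsub>\<Lambda>\<^esub> R S x = 0"
  and coord_smult: "coord (c \<odot>\<^bsub>\<Lambda>\<^esub> a) R S x = c * coord a R S x"
  and coord_one: "coord \<one>\<^bsub>\<Lambda>\<^esub> R S x = (if R \<in> intervals \<and> R = S \<and> x \<in> R then 1 else 0)"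
  by (auto simp: interval_algebra_simps coord_def gspace_unit_vec)
    (auto simp: unit_vec_def split: if_splits)

subsection \<open>Composition series\<close>

lemma submodule_trans:
  assumes "left_module R M" "submodule V R M" "submodule X R (M\<lparr>carrier := V\<rparr>)"
  shows "submodule X R M"
proof -
  interpret left_module R M by fact
  show ?thesis
    by (rule left_submoduleI)
      (use submodule_subset[OF assms(2)] submodule_subset[OF assms(3)] submodule_zero_mem[OF assms(3)]
        submodule_add[OF assms(3)] submodule_smult[OF assms(3)] in auto)
qed

text \<open>A submodule of the quotient is the image of its preimage, and the preimage lies between
  \<open>V\<close> and \<open>V'\<close>.\<close>

lemma simple_quotientI:
  assumes lm: "left_module R M" and V: "submodule V R M" and V': "submodule V' R M" and "V \<subset> V'"
    and max: "\<And>X. submodule X R M \<Longrightarrow> V \<subseteq> X \<Longrightarrow> X \<subseteq> V' \<Longrightarrow> X = V \<or> X = V'"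
  shows "simple_module R (quotient_module (M\<lparr>carrier := V'\<rparr>) V)"
proof -
  let ?M = "M\<lparr>carrier := V'\<rparr>"
  let ?Q = "quotient_module ?M V"
  have lM: "left_module R ?M" by (rule left_module_submodule[OF lm V'])
  have sV: "submodule V R ?M" using \<open>V \<subset> V'\<close> by (intro submodule_restrict[OF lm V V']) auto
  have lQ: "left_module R ?Q" by (rule left_module_quotient[OF lM sV])
  note zero = quotient_eq_zero_iff[OF lM sV]
  have Qc: "carrier ?Q = (\<lambda>x. V +>\<^bsub>?M\<^esub> x) ` V'" by (simp add: carrier_quotient_module)
  have Q0: "\<zero>\<^bsub>?Q\<^esub> = V" by (simp add: quotient_module_simps)
  obtain x where x: "x \<in> V'" "x \<notin> V" using \<open>V \<subset> V'\<close> by auto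
  then have "V +>\<^bsub>?M\<^esub> x \<noteq> V" using zero[of x] by simp
  then have "carrier ?Q \<noteq> {\<zero>\<^bsub>?Q\<^esub>}" using x(1) unfolding Qc Q0 by blast
  moreover have "W = {\<zero>\<^bsub>?Q\<^esub>} \<or> W = carrier ?Q" if W: "submodule W R ?Q" for W
  proof -
    define X where "X = {x \<in> carrier ?M. V +>\<^bsub>?M\<^esub> x \<in> W}"
    have "submodule X R ?M"
      unfolding X_def by (rule submodule_vimage[OF lM lQ lin_map_quotient[OF lM sV] W])
    then have "submodule X R M" by (rule submodule_trans[OF lm V'])
    moreover have "V \<subseteq> X"
    proof
      fix v assume v: "v \<in> V"
      then have "V +>\<^bsub>?M\<^esub> v = V" using \<open>V \<subset> V'\<close> zero[of v] by auto
      then show "v \<in> X" using v \<open>V \<subset> V'\<close> submodule_zero_mem[OF W] by (auto simp: X_def Q0)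
    qed
    moreover have "X \<subseteq> V'" by (auto simp: X_def)
    moreover have WX: "W = (\<lambda>x. V +>\<^bsub>?M\<^esub> x) ` X"
      using submodule_subset[OF W] unfolding Qc X_def by auto
    ultimately consider "X = V" | "X = V'" using max by blast
    then show ?thesis
    proof cases
      case 1
      have "V +>\<^bsub>?M\<^esub> x = V" if "x \<in> V" for x using that \<open>V \<subset> V'\<close> zero[of x] by auto
      then have "W = {V}" using submodule_zero_mem[OF V] unfolding WX 1 by auto
      then show ?thesis by (simp add: Q0)
    next
      case 2
      then show ?thesis by (simp add: WX Qc)
    qed
  qed
  ultimately show ?thesis by (auto simp: simple_module_def)
qed

text \<open>The next term is a strictly larger submodule of least rank, which leaves no room for an
  intermediate one; the recursion ends because the rank increases.\<close>

lemma exists_composition_series: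
  fixes rk :: "'m set \<Rightarrow> nat" and M :: "('a, 'm) module"
  assumes lm: "left_module R M"
    and mono: "\<And>V W. submodule V R M \<Longrightarrow> submodule W R M \<Longrightarrow> V \<subset> W \<Longrightarrow> rk V < rk W"
  shows "\<exists>Us. composition_series R M Us"
proof -
  interpret left_module R M by fact
  let ?step = "\<lambda>Us. \<forall>i. Suc i < length Us \<longrightarrow> Us ! i \<subseteq> Us ! Suc i \<and>
        simple_module R (quotient_module (M\<lparr>carrier := Us ! Suc i\<rparr>) (Us ! i))"
  have "submodule V R M \<Longrightarrow> \<exists>Us. Us \<noteq> [] \<and> hd Us = V \<and> last Us = carrier M \<and>
     (\<forall>U\<in>set Us. submodule U R M) \<and> ?step Us" for V
  proof (induction "rk (carrier M) - rk V" arbitrary: V rule: less_induct)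
    case less
    note V = \<open>submodule V R M\<close>
    show ?case
    proof (cases "V = carrier M")
      case True
      then show ?thesis using V by (intro exI[of _ "[V]"]) auto
    next
      case False
      then have "submodule (carrier M) R M \<and> V \<subset> carrier M"
        using submodule_subset[OF V] submodule_carrier by auto
      then obtain V' where V': "submodule V' R M" "V \<subset> V'"
        and min: "\<And>X. submodule X R M \<and> V \<subset> X \<Longrightarrow> rk V' \<le> rk X"
        using ex_has_least_nat[of "\<lambda>V'. submodule V' R M \<and> V \<subset> V'" "carrier M" rk] by blast
      have "rk V < rk V'" by (rule mono[OF V V'])
      moreover have "rk V' \<le> rk (carrier M)"
        using min \<open>submodule (carrier M) R M \<and> V \<subset> carrier M\<close> by blast
      ultimately have "rk (carrier M) - rk V' < rk (carrier M) - rk V" by simp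
      from less(1)[OF this V'(1)] obtain Us where Us: "Us \<noteq> []" "hd Us = V'" "last Us = carrier M"
        "\<forall>U\<in>set Us. submodule U R M" "?step Us" by blast
      have simple: "simple_module R (quotient_module (M\<lparr>carrier := V'\<rparr>) V)"
      proof (rule simple_quotientI[OF lm V V'])
        fix X assume X: "submodule X R M" "V \<subseteq> X" "X \<subseteq> V'"
        show "X = V \<or> X = V'"
        proof (rule ccontr)
          assume "\<not> (X = V \<or> X = V')"
          then have "V \<subset> X" "X \<subset> V'" using X by auto
          then show False using min[of X] mono[OF X(1) V'(1)] X(1) by auto
        qed
      qed
      have "?step (V # Us)"
      proof (intro allI impI)
        fix i assume i: "Suc i < length (V # Us)"
        show "(V # Us) ! i \<subseteq> (V # Us) ! Suc i \<and>
          simple_module R (quotient_module (M\<lparr>carrier := (V # Us) ! Suc i\<rparr>) ((V # Us) ! i))"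
          using i Us V' simple by (cases i) (auto simp: hd_conv_nth)
      qed
      then show ?thesis using Us V by (intro exI[of _ "V # Us"]) auto
    qed
  qed
  from this[OF submodule_zero] show ?thesis unfolding composition_series_def by blast
qed

lemma composition_series_left_module:
  assumes lm: "left_module R M" and cs: "composition_series R M Us" and i: "Suc i < length Us"
  defines "F \<equiv> quotient_module (M\<lparr>carrier := Us ! Suc i\<rparr>) (Us ! i)"
  shows "left_module R F" "simple_module R F"
    "left_module R (M\<lparr>carrier := Us ! Suc i\<rparr>)" "submodule (Us ! i) R (M\<lparr>carrier := Us ! Suc i\<rparr>)"
    "submodule (Us ! Suc i) R M"
proof -
  have s: "submodule (Us ! j) R M" if "j < length Us" for j
    using cs that by (auto simp: composition_series_def)
  have "Us ! i \<subseteq> Us ! Suc i" and F: "simple_module R F"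
    using cs i unfolding composition_series_def F_def by blast+
  then show "left_module R (M\<lparr>carrier := Us ! Suc i\<rparr>)" "submodule (Us ! i) R (M\<lparr>carrier := Us ! Suc i\<rparr>)"
    using left_module_submodule[OF lm s[OF i]] submodule_restrict[OF lm s s[OF i], of i] i by auto
  then show "left_module R F" unfolding F_def by (rule left_module_quotient)
  show "simple_module R F" by (fact F)
  show "submodule (Us ! Suc i) R M" by (rule s[OF i])
qed

text \<open>Acting as zero on a factor, \<open>e\<close> pushes each term of the series into the one
  below. Since \<open>e\<close> is idempotent, acting twice changes nothing, so the descent
  continues down to zero.\<close>

lemma idempotent_kills_factors:
  assumes lm: "left_module R M" and cs: "composition_series R M Us"
    and e: "e \<in> carrier R" "e \<otimes>\<^bsub>R\<^esub> e = e"
    and kill: "\<And>F X. F \<in> composition_factors R M \<Longrightarrow> X \<in> carrier F \<Longrightarrow> e \<odot>\<^bsub>F\<^esub> X = \<zero>\<^bsub>F\<^esub>"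
    and x: "x \<in> carrier M"
  shows "e \<odot>\<^bsub>M\<^esub> x = \<zero>\<^bsub>M\<^esub>"
proof -
  interpret left_module R M by fact
  have "i < length Us \<Longrightarrow> x \<in> Us ! i \<Longrightarrow> e \<odot>\<^bsub>M\<^esub> x = \<zero>\<^bsub>M\<^esub>" for i x
  proof (induction i arbitrary: x)
    case 0
    then have "x = \<zero>\<^bsub>M\<^esub>" using cs by (auto simp: composition_series_def hd_conv_nth)
    then show ?case using e smult_r_null by simp
  next
    case (Suc i)
    note m = composition_series_left_module[OF lm cs Suc.prems(1)]
    let ?M = "M\<lparr>carrier := Us ! Suc i\<rparr>"
    let ?F = "quotient_module ?M (Us ! i)"
    have "?F \<in> composition_factors R M"
      using cs Suc.prems(1) unfolding composition_factors_def by blast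
    moreover have xc: "x \<in> carrier ?M" using Suc.prems by simp
    ultimately have "e \<odot>\<^bsub>?F\<^esub> (Us ! i +>\<^bsub>?M\<^esub> x) = Us ! i"
      using kill[of ?F "Us ! i +>\<^bsub>?M\<^esub> x"] by (simp add: carrier_quotient_module quotient_module_simps(2))
    then have "Us ! i +>\<^bsub>?M\<^esub> (e \<odot>\<^bsub>M\<^esub> x) = Us ! i"
      using quotient_smult[OF m(3,4) e(1) xc] by simp
    moreover have "e \<odot>\<^bsub>M\<^esub> x \<in> Us ! Suc i" using submodule_smult[OF m(5) e(1)] Suc.prems by simp
    ultimately have "e \<odot>\<^bsub>M\<^esub> x \<in> Us ! i"
      using quotient_eq_zero_iff[OF m(3,4), of "e \<odot>\<^bsub>M\<^esub> x"] by simp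
    then have "e \<odot>\<^bsub>M\<^esub> (e \<odot>\<^bsub>M\<^esub> x) = \<zero>\<^bsub>M\<^esub>" using Suc by simp
    moreover have "x \<in> carrier M" using Suc.prems submodule_subset[OF m(5)] by auto
    ultimately show ?case using e smult_assoc1[of e e x] by simp
  qed
  moreover have "Us ! (length Us - 1) = carrier M" "length Us - 1 < length Us"
    using cs by (auto simp: composition_series_def last_conv_nth)
  ultimately show ?thesis using x by metis
qed

subsection \<open>Projective and simple modules of the interval algebra\<close>

lemma interval_algebra_closed [simp]:
  fixes a b :: "('k::field, 'p::order) interval_endo"
  shows "a \<in> carrier \<Lambda> \<Longrightarrow> b \<in> carrier \<Lambda> \<Longrightarrow> a \<otimes>\<^bsub>\<Lambda>\<^esub> b \<in> carrier \<Lambda>"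
    and "a \<in> carrier \<Lambda> \<Longrightarrow> b \<in> carrier \<Lambda> \<Longrightarrow> a \<oplus>\<^bsub>\<Lambda>\<^esub> b \<in> carrier \<Lambda>"
    and "\<zero>\<^bsub>\<Lambda>\<^esub> \<in> carrier (\<Lambda> :: ('k, ('k, 'p) interval_endo) module)"
    and "\<one>\<^bsub>\<Lambda>\<^esub> \<in> carrier (\<Lambda> :: ('k, ('k, 'p) interval_endo) module)"
proof -
  interpret ring "\<Lambda> :: ('k, ('k, 'p) interval_endo) module" by (rule ring_interval_algebra)
  show "a \<in> carrier \<Lambda> \<Longrightarrow> b \<in> carrier \<Lambda> \<Longrightarrow> a \<otimes>\<^bsub>\<Lambda>\<^esub> b \<in> carrier \<Lambda>"
    and "a \<in> carrier \<Lambda> \<Longrightarrow> b \<in> carrier \<Lambda> \<Longrightarrow> a \<oplus>\<^bsub>\<Lambda>\<^esub> b \<in> carrier \<Lambda>"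
    and "\<zero>\<^bsub>\<Lambda>\<^esub> \<in> carrier (\<Lambda> :: ('k, ('k, 'p) interval_endo) module)"
    and "\<one>\<^bsub>\<Lambda>\<^esub> \<in> carrier (\<Lambda> :: ('k, ('k, 'p) interval_endo) module)" by simp_all
qed

text \<open>The sum of the primitive idempotents e_R over the intervals \<open>R\<close> in
  \<open>J\<close>; single idempotents, the unit and all partial sums get one description.\<close>

definition idem_set :: "'p::{finite,order} set set \<Rightarrow> ('k::field, 'p) interval_endo" where
  "idem_set J = of_mat (\<lambda>R S x. if R \<in> intervals \<and> R \<in> J \<and> R = S \<and> x \<in> R then 1 else 0)"

lemma
  fixes J :: "'p::{finite,order} set set"
  shows idem_set_closed: "idem_set J \<in> carrier (\<Lambda> :: ('k::field, ('k, 'p) interval_endo) module)"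
    and coord_idem_set: "coord (idem_set J :: ('k, 'p) interval_endo) R S x =
      (if R \<in> intervals \<and> R \<in> J \<and> R = S \<and> x \<in> R then 1 else 0)"
proof -
  have m: "is_mat (\<lambda>R S x. if R \<in> intervals \<and> R \<in> J \<and> R = S \<and> x \<in> R then 1 else (0::'k))"
    unfolding is_mat_def by (auto intro!: hom_funI)
  show "idem_set J \<in> carrier (\<Lambda> :: ('k, ('k, 'p) interval_endo) module)" unfolding idem_set_def by (rule of_mat_closed[OF m])
  show "coord (idem_set J :: ('k, 'p) interval_endo) R S x = (if R \<in> intervals \<and> R \<in> J \<and> R = S \<and> x \<in> R then 1 else 0)"
    unfolding idem_set_def coord_of_mat[OF m] ..
qed

lemma interval_idem_eq:
  assumes "S \<in> intervals"
  shows "interval_idem S = (idem_set {S} :: ('k::field, 'p::{finite,order}) interval_endo)"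
proof (intro ext)
  fix x Q and v :: "'p set \<Rightarrow> 'k"
  show "interval_idem S x v Q = idem_set {S} x v Q"
  proof (cases "v \<in> gspace x")
    case True
    then have "idem_set {S} x v Q = (\<Sum>R\<in>UNIV. coord (idem_set {S} :: ('k, 'p) interval_endo) R Q x * v R)"
      by (rule endo_expand[OF idem_set_closed])
    also have "\<dots> = (\<Sum>R\<in>UNIV. if R = Q then (if Q = S then v R else 0) else 0)"
      using assms True by (intro sum.cong) (auto simp: coord_idem_set gspace_iff)
    finally show ?thesis using True by (simp add: interval_idem_def)
  next
    case False
    then show ?thesis by (simp add: interval_idem_def endo_outside[OF idem_set_closed])
  qed
qed

lemma coord_mult_idem:
  fixes a :: "('k::field, 'p::{finite,order}) interval_endo"
  assumes a: "a \<in> carrier \<Lambda>"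
  shows "coord (a \<otimes>\<^bsub>\<Lambda>\<^esub> idem_set J) R S x = (if S \<in> J then coord a R S x else 0)"
    and "coord (idem_set J \<otimes>\<^bsub>\<Lambda>\<^esub> a) R S x = (if R \<in> J then coord a R S x else 0)"
proof -
  have "coord (a \<otimes>\<^bsub>\<Lambda>\<^esub> idem_set J) R S x = (\<Sum>U\<in>UNIV. if U = S then (if S \<in> J then coord a R S x else 0) else 0)"
    unfolding coord_mult[OF a idem_set_closed] using coord_zero'[OF a, of S x R]
    by (intro sum.cong) (auto simp: coord_idem_set)
  then show "coord (a \<otimes>\<^bsub>\<Lambda>\<^esub> idem_set J) R S x = (if S \<in> J then coord a R S x else 0)" by simp
  have "coord (idem_set J \<otimes>\<^bsub>\<Lambda>\<^esub> a) R S x = (\<Sum>U\<in>UNIV. if U = R then (if R \<in> J then coord a R S x else 0) else 0)"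
    unfolding coord_mult[OF idem_set_closed a] using coord_zero[OF a, of R x S]
    by (intro sum.cong) (auto simp: coord_idem_set)
  then show "coord (idem_set J \<otimes>\<^bsub>\<Lambda>\<^esub> a) R S x = (if R \<in> J then coord a R S x else 0)" by simp
qed

lemma idem_set_idem: "idem_set J \<otimes>\<^bsub>\<Lambda>\<^esub> idem_set J = (idem_set J :: ('k::field, 'p::{finite,order}) interval_endo)"
  by (rule coord_inj)
    (auto simp: fun_eq_iff coord_mult_idem[OF idem_set_closed] coord_idem_set idem_set_closed
      intro: monoid.m_closed[OF ring.axioms(2)[OF ring_interval_algebra]])

text \<open>The other summands of the matrix product are loops from \<open>C\<close> through another
  interval, and these are zero. So the diagonal entry is multiplicative and can define a
  one-dimensional module.\<close>

lemma coord_corner_mult: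
  fixes a :: "('k::field, 'p::{finite,order}) interval_endo"
  assumes a: "a \<in> carrier \<Lambda>" and b: "b \<in> carrier \<Lambda>" and C: "C \<in> intervals"
  shows "coord (a \<otimes>\<^bsub>\<Lambda>\<^esub> b) C C x = coord a C C x * coord b C C x"
proof -
  have h: "coord a R S \<in> hom_fun R S" "coord b R S \<in> hom_fun R S" for R S
    using coord_is_mat[OF a] coord_is_mat[OF b] by (auto simp: is_mat_def)
  have "coord a C U x * coord b U C x = 0" if "U \<noteq> C" for U
  proof (cases "U \<in> intervals")
    case True
    then show ?thesis using hom_fun_loop_zero[OF C True that h(1) h(2)] by simp
  next
    case False
    then show ?thesis using coord_zero'[OF a, of U x C] by simp
  qed
  then have "(\<Sum>U\<in>UNIV. coord a C U x * coord b U C x) =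
      (\<Sum>U\<in>UNIV. if U = C then coord a C C x * coord b C C x else 0)"
    by (intro sum.cong) auto
  then show ?thesis by (simp add: coord_mult[OF a b])
qed

text \<open>An arbitrary evaluation point: entries from I_S to itself are constant on the interval
  \<open>S\<close>, so another choice would give the same scalar.\<close>

definition point :: "'p set \<Rightarrow> 'p" where
  "point S = (SOME x. x \<in> S)"

lemma point_mem: "S \<in> intervals \<Longrightarrow> point S \<in> S"
  unfolding point_def intervals_def by (auto intro: someI)

text \<open>A concrete model of L(C) on the field itself, replacing cosets of a radical in all
  computations.\<close>

definition kmod :: "'p::order set \<Rightarrow> (('k::field, 'p) interval_endo, 'k) module" where
  "kmod C = \<lparr>carrier = UNIV, mult = undefined, one = undefined, zero = 0, add = (+),
     smult = (\<lambda>a t. coord a C C (point C) * t)\<rparr>"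

lemma kmod_simps [simp]:
  "carrier (kmod C) = UNIV" "\<zero>\<^bsub>kmod C\<^esub> = 0" "s \<oplus>\<^bsub>kmod C\<^esub> t = s + t"
  "a \<odot>\<^bsub>kmod C\<^esub> t = coord a C C (point C) * t"
  by (simp_all add: kmod_def)

lemma left_module_kmod:
  assumes C: "C \<in> intervals"
  shows "left_module \<Lambda> (kmod C :: (('k::field, 'p::{finite,order}) interval_endo, 'k) module)"
proof -
  have "\<exists>y. y + x = (0::'k)" for x by (rule exI[of _ "- x"]) simp
  then have "abelian_group (kmod C :: (('k, 'p) interval_endo, 'k) module)"
    by (intro abelian_groupI) (auto simp: algebra_simps)
  moreover have "left_module_axioms \<Lambda> (kmod C :: (('k, 'p) interval_endo, 'k) module)"
    by (rule left_module_axioms.intro)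
      (simp_all add: coord_add coord_corner_mult C coord_one point_mem algebra_simps)
  ultimately show ?thesis by (simp add: left_module_def ring_interval_algebra)
qed

text \<open>For an interval this is the radical of P(S), see \<open>mod_radical_proj_module\<close>;
  as the kernel of the diagonal entry it has codimension one.\<close>

definition proj_rad :: "'p::order set \<Rightarrow> ('k::field, 'p) interval_endo set" where
  "proj_rad S = {a \<in> carrier (proj_module S). coord a S S (point S) = 0}"

lemma smult_closed_interval_algebra:
  fixes a :: "('k::field, 'p::{finite,order}) interval_endo"
  assumes a: "a \<in> carrier \<Lambda>"
  shows "c \<odot>\<^bsub>\<Lambda>\<^esub> a \<in> carrier \<Lambda>"
  unfolding carrier_interval_algebra_iff interval_algebra_simps(6)
  by (auto simp: gspace_scale endo_in_gspace[OF a] endo_outside[OF a] endo_add[OF a] endo_scale[OF a]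
    endo_natural[OF a] fun_eq_iff algebra_simps)

lemma coord_scalar_mult:
  fixes a :: "('k::field, 'p::{finite,order}) interval_endo"
  assumes a: "a \<in> carrier \<Lambda>"
  shows "coord ((c \<odot>\<^bsub>\<Lambda>\<^esub> \<one>\<^bsub>\<Lambda>\<^esub>) \<otimes>\<^bsub>\<Lambda>\<^esub> a) R S x = c * coord a R S x"
    and "coord (a \<otimes>\<^bsub>\<Lambda>\<^esub> (c \<odot>\<^bsub>\<Lambda>\<^esub> \<one>\<^bsub>\<Lambda>\<^esub>)) R S x = c * coord a R S x"
proof -
  interpret ring "\<Lambda> :: ('k, ('k, 'p) interval_endo) module" by (rule ring_interval_algebra)
  have o: "c \<odot>\<^bsub>\<Lambda>\<^esub> \<one>\<^bsub>\<Lambda>\<^esub> \<in> carrier (\<Lambda> :: ('k, ('k, 'p) interval_endo) module)"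
    by (rule smult_closed_interval_algebra) simp
  have "coord ((c \<odot>\<^bsub>\<Lambda>\<^esub> \<one>\<^bsub>\<Lambda>\<^esub>) \<otimes>\<^bsub>\<Lambda>\<^esub> a) R S x = (\<Sum>U\<in>UNIV. if U = R then c * coord a R S x else 0)"
    unfolding coord_mult[OF o a] using coord_zero[OF a, of R x S]
    by (intro sum.cong) (auto simp: coord_smult coord_one)
  then show "coord ((c \<odot>\<^bsub>\<Lambda>\<^esub> \<one>\<^bsub>\<Lambda>\<^esub>) \<otimes>\<^bsub>\<Lambda>\<^esub> a) R S x = c * coord a R S x" by simp
  have "coord (a \<otimes>\<^bsub>\<Lambda>\<^esub> (c \<odot>\<^bsub>\<Lambda>\<^esub> \<one>\<^bsub>\<Lambda>\<^esub>)) R S x = (\<Sum>U\<in>UNIV. if U = S then c * coord a R S x else 0)"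
    unfolding coord_mult[OF a o] using coord_zero'[OF a, of S x R]
    by (intro sum.cong) (auto simp: coord_smult coord_one)
  then show "coord (a \<otimes>\<^bsub>\<Lambda>\<^esub> (c \<odot>\<^bsub>\<Lambda>\<^esub> \<one>\<^bsub>\<Lambda>\<^esub>)) R S x = c * coord a R S x" by simp
qed

lemma scalar_algebra_interval_algebra:
  "scalar_algebra (\<Lambda> :: ('k::field, ('k, 'p::{finite,order}) interval_endo) module)"
proof -
  interpret ring "\<Lambda> :: ('k, ('k, 'p) interval_endo) module" by (rule ring_interval_algebra)
  note [simp] = smult_closed_interval_algebra
  show ?thesis
    by unfold_locales
      ((rule coord_inj)?; simp add: fun_eq_iff coord_scalar_mult coord_add coord_smult coord_one algebra_simps)+
qed

section \<open>Projective modules, their radicals and their simple tops\<close>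

context
  fixes S :: "'p::{finite,order} set"
  assumes S: "S \<in> intervals"
begin

lemma proj_module_simps:
  "\<zero>\<^bsub>proj_module S\<^esub> = (\<zero>\<^bsub>\<Lambda>\<^esub> :: ('k::field, 'p) interval_endo)"
  "a \<oplus>\<^bsub>proj_module S\<^esub> b = a \<oplus>\<^bsub>\<Lambda>\<^esub> (b :: ('k::field, 'p) interval_endo)"
  "a \<odot>\<^bsub>proj_module S\<^esub> b = a \<otimes>\<^bsub>\<Lambda>\<^esub> (b :: ('k::field, 'p) interval_endo)"
  by (simp_all add: proj_module_def regular_module_def)

lemma proj_module_iff:
  "a \<in> carrier (proj_module S) \<longleftrightarrow>
    (a :: ('k::field, 'p) interval_endo) \<in> carrier \<Lambda> \<and> (\<forall>R Q x. Q \<noteq> S \<longrightarrow> coord a R Q x = 0)"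
proof
  assume "a \<in> carrier (proj_module S)"
  then obtain b where b: "b \<in> carrier \<Lambda>" "a = b \<otimes>\<^bsub>\<Lambda>\<^esub> idem_set {S}"
    by (auto simp: proj_module_def interval_idem_eq[OF S])
  then show "a \<in> carrier \<Lambda> \<and> (\<forall>R Q x. Q \<noteq> S \<longrightarrow> coord a R Q x = 0)"
    by (auto simp: coord_mult_idem idem_set_closed)
next
  assume a: "a \<in> carrier \<Lambda> \<and> (\<forall>R Q x. Q \<noteq> S \<longrightarrow> coord a R Q x = 0)"
  then have "a = a \<otimes>\<^bsub>\<Lambda>\<^esub> idem_set {S}"
    by (intro coord_inj) (auto simp: fun_eq_iff coord_mult_idem idem_set_closed)
  then show "a \<in> carrier (proj_module S)"
    using a by (auto simp: proj_module_def interval_idem_eq[OF S])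
qed

lemma idem_in_proj_module: "(idem_set {S} :: ('k::field, 'p) interval_endo) \<in> carrier (proj_module S)"
  by (auto simp: proj_module_iff idem_set_closed coord_idem_set)

lemma proj_module_mult_idem:
  "(a :: ('k::field, 'p) interval_endo) \<in> carrier (proj_module S) \<Longrightarrow> a \<otimes>\<^bsub>\<Lambda>\<^esub> idem_set {S} = a"
  by (intro coord_inj) (auto simp: fun_eq_iff coord_mult_idem proj_module_iff idem_set_closed)

lemma left_module_proj_module: "left_module \<Lambda> (proj_module S :: (('k::field, 'p) interval_endo, _) module)"
proof -
  let ?M = "regular_module (\<Lambda> :: ('k::field, ('k::field, 'p) interval_endo) module)"
  interpret M: left_module "\<Lambda> :: ('k::field, ('k::field, 'p) interval_endo) module" ?M by (rule left_module_regular_interval)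
  have s: "carrier ?M = carrier \<Lambda>" "\<zero>\<^bsub>?M\<^esub> = \<zero>\<^bsub>\<Lambda>\<^esub>"
    "x \<oplus>\<^bsub>?M\<^esub> y = x \<oplus>\<^bsub>\<Lambda>\<^esub> y" "x \<odot>\<^bsub>?M\<^esub> y = x \<otimes>\<^bsub>\<Lambda>\<^esub> y" for x y
    by (simp_all add: regular_module_def)
  have "submodule (carrier (proj_module S)) \<Lambda> ?M"
  proof (rule M.left_submoduleI; unfold s)
    show "carrier (proj_module S) \<subseteq> carrier \<Lambda>" "\<zero>\<^bsub>\<Lambda>\<^esub> \<in> carrier (proj_module S)"
      by (auto simp: proj_module_iff coord_zero_elem)
    fix x y assume x: "x \<in> carrier (proj_module S)"
    show "x \<oplus>\<^bsub>\<Lambda>\<^esub> y \<in> carrier (proj_module S)" if "y \<in> carrier (proj_module S)"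
      using x that by (auto simp: proj_module_iff coord_add)
    show "a \<otimes>\<^bsub>\<Lambda>\<^esub> x \<in> carrier (proj_module S)" if "a \<in> carrier \<Lambda>" for a
      using x that by (auto simp: proj_module_iff coord_mult)
  qed
  from left_module_submodule[OF left_module_regular_interval this]
  show ?thesis by (simp add: proj_module_def)
qed

lemma lin_map_proj_module:
  assumes "left_module \<Lambda> M" "y \<in> carrier M"
  shows "lin_map (\<Lambda> :: ('k::field, ('k::field, 'p) interval_endo) module) (proj_module S) M (\<lambda>a. a \<odot>\<^bsub>M\<^esub> y)"
proof -
  interpret M: left_module "\<Lambda> :: ('k::field, ('k::field, 'p) interval_endo) module" M by fact
  show ?thesis
    by (rule lin_mapI)
      (auto simp: proj_module_iff proj_module_simps assms(2) M.smult_closed M.smult_l_distr M.smult_assoc1)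
qed

lemma lin_map_proj_kmod:
  "lin_map \<Lambda> (proj_module S) (kmod S :: (('k::field, 'p) interval_endo, 'k::field) module) (\<lambda>a. coord a S S (point S))"
  by (rule lin_mapI) (auto simp: proj_module_simps coord_add coord_corner_mult S proj_module_iff)

lemma submodule_proj_rad: "submodule (proj_rad S) \<Lambda> (proj_module S)"
proof -
  interpret K: left_module "\<Lambda> :: ('k::field, ('k::field, 'p) interval_endo) module" "kmod S :: (('k::field, 'p) interval_endo, 'k::field) module"
    by (rule left_module_kmod[OF S])
  show ?thesis
    using submodule_vimage[OF left_module_proj_module K.left_module_axioms lin_map_proj_kmod K.submodule_zero]
    by (simp add: proj_rad_def)
qed

lemma coord_SS_const:
  "(a :: ('k::field, 'p) interval_endo) \<in> carrier \<Lambda> \<Longrightarrow> x \<in> S \<Longrightarrow> coord a S S x = coord a S S (point S)"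
  using coord_is_mat[of a] hom_fun_const[of "coord a S S" S S S x "point S"] intervals_connected[OF S] point_mem[OF S]
  by (auto simp: is_mat_def)

text \<open>An element \<open>a\<close> outside \<open>proj_rad S\<close> generates \<open>P(S)\<close>, as it satisfies \<open>e\<^sub>S a = t e\<^sub>S\<close> with \<open>t \<noteq> 0\<close>.\<close>

lemma submodule_proj_module_top:
  assumes U: "submodule U \<Lambda> (proj_module S)" and "\<not> U \<subseteq> proj_rad S"
  shows "U = carrier (proj_module S :: (('k::field, 'p) interval_endo, _) module)"
proof -
  interpret ring "\<Lambda> :: ('k, ('k, 'p) interval_endo) module" by (rule ring_interval_algebra)
  interpret scalar_algebra "\<Lambda> :: ('k, ('k, 'p) interval_endo) module"
    by (rule scalar_algebra_interval_algebra)
  obtain a where aU: "a \<in> U" and nz: "coord a S S (point S) \<noteq> 0" and aP: "a \<in> carrier (proj_module S)"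
    using assms submodule_subset[OF U] unfolding proj_rad_def by blast
  then have a: "a \<in> carrier \<Lambda>" and z: "\<And>R Q x. Q \<noteq> S \<Longrightarrow> coord a R Q x = 0"
    unfolding proj_module_iff by blast+
  define t where "t = inverse (coord a S S (point S))"
  have ia: "idem_set {S} \<otimes>\<^bsub>\<Lambda>\<^esub> a \<in> U"
    using submodule_smult[OF U idem_set_closed aU] by (simp add: proj_module_simps)
  have "(t \<odot>\<^bsub>\<Lambda>\<^esub> \<one>\<^bsub>\<Lambda>\<^esub>) \<otimes>\<^bsub>\<Lambda>\<^esub> (idem_set {S} \<otimes>\<^bsub>\<Lambda>\<^esub> a) \<in> U"
    using submodule_smult[OF U scalar_closed ia] by (simp add: proj_module_simps)
  also have "(t \<odot>\<^bsub>\<Lambda>\<^esub> \<one>\<^bsub>\<Lambda>\<^esub>) \<otimes>\<^bsub>\<Lambda>\<^esub> (idem_set {S} \<otimes>\<^bsub>\<Lambda>\<^esub> a) = idem_set {S}"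
  proof (rule coord_inj)
    show "coord ((t \<odot>\<^bsub>\<Lambda>\<^esub> \<one>\<^bsub>\<Lambda>\<^esub>) \<otimes>\<^bsub>\<Lambda>\<^esub> (idem_set {S} \<otimes>\<^bsub>\<Lambda>\<^esub> a)) = coord (idem_set {S})"
    proof (intro ext)
      fix R Q x
      have "coord ((t \<odot>\<^bsub>\<Lambda>\<^esub> \<one>\<^bsub>\<Lambda>\<^esub>) \<otimes>\<^bsub>\<Lambda>\<^esub> (idem_set {S} \<otimes>\<^bsub>\<Lambda>\<^esub> a)) R Q x =
          t * (if R = S then coord a R Q x else 0)"
        using a by (simp add: coord_scalar_mult coord_mult_idem idem_set_closed)
      also have "\<dots> = coord (idem_set {S}) R Q x"
        using z[of Q R x] coord_SS_const[OF a, of x] coord_zero[OF a, of S x S] nz S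
        by (auto simp: coord_idem_set t_def)
      finally show "coord ((t \<odot>\<^bsub>\<Lambda>\<^esub> \<one>\<^bsub>\<Lambda>\<^esub>) \<otimes>\<^bsub>\<Lambda>\<^esub> (idem_set {S} \<otimes>\<^bsub>\<Lambda>\<^esub> a)) R Q x =
          coord (idem_set {S}) R Q x" .
    qed
  qed (simp_all add: a scalar_closed idem_set_closed)
  finally have "idem_set {S} \<in> U" .
  then have "b \<in> U" if "b \<in> carrier (proj_module S)" for b
    using submodule_smult[OF U, of b "idem_set {S}"] that proj_module_mult_idem[OF that]
    by (simp add: proj_module_simps proj_module_iff)
  then show ?thesis using submodule_subset[OF U] by blast
qed

lemma proj_rad_ne: "(idem_set {S} :: ('k::field, 'p) interval_endo) \<notin> proj_rad S"
  using S point_mem[OF S] by (simp add: proj_rad_def coord_idem_set)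

text \<open>Every proper submodule lies in \<open>proj_rad S\<close>, so this is the only maximal
  one.\<close>

lemma mod_radical_proj_module:
  "mod_radical \<Lambda> (proj_module S) = (proj_rad S :: ('k::field, 'p) interval_endo set)"
proof -
  have 1: "maximal_submodule (proj_rad S) (\<Lambda> :: ('k, ('k, 'p) interval_endo) module) (proj_module S)"
    unfolding maximal_submodule_def
    using submodule_proj_rad proj_rad_ne idem_in_proj_module submodule_proj_module_top by blast
  have 2: "U = proj_rad S" if "maximal_submodule U (\<Lambda> :: ('k, ('k, 'p) interval_endo) module) (proj_module S)" for U
    using that 1 submodule_proj_module_top[of U] unfolding maximal_submodule_def by metis
  show ?thesis
    unfolding mod_radical_def using 1 2 submodule_subset[OF submodule_proj_rad] by blast
qed

lemma simple_top_eq: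
  "(simple_top S :: (('k::field, 'p) interval_endo, _) module) = quotient_module (proj_module S) (proj_rad S)"
  by (simp add: simple_top_def mod_radical_proj_module)

lemma left_module_simple_top: "left_module \<Lambda> (simple_top S :: (('k::field, 'p) interval_endo, _) module)"
  unfolding simple_top_eq by (rule left_module_quotient[OF left_module_proj_module submodule_proj_rad])

lemma simple_top_iso_kmod:
  "mod_iso \<Lambda> (simple_top S) (kmod S :: (('k::field, 'p) interval_endo, 'k) module)"
proof -
  interpret scalar_algebra "\<Lambda> :: ('k, ('k, 'p) interval_endo) module"
    by (rule scalar_algebra_interval_algebra)
  have "t \<in> (\<lambda>a. coord a S S (point S)) ` carrier (proj_module S)" for t :: 'k
  proof
    let ?a = "(t \<odot>\<^bsub>\<Lambda>\<^esub> \<one>\<^bsub>\<Lambda>\<^esub>) \<otimes>\<^bsub>\<Lambda>\<^esub> (idem_set {S} :: ('k, 'p) interval_endo)"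
    show "t = coord ?a S S (point S)"
      using S point_mem[OF S] by (simp add: coord_scalar_mult idem_set_closed coord_idem_set)
    show "?a \<in> carrier (proj_module S)"
      using left_module.smult_closed[OF left_module_proj_module scalar_closed idem_in_proj_module]
      by (simp add: proj_module_simps)
  qed
  then have "(\<lambda>a. coord a S S (point S)) ` carrier (proj_module S) =
      carrier (kmod S :: (('k, 'p) interval_endo, 'k) module)" by auto
  from mod_iso_quotient[OF left_module_proj_module left_module_kmod[OF S] lin_map_proj_kmod this]
  show ?thesis by (simp add: simple_top_eq proj_rad_def)
qed

text \<open>An element not killed by \<open>e\<^sub>S\<close> generates a quotient of \<open>P(S)\<close>.\<close>

lemma simple_module_iso_simple_top:
  fixes F :: "(('k::field, 'p) interval_endo, 'm) module"
  assumes lF: "left_module \<Lambda> F" and F: "simple_module \<Lambda> F"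
    and x: "x \<in> carrier F" and nz: "idem_set {S} \<odot>\<^bsub>F\<^esub> x \<noteq> \<zero>\<^bsub>F\<^esub>"
  shows "mod_iso \<Lambda> F (simple_top S)"
proof -
  let ?f = "\<lambda>a. a \<odot>\<^bsub>F\<^esub> x"
  let ?P = "proj_module S :: (('k, 'p) interval_endo, _) module"
  note lP = left_module_proj_module
  interpret F: left_module "\<Lambda> :: ('k, ('k, 'p) interval_endo) module" F by fact
  have f: "lin_map \<Lambda> ?P F ?f" by (rule lin_map_proj_module[OF lF x])
  have sub: "submodule U \<Lambda> F \<Longrightarrow> U = {\<zero>\<^bsub>F\<^esub>} \<or> U = carrier F" for U
    using F by (auto simp: simple_module_def)
  have im: "?f ` carrier ?P = carrier F"
    using sub[OF submodule_image[OF lP lF f left_module.submodule_carrier[OF lP]]] nz idem_in_proj_module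
    by blast
  let ?K = "{a \<in> carrier ?P. ?f a = \<zero>\<^bsub>F\<^esub>}"
  have sK: "submodule ?K \<Lambda> ?P" using submodule_vimage[OF lP lF f F.submodule_zero] by simp
  have KneP: "?K \<noteq> carrier ?P" using nz idem_in_proj_module by blast
  have K1: "?K \<subseteq> proj_rad S" using submodule_proj_module_top[OF sK] KneP by blast
  \<comment> \<open>Otherwise the generator would agree modulo the kernel with an element of the
    radical, and would lie in the radical itself because the kernel does.\<close>
  have "?f ` proj_rad S \<noteq> carrier F"
  proof
    assume "?f ` proj_rad S = carrier F"
    then have "?f (idem_set {S}) \<in> ?f ` proj_rad S"
      using lin_map_closed[OF f idem_in_proj_module] by simp
    then obtain b where b: "b \<in> proj_rad S" "?f (idem_set {S}) = ?f b" by blast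
    then have bP: "b \<in> carrier ?P" by (simp add: proj_rad_def)
    interpret P: left_module "\<Lambda> :: ('k, ('k, 'p) interval_endo) module" ?P by (rule lP)
    have "?f (idem_set {S} \<ominus>\<^bsub>?P\<^esub> b) = \<zero>\<^bsub>F\<^esub>"
      using b(2) lin_map_closed[OF f] bP
      by (simp add: lin_map_minus[OF lP lF f idem_in_proj_module bP] F.M.diff_eq_zero_iff)
    then have "idem_set {S} \<ominus>\<^bsub>?P\<^esub> b \<in> proj_rad S"
      using K1 P.M.minus_closed[OF idem_in_proj_module bP] by blast
    then have "(idem_set {S} \<ominus>\<^bsub>?P\<^esub> b) \<oplus>\<^bsub>?P\<^esub> b \<in> proj_rad S"
      using submodule_add[OF submodule_proj_rad] b(1) by blast
    moreover have "(idem_set {S} \<ominus>\<^bsub>?P\<^esub> b) \<oplus>\<^bsub>?P\<^esub> b = idem_set {S}"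
      using bP idem_in_proj_module by (simp add: a_minus_def P.M.a_assoc[OF idem_in_proj_module P.M.a_inv_closed[OF bP] bP]
          P.M.l_neg[OF bP] P.M.r_zero[OF idem_in_proj_module])
    ultimately show False by (simp add: proj_rad_ne)
  qed
  then have "?f ` proj_rad S = {\<zero>\<^bsub>F\<^esub>}"
    using sub[OF submodule_image[OF lP lF f submodule_proj_rad]] by blast
  then have "?K = proj_rad S" using K1 by (auto simp: proj_rad_def)
  with mod_iso_quotient[OF lP lF f im] have "mod_iso \<Lambda> (simple_top S) F" by (simp add: simple_top_eq)
  then show ?thesis by (rule mod_iso_sym[OF left_module_simple_top lF])
qed

text \<open>In the model \<open>kmod S\<close> the idempotent of another interval acts by its
  diagonal entry at \<open>S\<close>, which is zero.\<close>

lemma idem_kills_simple_top: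
  fixes F :: "(('k::field, 'p) interval_endo, 'm) module"
  assumes lF: "left_module \<Lambda> F" and iso: "mod_iso \<Lambda> F (simple_top S)"
    and x: "x \<in> carrier F" and "R \<noteq> S"
  shows "idem_set {R} \<odot>\<^bsub>F\<^esub> x = \<zero>\<^bsub>F\<^esub>"
proof -
  let ?K = "kmod S :: (('k, 'p) interval_endo, 'k) module"
  interpret F: left_module "\<Lambda> :: ('k, ('k, 'p) interval_endo) module" F by fact
  obtain f where f: "lin_map \<Lambda> F (simple_top S) f" "bij_betw f (carrier F) (carrier (simple_top S))"
    using iso by (rule mod_isoE)
  obtain g where g: "lin_map \<Lambda> (simple_top S) ?K g" "bij_betw g (carrier (simple_top S)) (carrier ?K)"
    using simple_top_iso_kmod by (rule mod_isoE)
  let ?h = "\<lambda>y. g (f y)"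
  have h: "lin_map \<Lambda> F ?K ?h" by (rule lin_map_compose[OF f(1) g(1)])
  have "inj_on ?h (carrier F)"
    using f(2) g(2) comp_inj_on[of f "carrier F" g] by (simp add: bij_betw_def comp_def)
  moreover have "?h (idem_set {R} \<odot>\<^bsub>F\<^esub> x) = ?h \<zero>\<^bsub>F\<^esub>"
    using lin_map_smult[OF h idem_set_closed x] lin_map_zero[OF lF left_module_kmod[OF S] h] \<open>R \<noteq> S\<close>
    by (simp add: coord_idem_set)
  ultimately show ?thesis
    using F.smult_closed[OF idem_set_closed x] by (auto simp: inj_on_def)
qed

end

text \<open>The unit is the sum of the idempotents of all intervals and fixes
  \<open>x\<close>.\<close>

lemma exists_idem_not_killing:
  fixes F :: "(('k::field, 'p::{finite,order}) interval_endo, 'm) module"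
  assumes lF: "left_module \<Lambda> F" and x: "x \<in> carrier F" "x \<noteq> \<zero>\<^bsub>F\<^esub>"
  shows "\<exists>R\<in>intervals. idem_set {R} \<odot>\<^bsub>F\<^esub> x \<noteq> \<zero>\<^bsub>F\<^esub>"
proof (rule ccontr)
  assume "\<not> (\<exists>R\<in>intervals. idem_set {R} \<odot>\<^bsub>F\<^esub> x \<noteq> \<zero>\<^bsub>F\<^esub>)"
  then have z: "\<And>R. R \<in> intervals \<Longrightarrow> idem_set {R} \<odot>\<^bsub>F\<^esub> x = \<zero>\<^bsub>F\<^esub>" by blast
  interpret F: left_module "\<Lambda> :: ('k, ('k, 'p) interval_endo) module" F by fact
  have "finite J \<Longrightarrow> J \<subseteq> intervals \<Longrightarrow> idem_set J \<odot>\<^bsub>F\<^esub> x = \<zero>\<^bsub>F\<^esub>" for J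
  proof (induction J rule: finite_induct)
    case empty
    have "idem_set {} = (\<zero>\<^bsub>\<Lambda>\<^esub> :: ('k, 'p) interval_endo)"
      by (rule coord_inj) (simp_all add: idem_set_closed fun_eq_iff coord_idem_set coord_zero_elem)
    then show ?case using F.smult_l_null[OF x(1)] by simp
  next
    case (insert R J)
    have "idem_set (insert R J) = (idem_set J \<oplus>\<^bsub>\<Lambda>\<^esub> idem_set {R} :: ('k, 'p) interval_endo)"
      using insert(2) by (intro coord_inj) (auto simp: idem_set_closed fun_eq_iff coord_idem_set coord_add)
    then show ?case
      using insert x z[of R] by (simp add: F.smult_l_distr idem_set_closed)
  qed
  from this[of intervals] have "idem_set intervals \<odot>\<^bsub>F\<^esub> x = \<zero>\<^bsub>F\<^esub>" by simp
  moreover have "idem_set intervals = (\<one>\<^bsub>\<Lambda>\<^esub> :: ('k, 'p) interval_endo)"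
    by (rule coord_inj) (auto simp: idem_set_closed fun_eq_iff coord_idem_set coord_one)
  ultimately show False using F.smult_one[OF x(1)] x(2) by simp
qed

subsection \<open>Connected components\<close>

definition comparable_in :: "'p::order set \<Rightarrow> ('p \<times> 'p) set" where
  "comparable_in U = {(a, b). a \<in> U \<and> b \<in> U \<and> (a \<le> b \<or> b \<le> a)}"

definition component_of :: "'p::order set \<Rightarrow> 'p \<Rightarrow> 'p set" where
  "component_of U x = {y. (x, y) \<in> (comparable_in U)\<^sup>*}"

definition components :: "'p::order set \<Rightarrow> 'p set set" where
  "components U = component_of U ` U"

lemma poset_connected_iff: "poset_connected U \<longleftrightarrow> (\<forall>x\<in>U. U \<subseteq> component_of U x)"
  by (auto simp: poset_connected_def component_of_def comparable_in_def)

lemma component_of_self: "x \<in> component_of U x"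
  by (simp add: component_of_def)

lemma component_of_subset: "x \<in> U \<Longrightarrow> component_of U x \<subseteq> U"
proof
  fix y assume "x \<in> U" "y \<in> component_of U x"
  then have "(x, y) \<in> (comparable_in U)\<^sup>*" by (simp add: component_of_def)
  then show "y \<in> U" using \<open>x \<in> U\<close> by (induction rule: rtrancl_induct) (auto simp: comparable_in_def)
qed

lemma sym_comparable_in: "sym ((comparable_in U)\<^sup>*)"
  by (rule sym_rtrancl) (auto simp: sym_def comparable_in_def)

lemma component_of_eq:
  assumes "y \<in> component_of U x"
  shows "component_of U y = component_of U x"
proof -
  have xy: "(x, y) \<in> (comparable_in U)\<^sup>*" using assms by (simp add: component_of_def)
  then have "(y, x) \<in> (comparable_in U)\<^sup>*" using sym_comparable_in by (auto dest: symD)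
  with xy show ?thesis by (auto simp: component_of_def intro: rtrancl_trans)
qed

lemma component_of_comparable:
  "x \<in> U \<Longrightarrow> y \<in> U \<Longrightarrow> x \<le> y \<or> y \<le> x \<Longrightarrow> component_of U y = component_of U x"
  by (rule component_of_eq) (auto simp: component_of_def comparable_in_def)

lemma components_unique: "Z \<in> components U \<Longrightarrow> x \<in> Z \<Longrightarrow> Z = component_of U x"
  using component_of_eq by (force simp: components_def)

lemma components_subset: "Z \<in> components U \<Longrightarrow> Z \<subseteq> U"
  using component_of_subset by (auto simp: components_def)

lemma component_of_mem: "x \<in> U \<Longrightarrow> component_of U x \<in> components U"
  by (auto simp: components_def)

lemma components_closed:
  assumes "Z \<in> components U" "x \<in> Z" "y \<in> U" "x \<le> y \<or> y \<le> x"
  shows "y \<in> Z"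
  using components_unique[OF assms(1,2)] component_of_comparable[of x U y] components_subset[OF assms(1)]
    component_of_self[of y U] assms by auto

text \<open>A component contains every point of \<open>U\<close> comparable with one of its own, so
  it inherits convexity from \<open>U\<close>; chains starting in it never leave it, so it is
  connected in itself.\<close>

lemma components_intervals:
  assumes U: "poset_convex U" and Z: "Z \<in> components U"
  shows "Z \<in> intervals"
proof -
  have "Z \<noteq> {}" using Z component_of_self by (fastforce simp: components_def)
  moreover have "poset_convex Z"
    unfolding poset_convex_def
  proof (intro ballI allI impI)
    fix x y z assume xyz: "x \<in> Z" "y \<in> Z" "x \<le> z \<and> z \<le> y"
    then have "z \<in> U" using U components_subset[OF Z] unfolding poset_convex_def by blast
    then show "z \<in> Z" using components_closed[OF Z xyz(1)] xyz(3) by blast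
  qed
  moreover have "poset_connected Z"
    unfolding poset_connected_iff
  proof (intro ballI subsetI)
    fix x y assume xy: "x \<in> Z" "y \<in> Z"
    then have "(x, y) \<in> (comparable_in U)\<^sup>*"
      using components_unique[OF Z xy(1)] by (simp add: component_of_def)
    then have "y \<in> Z \<and> y \<in> component_of Z x"
    proof (induction rule: rtrancl_induct)
      case base
      then show ?case using xy component_of_self by blast
    next
      case (step y z)
      then have "z \<in> Z" using components_closed[OF Z, of y z] by (auto simp: comparable_in_def)
      moreover from this step have "(y, z) \<in> comparable_in Z" by (auto simp: comparable_in_def)
      ultimately show ?case using step by (auto simp: component_of_def intro: rtrancl.rtrancl_into_rtrancl)
    qed
    then show "y \<in> component_of Z x" by simp
  qed
  ultimately show ?thesis by (simp add: intervals_def)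
qed

text \<open>A point of \<open>U\<close> lies in exactly one component. The sum over all sets matches
  the shape of a matrix product.\<close>

lemma sum_components:
  fixes U :: "'p::{finite,order} set" and c :: "'p \<Rightarrow> 'k::field"
  assumes "x \<notin> U \<Longrightarrow> c x = 0"
  shows "(\<Sum>Z\<in>UNIV. if Z \<in> components U \<and> x \<in> Z then c x else 0) = c x"
proof (cases "x \<in> U")
  case True
  have "Z \<in> components U \<and> x \<in> Z \<longleftrightarrow> Z = component_of U x" for Z
    using component_of_mem[OF True] component_of_self[of x U] components_unique[of Z U x] by blast
  then show ?thesis by simp
next
  case False
  then show ?thesis using assms by (auto intro!: sum.neutral)
qed

lemma intervals_convex: "S \<in> intervals \<Longrightarrow> poset_convex S"
  by (simp add: intervals_def)

subsection \<open>Standard modules\<close>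

text \<open>For intervals, a map from I_R to I_T is onto exactly if \<open>T \<subseteq> R\<close>
  and it is nonzero, so these are the elements of P(T) none of whose entries is onto.\<close>

definition std_kernel :: "'p::order set \<Rightarrow> ('k::field, 'p) interval_endo set" where
  "std_kernel T = {a \<in> carrier (proj_module T). \<forall>R. T \<subseteq> R \<longrightarrow> (\<forall>x. coord a R T x = 0)}"

text \<open>A map \<open>I\<^sub>R \<rightarrow> I\<^sub>T\<close> is either surjective or vanishes somewhere on \<open>T\<close>; in the second case it
  is \<open>0\<close> as soon as \<open>T \<subseteq> R\<close>.\<close>

lemma hom_fun_vanish:
  assumes T: "poset_connected T" and c: "c \<in> hom_fun R T" and "T \<subseteq> R" and "t \<in> T" "c t = 0"
  shows "c x = 0"
proof (cases "x \<in> T")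
  case True
  then show ?thesis using hom_fun_const[OF c T \<open>T \<subseteq> R\<close> order_refl True \<open>t \<in> T\<close>] \<open>c t = 0\<close> by simp
qed (use hom_fun_supp[OF c] in simp)

lemma coord_hom_fun:
  fixes a :: "('k::field, 'p::{finite,order}) interval_endo"
  shows "a \<in> carrier \<Lambda> \<Longrightarrow> coord a R S \<in> hom_fun R S"
  using coord_is_mat[of a] by (simp add: is_mat_def)

lemma submodule_std_kernel:
  fixes T :: "'p::{finite,order} set"
  assumes T: "T \<in> intervals"
  shows "submodule (std_kernel T :: ('k::field, 'p) interval_endo set) \<Lambda> (proj_module T)"
proof -
  interpret P: left_module "\<Lambda> :: ('k, ('k, 'p) interval_endo) module" "proj_module T"
    by (rule left_module_proj_module[OF T])
  note s = proj_module_simps[OF T]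
  show ?thesis
  proof (rule P.left_submoduleI)
    show "(std_kernel T :: ('k, 'p) interval_endo set) \<subseteq> carrier (proj_module T)"
      by (auto simp: std_kernel_def)
    show "\<zero>\<^bsub>proj_module T\<^esub> \<in> (std_kernel T :: ('k, 'p) interval_endo set)"
      using P.M.zero_closed by (simp add: std_kernel_def s coord_zero_elem)
    fix a b :: "('k, 'p) interval_endo" assume b: "b \<in> std_kernel T"
    show "a \<oplus>\<^bsub>proj_module T\<^esub> b \<in> std_kernel T" if "a \<in> std_kernel T"
      using P.M.a_closed[of a b] that b by (simp add: std_kernel_def s coord_add)
    assume a: "a \<in> carrier \<Lambda>"
    have bC: "b \<in> carrier \<Lambda>" "b \<in> carrier (proj_module T)"
      using b by (auto simp: std_kernel_def proj_module_iff[OF T])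
    \<comment> \<open>If \<open>T \<subseteq> U\<close>, the second factor is zero by assumption;
      otherwise the product vanishes at a point of \<open>T\<close> outside \<open>U\<close>, and
      then everywhere.\<close>
    have z: "coord a R U x * coord b U T x = 0" if "T \<subseteq> R" for R U x
    proof (cases "T \<subseteq> U")
      case True
      then show ?thesis using b by (auto simp: std_kernel_def)
    next
      case False
      then obtain t where t: "t \<in> T" "t \<notin> U" by auto
      have "(\<lambda>x. coord a R U x * coord b U T x) \<in> hom_fun R T"
        by (intro hom_fun_mult[of _ R U] coord_hom_fun a bC)
      from hom_fun_vanish[OF intervals_connected[OF T] this that t(1)]
      show ?thesis using hom_fun_supp[OF coord_hom_fun[OF a], of t R U] t(2) by simp
    qed
    have "coord (a \<otimes>\<^bsub>\<Lambda>\<^esub> b) R T x = 0" if "T \<subseteq> R" for R x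
      unfolding coord_mult[OF a bC(1)] using z[OF that] by (intro sum.neutral ballI)
    then show "a \<odot>\<^bsub>proj_module T\<^esub> b \<in> std_kernel T"
      using P.smult_closed[OF a bC(2)] by (simp add: std_kernel_def s)
  qed
qed

text \<open>A factor not killed by e_R is L(R). Lifting a witness to P(T) gives some
  \<open>b\<close> with e_R b outside the kernel, hence an onto entry in row \<open>R\<close>, and
  this requires \<open>T \<subseteq> R\<close>.\<close>

lemma factors_preceq_std_kernel:
  fixes T :: "'p::{finite,order} set"
  assumes T: "T \<in> intervals"
  shows "factors_preceq T (quotient_module (proj_module T) (std_kernel T :: ('k::field, 'p) interval_endo set))"
  unfolding factors_preceq_def
proof
  let ?P = "proj_module T :: (('k, 'p) interval_endo, _) module"
  let ?U = "std_kernel T :: ('k, 'p) interval_endo set"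
  let ?M = "quotient_module ?P ?U"
  note lP = left_module_proj_module[OF T] and sU = submodule_std_kernel[OF T]
  note s = proj_module_simps[OF T]
  have lM: "left_module \<Lambda> ?M" by (rule left_module_quotient[OF lP sU])
  fix F assume "F \<in> composition_factors \<Lambda> ?M"
  then obtain Us i where cs: "composition_series \<Lambda> ?M Us" and i: "Suc i < length Us"
    and F: "F = quotient_module (?M\<lparr>carrier := Us ! Suc i\<rparr>) (Us ! i)"
    unfolding composition_factors_def by blast
  note m = composition_series_left_module[OF lM cs i, folded F]
  let ?N = "?M\<lparr>carrier := Us ! Suc i\<rparr>"
  interpret F: left_module "\<Lambda> :: ('k, ('k, 'p) interval_endo) module" F by (rule m(1))
  obtain x where x: "x \<in> carrier F" "x \<noteq> \<zero>\<^bsub>F\<^esub>"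
    using m(2) F.M.zero_closed unfolding simple_module_def by blast
  obtain R where R: "R \<in> intervals" "idem_set {R} \<odot>\<^bsub>F\<^esub> x \<noteq> \<zero>\<^bsub>F\<^esub>"
    using exists_idem_not_killing[OF m(1) x] by blast
  have iso: "mod_iso \<Lambda> F (simple_top R)"
    by (rule simple_module_iso_simple_top[OF R(1) m(1,2) x(1) R(2)])
  obtain y where y: "y \<in> Us ! Suc i" "x = Us ! i +>\<^bsub>?N\<^esub> y"
    using x(1) unfolding F carrier_quotient_module by auto
  have yM: "y \<in> carrier ?M" using y(1) submodule_subset[OF m(5)] by blast
  then obtain b where b: "b \<in> carrier ?P" "y = ?U +>\<^bsub>?P\<^esub> b" unfolding carrier_quotient_module by blast
  have "idem_set {R} \<otimes>\<^bsub>\<Lambda>\<^esub> b \<notin> ?U"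
  proof
    assume U: "idem_set {R} \<otimes>\<^bsub>\<Lambda>\<^esub> b \<in> ?U"
    have "idem_set {R} \<odot>\<^bsub>?M\<^esub> y = ?U +>\<^bsub>?P\<^esub> (idem_set {R} \<odot>\<^bsub>?P\<^esub> b)"
      unfolding b(2) by (rule quotient_smult[OF lP sU idem_set_closed b(1)])
    also have "\<dots> = ?U"
      using U submodule_subset[OF sU] by (subst quotient_eq_zero_iff[OF lP sU]) (auto simp: s)
    finally have "idem_set {R} \<odot>\<^bsub>?M\<^esub> y = \<zero>\<^bsub>?M\<^esub>" by (simp add: quotient_module_simps)
    moreover have "idem_set {R} \<odot>\<^bsub>F\<^esub> x = Us ! i +>\<^bsub>?N\<^esub> (idem_set {R} \<odot>\<^bsub>?N\<^esub> y)"
      unfolding y(2) F using y(1) by (intro quotient_smult[OF m(3,4) idem_set_closed]) simp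
    ultimately have "idem_set {R} \<odot>\<^bsub>F\<^esub> x = Us ! i +>\<^bsub>?N\<^esub> \<zero>\<^bsub>?N\<^esub>" by simp
    also have "\<dots> = Us ! i"
      using submodule_zero_mem[OF m(4)] submodule_subset[OF m(4)]
      by (subst quotient_eq_zero_iff[OF m(3,4)]) auto
    finally show False using R(2) by (simp add: F quotient_module_simps)
  qed
  moreover have bC: "b \<in> carrier \<Lambda>" using b(1) by (simp add: proj_module_iff[OF T])
  moreover have "idem_set {R} \<otimes>\<^bsub>\<Lambda>\<^esub> b \<in> carrier ?P"
    using left_module.smult_closed[OF lP idem_set_closed b(1)] by (simp add: s)
  ultimately obtain R' z where "T \<subseteq> R'" "coord (idem_set {R} \<otimes>\<^bsub>\<Lambda>\<^esub> b) R' T z \<noteq> 0"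
    unfolding std_kernel_def by blast
  then have "T \<subseteq> R" using bC by (simp add: coord_mult_idem split: if_splits)
  then have "interval_preceq R T" 
    using psubset_card_mono[of R T] by (cases "R = T") (auto simp: interval_preceq_def)
  with iso R(1) show "\<exists>R\<in>intervals. interval_preceq R T \<and> mod_iso \<Lambda> F (simple_top R)" by blast
qed

text \<open>The ambient space of coordinate matrices is finite dimensional, so the dimension of the
  space of coordinates is a strictly monotone rank function on submodules.\<close>

lemma exists_rank_function:
  fixes T :: "'p::{finite,order} set" and U :: "('k::field, 'p) interval_endo set"
  assumes T: "T \<in> intervals" and U: "submodule U \<Lambda> (proj_module T)"
  shows "\<exists>rk :: ('k, 'p) interval_endo set set \<Rightarrow> nat. \<forall>V W.
    submodule V \<Lambda> (quotient_module (proj_module T) U) \<longrightarrow>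
    submodule W \<Lambda> (quotient_module (proj_module T) U) \<longrightarrow> V \<subset> W \<longrightarrow> rk V < rk W"
proof -
  let ?P = "proj_module T :: (('k, 'p) interval_endo, _) module"
  let ?M = "quotient_module ?P U"
  let ?B = "range (\<lambda>i j. if j = i then 1 else (0::'k)) :: ('p set \<times> 'p set \<times> 'p \<Rightarrow> 'k) set"
  let ?sc = "\<lambda>(c::'k) (f :: 'p set \<times> 'p set \<times> 'p \<Rightarrow> 'k) i. c * f i"
  note lP = left_module_proj_module[OF T]
  interpret V: vector_space ?sc by unfold_locales (auto simp: fun_eq_iff algebra_simps)
  interpret scalar_algebra "\<Lambda> :: ('k, ('k, 'p) interval_endo) module"
    by (rule scalar_algebra_interval_algebra)
  have span: "f \<in> V.span ?B" for f
  proof -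
    have "f = (\<Sum>i\<in>UNIV. ?sc (f i) (\<lambda>j. if j = i then 1 else 0))"
      by (auto simp: fun_eq_iff sum_apply if_distrib cong: if_cong)
    also have "\<dots> \<in> V.span ?B" by (intro V.span_sum V.span_scale V.span_base) auto
    finally show ?thesis .
  qed
  \<comment> \<open>A basis is extracted from the spanning unit functions, which spares a proof that
    they are independent.\<close>
  obtain B where B: "B \<subseteq> ?B" "V.independent B" "?B \<subseteq> V.span B"
    by (rule V.maximal_independent_subset[of ?B])
  have "V.span ?B \<subseteq> V.span B" using B(3) V.subspace_span by (rule V.span_minimal)
  with span have spanB: "V.span B = UNIV" by blast
  interpret F: finite_dimensional_vector_space ?sc B
  proof unfold_locales
    show "finite B" using B(1) by (rule finite_subset) simp
    show "V.independent B" by (fact B(2))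
    show "V.span B = UNIV" by (fact spanB)
  qed
  define vec where "vec a = (\<lambda>(R, S, x). coord a R S x)" for a :: "('k, 'p) interval_endo"
  \<comment> \<open>Coordinates belong to elements and not to cosets, so submodules of the quotient
    are pulled back to P(T) before dimensions are taken.\<close>
  define pre where "pre W = {a \<in> carrier ?P. U +>\<^bsub>?P\<^esub> a \<in> W}" for W
  have sp: "submodule (pre W) \<Lambda> ?P" if "submodule W \<Lambda> ?M" for W
    unfolding pre_def
    by (rule submodule_vimage[OF lP left_module_quotient[OF lP U] lin_map_quotient[OF lP U] that])
  have sub: "V.subspace (vec ` pre W)" if W: "submodule W \<Lambda> ?M" for W
    unfolding V.subspace_def
  proof (intro conjI ballI allI)
    note s = proj_module_simps[OF T]
    have "vec \<zero>\<^bsub>\<Lambda>\<^esub> = 0" by (auto simp: vec_def coord_zero_elem fun_eq_iff)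
    moreover have "\<zero>\<^bsub>\<Lambda>\<^esub> \<in> pre W" using submodule_zero_mem[OF sp[OF W]] by (simp add: s)
    ultimately show "0 \<in> vec ` pre W" by (metis image_eqI)
    fix f g assume "f \<in> vec ` pre W" "g \<in> vec ` pre W"
    then obtain a b where ab: "a \<in> pre W" "b \<in> pre W" "f = vec a" "g = vec b" by auto
    then have "f + g = vec (a \<oplus>\<^bsub>\<Lambda>\<^esub> b)" by (auto simp: vec_def coord_add fun_eq_iff)
    moreover have "a \<oplus>\<^bsub>\<Lambda>\<^esub> b \<in> pre W" using submodule_add[OF sp[OF W] ab(1,2)] by (simp add: s)
    ultimately show "f + g \<in> vec ` pre W" by blast
  next
    note s = proj_module_simps[OF T]
    fix c f assume "f \<in> vec ` pre W"
    then obtain a where a: "a \<in> pre W" "f = vec a" by auto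
    then have aC: "a \<in> carrier \<Lambda>" by (simp add: pre_def proj_module_iff[OF T])
    have "?sc c f = vec ((c \<odot>\<^bsub>\<Lambda>\<^esub> \<one>\<^bsub>\<Lambda>\<^esub>) \<otimes>\<^bsub>\<Lambda>\<^esub> a)"
      by (auto simp: a(2) vec_def coord_scalar_mult[OF aC] fun_eq_iff)
    moreover have "(c \<odot>\<^bsub>\<Lambda>\<^esub> \<one>\<^bsub>\<Lambda>\<^esub>) \<otimes>\<^bsub>\<Lambda>\<^esub> a \<in> pre W"
      using submodule_smult[OF sp[OF W] scalar_closed a(1)] by (simp add: s)
    ultimately show "?sc c f \<in> vec ` pre W" by blast
  qed
  have inj: "inj_on vec (carrier ?P)"
  proof (rule inj_onI)
    fix a b assume "a \<in> carrier ?P" "b \<in> carrier ?P" "vec a = vec b"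
    then show "a = b"
      by (intro coord_inj) (auto simp: proj_module_iff[OF T] vec_def fun_eq_iff)
  qed
  show ?thesis
  proof (intro exI[of _ "\<lambda>W. V.dim (vec ` pre W)"] allI impI)
    fix X Y assume X: "submodule X \<Lambda> ?M" and Y: "submodule Y \<Lambda> ?M" and XY: "X \<subset> Y"
    obtain y where y: "y \<in> Y" "y \<notin> X" using XY by auto
    then obtain a where a: "a \<in> carrier ?P" "y = U +>\<^bsub>?P\<^esub> a"
      using submodule_subset[OF Y] unfolding carrier_quotient_module by blast
    have "pre X \<subseteq> carrier ?P" by (auto simp: pre_def)
    have "vec a \<notin> vec ` pre X"
    proof
      assume "vec a \<in> vec ` pre X"
      then have "a \<in> pre X" using inj_on_image_mem_iff[OF inj a(1) \<open>pre X \<subseteq> carrier ?P\<close>] by simp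
      then show False using a y by (simp add: pre_def)
    qed
    moreover have "vec a \<in> vec ` pre Y" using a y by (simp add: pre_def)
    moreover have "vec ` pre X \<subseteq> vec ` pre Y" using XY by (auto simp: pre_def)
    ultimately have "vec ` pre X \<subset> vec ` pre Y" by blast
    then show "V.dim (vec ` pre X) < V.dim (vec ` pre Y)"
      by (intro F.dim_psubset) (simp add: V.span_eq_iff[THEN iffD2, OF sub[OF X]] V.span_eq_iff[THEN iffD2, OF sub[OF Y]])
  qed
qed

text \<open>For \<open>Z\<close> in \<open>J\<close> the idempotent e_Z kills all permitted factors,
  so e_Z P(T) lies in \<open>U\<close>. An element of the kernel factors through such
  \<open>Z\<close>, namely the components of the supports of its entries: these are proper subsets
  of \<open>T\<close>, hence smaller.\<close>

lemma std_kernel_least: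
  fixes T :: "'p::{finite,order} set" and U :: "('k::field, 'p) interval_endo set"
  assumes T: "T \<in> intervals" and U: "submodule U \<Lambda> (proj_module T)"
    and fac: "factors_preceq T (quotient_module (proj_module T) U)"
  shows "std_kernel T \<subseteq> U"
proof
  let ?P = "proj_module T :: (('k, 'p) interval_endo, _) module"
  let ?M = "quotient_module ?P U"
  note lP = left_module_proj_module[OF T] and s = proj_module_simps[OF T]
  have lM: "left_module \<Lambda> ?M" by (rule left_module_quotient[OF lP U])
  obtain Us where cs: "composition_series \<Lambda> ?M Us"
    using exists_rank_function[OF T U] exists_composition_series[OF lM] by blast
  define J where "J = {Z \<in> intervals. Z \<noteq> T \<and> card Z \<le> card T}"
  have one: "idem_set {Z} \<otimes>\<^bsub>\<Lambda>\<^esub> b \<in> U" if Z: "Z \<in> J" and b: "b \<in> carrier ?P" for Z b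
  proof -
    have "idem_set {Z} \<odot>\<^bsub>?M\<^esub> (U +>\<^bsub>?P\<^esub> b) = \<zero>\<^bsub>?M\<^esub>"
    proof (rule idempotent_kills_factors[OF lM cs idem_set_closed idem_set_idem])
      show "U +>\<^bsub>?P\<^esub> b \<in> carrier ?M" using b by (auto simp: carrier_quotient_module)
      fix F X assume F: "F \<in> composition_factors \<Lambda> ?M" and X: "X \<in> carrier F"
      obtain R where R: "R \<in> intervals" "interval_preceq R T" "mod_iso \<Lambda> F (simple_top R)"
        using fac F unfolding factors_preceq_def by blast
      obtain Us' i where cs': "composition_series \<Lambda> ?M Us'" "Suc i < length Us'"
        "F = quotient_module (?M\<lparr>carrier := Us' ! Suc i\<rparr>) (Us' ! i)"
        using F unfolding composition_factors_def by blast
      have lF: "left_module \<Lambda> F" using composition_series_left_module(1)[OF lM cs'(1,2)] cs'(3) by simp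
      have "Z \<noteq> R" using Z R(2) by (auto simp: J_def interval_preceq_def)
      then show "idem_set {Z} \<odot>\<^bsub>F\<^esub> X = \<zero>\<^bsub>F\<^esub>" by (rule idem_kills_simple_top[OF R(1) lF R(3) X])
    qed
    then have "U +>\<^bsub>?P\<^esub> (idem_set {Z} \<odot>\<^bsub>?P\<^esub> b) = U"
      using quotient_smult[OF lP U idem_set_closed b] by (simp add: quotient_module_simps(2))
    then show ?thesis
      using quotient_eq_zero_iff[OF lP U left_module.smult_closed[OF lP idem_set_closed b]] by (simp add: s)
  qed
  have many: "idem_set J' \<otimes>\<^bsub>\<Lambda>\<^esub> b \<in> U" if "J' \<subseteq> J" and b: "b \<in> carrier ?P" for J' b
  proof -
    have bC: "b \<in> carrier \<Lambda>" using b by (simp add: proj_module_iff[OF T])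
    have "finite J'" by simp
    then show ?thesis using \<open>J' \<subseteq> J\<close>
    proof (induction J' rule: finite_induct)
      case empty
      have "idem_set {} \<otimes>\<^bsub>\<Lambda>\<^esub> b = \<zero>\<^bsub>\<Lambda>\<^esub>"
        by (rule coord_inj) (simp_all add: idem_set_closed fun_eq_iff coord_mult_idem coord_zero_elem bC)
      then show ?case using submodule_zero_mem[OF U] by (simp add: s)
    next
      case (insert Z J')
      have "idem_set (insert Z J') \<otimes>\<^bsub>\<Lambda>\<^esub> b = (idem_set {Z} \<otimes>\<^bsub>\<Lambda>\<^esub> b) \<oplus>\<^bsub>\<Lambda>\<^esub> (idem_set J' \<otimes>\<^bsub>\<Lambda>\<^esub> b)"
        using insert(2)
        by (intro coord_inj) (auto simp: idem_set_closed fun_eq_iff coord_mult_idem coord_add bC)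
      then show ?case using submodule_add[OF U one[of Z b]] insert b by (simp add: s)
    qed
  qed
  fix a :: "('k, 'p) interval_endo" assume a: "a \<in> std_kernel T"
  then have aC: "a \<in> carrier \<Lambda>" and aT: "\<And>R Q x. Q \<noteq> T \<Longrightarrow> coord a R Q x = 0"
    and a0: "\<And>R x. T \<subseteq> R \<Longrightarrow> coord a R T x = 0"
    by (auto simp: std_kernel_def proj_module_iff[OF T])
  define W where "W R = {x. coord a R T x \<noteq> 0}" for R
  have nz: "R \<in> intervals \<and> x \<in> R \<and> x \<in> T \<and> \<not> T \<subseteq> R" if "x \<in> W R" for R x
    using that coord_zero[OF aC, of R x T] coord_zero'[OF aC, of T x R] a0[of R x] by (auto simp: W_def)
  have WRT: "W R \<subseteq> R" "W R \<subseteq> T" "W R \<noteq> {} \<Longrightarrow> R \<in> intervals" "W R \<noteq> {} \<Longrightarrow> R \<inter> T \<subset> T" for R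
    using nz by blast+
  have Weq: "coord a R T x = coord a R T y" if "x \<in> R" "y \<in> T" "x \<le> y" for R x y
    by (rule hom_fun_eq[OF coord_hom_fun[OF aC] that])
  have Wconv: "poset_convex (W R)" for R
    unfolding poset_convex_def
  proof (intro ballI allI impI)
    fix x y z assume xyz: "x \<in> W R" "y \<in> W R" "x \<le> z \<and> z \<le> y"
    have "z \<in> T" using xyz WRT(2)[of R] intervals_convex[OF T] unfolding poset_convex_def by blast
    then have "coord a R T x = coord a R T z" using Weq[of x R z] xyz WRT(1)[of R] by blast
    then show "z \<in> W R" using xyz(1) by (simp add: W_def)
  qed
  \<comment> \<open>The components are upsets of \<open>T\<close>, which is what makes the inclusion
    of I_Z into I_T a morphism.\<close>
  have Zup: "y \<in> Z" if Z: "Z \<in> components (W R)" and "x \<in> Z" "y \<in> T" "x \<le> y" for R Z x y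
  proof -
    have x: "x \<in> W R" using components_subset[OF Z] \<open>x \<in> Z\<close> by blast
    then have "coord a R T x = coord a R T y" using nz[OF x] by (intro Weq) (use that in auto)
    with x have "y \<in> W R" by (simp add: W_def)
    then show ?thesis using components_closed[OF Z \<open>x \<in> Z\<close>] \<open>x \<le> y\<close> by blast
  qed
  have ZJ: "Z \<in> J" "Z \<subseteq> T" if Z: "Z \<in> components (W R)" for R Z
  proof -
    have "W R \<noteq> {}" using Z by (auto simp: components_def)
    then have ZT: "Z \<subset> T" using components_subset[OF Z] WRT[of R] by blast
    then show "Z \<in> J" "Z \<subseteq> T"
      using components_intervals[OF Wconv Z] psubset_card_mono[OF _ ZT] by (auto simp: J_def)
  qed
  \<comment> \<open>The factorisation of \<open>a\<close>: \<open>b\<close> carries the values of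
    the entries into the components of their supports, and \<open>g\<close> consists of the
    inclusions of these components into I_T.\<close>
  define b where "b R Z x = (if Z \<in> components (W R) \<and> x \<in> Z then coord a R T x else 0)" for R Z x
  define g where "g Z Q x = (if Q = T \<and> (\<exists>R. Z \<in> components (W R)) \<and> x \<in> Z then 1 else (0::'k))" for Z Q x
  have mb: "is_mat b"
    unfolding is_mat_def
  proof (intro conjI allI impI)
    fix R Z x
    show "b R Z \<in> hom_fun R Z"
    proof (rule hom_funI)
      show "b R Z x = 0" if "x \<notin> R \<or> x \<notin> Z" for x using that coord_zero[OF aC] by (auto simp: b_def)
      fix x y assume xy: "x \<in> R" "y \<in> Z" "x \<le> y"
      show "b R Z x = b R Z y"
      proof (cases "Z \<in> components (W R)")
        case True
        then have y: "y \<in> W R" "y \<in> T" using components_subset[OF True] nz[of _ R] xy(2) by blast+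
        then have "coord a R T x = coord a R T y" using Weq xy by blast
        moreover from this y have "x \<in> W R" by (simp add: W_def)
        then have "x \<in> Z" using components_closed[OF True xy(2)] xy(3) by blast
        ultimately show ?thesis using xy(2) by (simp add: b_def)
      qed (simp add: b_def)
    qed
    show "b R Z x = 0" if "R \<notin> intervals \<or> Z \<notin> intervals"
      using that coord_zero[OF aC, of R x T] components_intervals[OF Wconv, of Z R] by (auto simp: b_def)
  qed
  have mg: "is_mat g"
    unfolding is_mat_def
  proof (intro conjI allI impI)
    fix Z Q x
    show "g Z Q \<in> hom_fun Z Q"
      by (rule hom_funI) (auto simp: g_def dest: Zup subsetD[OF ZJ(2)])
    show "g Z Q x = 0" if "Z \<notin> intervals \<or> Q \<notin> intervals"
      using that T components_intervals[OF Wconv, of Z] by (auto simp: g_def)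
  qed
  have gP: "of_mat g \<in> carrier ?P"
    using of_mat_closed[OF mg] by (auto simp: proj_module_iff[OF T] coord_of_mat[OF mg] g_def)
  have "idem_set J \<otimes>\<^bsub>\<Lambda>\<^esub> of_mat g = of_mat g"
    by (rule coord_inj)
      (use ZJ in \<open>auto simp: idem_set_closed of_mat_closed[OF mg] coord_mult_idem fun_eq_iff coord_of_mat[OF mg] g_def\<close>)
  then have "of_mat g \<in> U" using many[OF order_refl gP] by simp
  then have "of_mat b \<otimes>\<^bsub>\<Lambda>\<^esub> of_mat g \<in> U"
    using submodule_smult[OF U of_mat_closed[OF mb]] by (simp add: s)
  also have "of_mat b \<otimes>\<^bsub>\<Lambda>\<^esub> of_mat g = a"
  proof (rule coord_inj)
    show "coord (of_mat b \<otimes>\<^bsub>\<Lambda>\<^esub> of_mat g) = coord a"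
    proof (intro ext)
      fix R Q x
      have "coord (of_mat b \<otimes>\<^bsub>\<Lambda>\<^esub> of_mat g) R Q x = (\<Sum>Z\<in>UNIV. b R Z x * g Z Q x)"
        by (simp add: coord_mult of_mat_closed mb mg coord_of_mat)
      also have "\<dots> = (\<Sum>Z\<in>UNIV. if Z \<in> components (W R) \<and> x \<in> Z then coord a R Q x else 0)"
        using aT[of Q R x] by (intro sum.cong) (auto simp: b_def g_def)
      also have "\<dots> = coord a R Q x"
        using aT[of Q R x] by (intro sum_components) (auto simp: W_def)
      finally show "coord (of_mat b \<otimes>\<^bsub>\<Lambda>\<^esub> of_mat g) R Q x = coord a R Q x" .
    qed
  qed (simp_all add: of_mat_closed mb mg aC)
  finally show "a \<in> U" .
qed

lemma standard_module_eq:
  fixes T :: "'p::{finite,order} set"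
  assumes T: "T \<in> intervals"
  shows "(standard_module T :: (('k::field, 'p) interval_endo, _) module) =
    quotient_module (proj_module T) (std_kernel T)"
  unfolding standard_module_def
  by (rule arg_cong[where f = "quotient_module (proj_module T)"], rule Least_equality)
    (use submodule_std_kernel[OF T] factors_preceq_std_kernel[OF T] std_kernel_least[OF T] in auto)

section \<open>The Koszul resolution of a standard module\<close>

subsection \<open>Signs\<close>

text \<open>An arbitrary total order on the points, unrelated to the partial order, used only for
  signs.\<close>

definition elem_rank :: "'p::finite \<Rightarrow> nat" where
  "elem_rank = (SOME f. inj f)"

lemma inj_elem_rank: "inj (elem_rank :: 'p::finite \<Rightarrow> nat)"
proof -
  have "\<exists>f :: 'p \<Rightarrow> nat. inj f"
    using finite_imp_inj_to_nat_seg[of "UNIV :: 'p set"] by auto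
  then show ?thesis unfolding elem_rank_def by (rule someI_ex)
qed

text \<open>The exterior algebra sign for moving \<open>m\<close> to its place among the ordered
  elements of \<open>A\<close>.\<close>

definition ksign :: "'p::finite \<Rightarrow> 'p set \<Rightarrow> 'k::field" where
  "ksign m A = (-1) ^ card {a \<in> A. elem_rank a < elem_rank m}"

lemma ksign_square: "ksign m A * ksign m A = (1 :: 'k::field)"
  by (simp add: ksign_def flip: power_add)

lemma ksign_square_mult: "ksign m A * (ksign m A * t) = (t :: 'k::field)"
  by (simp add: ksign_square flip: mult.assoc)

lemma ksign_insert:
  assumes "n \<notin> B"
  shows "ksign m (insert n B) = (if elem_rank n < elem_rank m then - ksign m B else (ksign m B :: 'k::field))"
proof (cases "elem_rank n < elem_rank m")
  case True
  then have "{a \<in> insert n B. elem_rank a < elem_rank m} = insert n {a \<in> B. elem_rank a < elem_rank m}" by auto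
  with True assms show ?thesis by (simp add: ksign_def)
next
  case False
  then have "{a \<in> insert n B. elem_rank a < elem_rank m} = {a \<in> B. elem_rank a < elem_rank m}" by auto
  with False show ?thesis by (simp add: ksign_def)
qed

text \<open>Of two distinct elements exactly one precedes the other, so exactly one of the two signs
  is affected by inserting the other element. The first form serves the contractions, the second the
  vanishing of the squared differential.\<close>

lemma ksign_swap:
  assumes "m \<noteq> n" "m \<notin> B" "n \<notin> B"
  shows "ksign n (insert m B) * ksign m (insert n B) = - (ksign n B * ksign m B :: 'k::field)"
    and "ksign m B * ksign n (insert m B) = - (ksign n B * ksign m (insert n B) :: 'k)"
proof -
  have "elem_rank m \<noteq> elem_rank n" using inj_elem_rank assms(1) by (auto simp: inj_def)
  then show "ksign n (insert m B) * ksign m (insert n B) = - (ksign n B * ksign m B :: 'k)"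
    and "ksign m B * ksign n (insert m B) = - (ksign n B * ksign m (insert n B) :: 'k)"
    using assms by (auto simp: ksign_insert)
qed

subsection \<open>Removing minimal elements\<close>

lemma exists_minimal_below:
  fixes T :: "'p::{finite,order} set"
  assumes "t \<in> T"
  shows "\<exists>m\<in>minimal_elements T. m \<le> t"
proof -
  obtain m where "m \<in> T" "m \<le> t" "\<forall>b\<in>T. b \<le> m \<longrightarrow> m = b"
    using finite_has_minimal2[of T t] assms by auto
  then show ?thesis by (auto simp: minimal_elements_def less_le)
qed

lemma minimal_elementsD: "m \<in> minimal_elements T \<Longrightarrow> x \<in> T \<Longrightarrow> x \<le> m \<Longrightarrow> x = m"
  by (auto simp: minimal_elements_def less_le)

lemma minimal_elements_subset: "minimal_elements T \<subseteq> T"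
  by (auto simp: minimal_elements_def)

lemma convex_Diff_minimal:
  assumes "poset_convex T" "A \<subseteq> minimal_elements T"
  shows "poset_convex (T - A)"
  unfolding poset_convex_def
proof (intro ballI allI impI)
  fix x y z assume "x \<in> T - A" "y \<in> T - A" "x \<le> z \<and> z \<le> y"
  moreover from this have "z \<in> T" using assms(1) unfolding poset_convex_def by blast
  ultimately show "z \<in> T - A" using assms(2) minimal_elementsD[of z T x] by auto
qed

lemma hom_fun_Diff_mono:
  assumes "A \<subseteq> A'" "A' \<subseteq> minimal_elements T" and c: "c \<in> hom_fun R (T - A')"
  shows "c \<in> hom_fun R (T - A)"
proof (rule hom_funI)
  show "c x = 0" if "x \<notin> R \<or> x \<notin> T - A" for x
    using that assms(1) hom_fun_supp[OF c, of x] by auto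
  fix x y assume xy: "x \<in> R" "y \<in> T - A" "x \<le> y"
  show "c x = c y"
  proof (cases "y \<in> A'")
    case True
    \<comment> \<open>A removed \<open>y\<close> is minimal in \<open>T\<close>, so a point below it
      is \<open>y\<close> itself or lies outside \<open>T\<close>, where both values are
      zero.\<close>
    then have "x = y \<or> x \<notin> T" using minimal_elementsD[of y T x] assms(2) xy(3) by auto
    then show ?thesis using True hom_fun_supp[OF c, of x] hom_fun_supp[OF c, of y] by auto
  next
    case False
    then show ?thesis using hom_fun_eq[OF c xy(1) _ xy(3)] xy(2) by simp
  qed
qed

lemma hom_fun_uminus: "c \<in> hom_fun R S \<Longrightarrow> (\<lambda>x. - c x) \<in> hom_fun R S"
  by (simp add: hom_fun_def)

text \<open>For a component \<open>S\<close> of \<open>V\<close> the representation I_S is a direct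
  summand of I_V: this is the projection, and \<open>hom_fun_component_mono\<close> is the
  inclusion.\<close>

lemma hom_fun_component_restrict:
  assumes c: "c \<in> hom_fun R V" and S: "S \<in> components V"
  shows "(\<lambda>x. if x \<in> S then c x else 0) \<in> hom_fun R S"
proof (rule hom_funI)
  show "(if x \<in> S then c x else 0) = 0" if "x \<notin> R \<or> x \<notin> S" for x
    using that hom_fun_supp[OF c, of x] by auto
  fix x y assume xy: "x \<in> R" "y \<in> S" "x \<le> y"
  have "y \<in> V" using components_subset[OF S] xy(2) by blast
  then have "c x = c y" using hom_fun_eq[OF c] xy by blast
  moreover have "x \<notin> S \<Longrightarrow> c x = 0"
    using components_closed[OF S xy(2), of x] xy(3) hom_fun_supp[OF c, of x] by blast
  ultimately show "(if x \<in> S then c x else 0) = (if y \<in> S then c y else 0)" using xy(2) by auto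
qed

lemma hom_fun_component_mono:
  assumes c: "c \<in> hom_fun R S" and S: "S \<in> components V"
  shows "c \<in> hom_fun R V"
proof (rule hom_funI)
  show "c x = 0" if "x \<notin> R \<or> x \<notin> V" for x
    using that hom_fun_supp[OF c, of x] components_subset[OF S] by auto
  fix x y assume xy: "x \<in> R" "y \<in> V" "x \<le> y"
  have "y \<notin> S \<Longrightarrow> x \<notin> S" using components_closed[OF S _ xy(2), of x] xy(3) by blast
  then show "c x = c y"
    using hom_fun_eq[OF c xy(1) _ xy(3)] hom_fun_supp[OF c, of x] hom_fun_supp[OF c, of y] by metis
qed

subsection \<open>The Koszul complex\<close>

text \<open>\<open>F A R\<close> is the component of \<open>F\<close> in \<open>Hom(I\<^sub>R, I\<^bsub>T - A\<^esub>)\<close>. As \<open>A\<close> consists of minimal elements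
  of \<open>T\<close>, the (decomposable) representation \<open>I\<^bsub>T - A\<^esub>\<close> is a subrepresentation of \<open>I\<^sub>T\<close>, and the
  inclusions between them become identities of functions.\<close>

definition kidx :: "'p::order set \<Rightarrow> nat \<Rightarrow> 'p set set" where
  "kidx T n = {A. A \<subseteq> minimal_elements T \<and> card A = n}"

definition koszul ::
  "'p::{finite,order} set \<Rightarrow> nat \<Rightarrow> (('k::field, 'p) interval_endo, 'p set \<Rightarrow> 'p set \<Rightarrow> 'p \<Rightarrow> 'k) module" where
  "koszul T n = \<lparr>
     carrier = {F. (\<forall>A R. F A R \<in> hom_fun R (T - A)) \<and>
       (\<forall>A R x. A \<notin> kidx T n \<or> R \<notin> intervals \<longrightarrow> F A R x = 0)},
     mult = undefined, one = undefined,
     zero = (\<lambda>A R x. 0),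
     add = (\<lambda>F G A R x. F A R x + G A R x),
     smult = (\<lambda>a F A R x. \<Sum>U\<in>UNIV. coord a R U x * F A U x)\<rparr>"

text \<open>Indexed by the target: at \<open>A\<close> arrive the inclusions from the
  subrepresentations in which one further minimal element has been removed.\<close>

definition kdiff ::
  "'p::{finite,order} set \<Rightarrow> ('p set \<Rightarrow> 'p set \<Rightarrow> 'p \<Rightarrow> 'k::field) \<Rightarrow> 'p set \<Rightarrow> 'p set \<Rightarrow> 'p \<Rightarrow> 'k" where
  "kdiff T F A R x = (\<Sum>m\<in>minimal_elements T - A. ksign m A * F (insert m A) R x)"

lemma koszul_simps:
  "\<zero>\<^bsub>koszul T n\<^esub> = (\<lambda>A R x. 0)"
  "F \<oplus>\<^bsub>koszul T n\<^esub> G = (\<lambda>A R x. F A R x + G A R x)"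
  "a \<odot>\<^bsub>koszul T n\<^esub> F = (\<lambda>A R x. \<Sum>U\<in>UNIV. coord a R U x * F A U x)"
  by (simp_all add: koszul_def)

lemma koszul_iff:
  "F \<in> carrier (koszul T n) \<longleftrightarrow> (\<forall>A R. F A R \<in> hom_fun R (T - A)) \<and>
       (\<forall>A R x. A \<notin> kidx T n \<or> R \<notin> intervals \<longrightarrow> F A R x = 0)"
  by (simp add: koszul_def)

lemma koszul_hom_fun: "F \<in> carrier (koszul T n) \<Longrightarrow> F A R \<in> hom_fun R (T - A)"
  and koszul_zero: "F \<in> carrier (koszul T n) \<Longrightarrow> A \<notin> kidx T n \<or> R \<notin> intervals \<Longrightarrow> F A R x = 0"
  by (auto simp: koszul_iff)

lemma koszul_hom_fun_T:
  assumes "F \<in> carrier (koszul T n)"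
  shows "F A R \<in> hom_fun R T"
proof (cases "A \<in> kidx T n")
  case True
  then show ?thesis
    using hom_fun_Diff_mono[of "{}" A T "F A R" R] koszul_hom_fun[OF assms, of A R] by (simp add: kidx_def)
next
  case False
  then have "F A R = (\<lambda>x. 0)" using koszul_zero[OF assms] by blast
  then show ?thesis by (simp add: hom_fun_zero)
qed

lemma kidx_insert:
  fixes T :: "'p::{finite,order} set"
  shows "m \<in> minimal_elements T - A \<Longrightarrow> insert m A \<in> kidx T (Suc n) \<longleftrightarrow> A \<in> kidx T n"
  by (auto simp: kidx_def)

lemma left_module_koszul:
  "left_module \<Lambda> (koszul T n :: (('k::field, 'p::{finite,order}) interval_endo, _) module)"
proof -
  let ?K = "koszul T n :: (('k, 'p) interval_endo, _) module"
  have sm: "(\<lambda>A R x. \<Sum>U\<in>UNIV. coord a R U x * F A U x) \<in> carrier ?K"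
    if a: "a \<in> carrier \<Lambda>" and F: "F \<in> carrier ?K" for a F
    unfolding koszul_iff
  proof (intro conjI allI impI)
    fix A R x
    show "(\<lambda>x. \<Sum>U\<in>UNIV. coord a R U x * F A U x) \<in> hom_fun R (T - A)"
      by (intro hom_fun_sum hom_fun_mult[OF coord_hom_fun[OF a] koszul_hom_fun[OF F]])
    show "(\<Sum>U\<in>UNIV. coord a R U x * F A U x) = 0" if "A \<notin> kidx T n \<or> R \<notin> intervals"
      using that koszul_zero[OF F, of A] coord_zero[OF a, of R x] by (intro sum.neutral) auto
  qed
  have "(\<lambda>A R x. - F A R x) \<in> carrier ?K" if "F \<in> carrier ?K" for F
    using that by (simp add: koszul_iff hom_fun_uminus)
  then have inv: "\<exists>G\<in>carrier ?K. (\<lambda>A R x. G A R x + F A R x) = (\<lambda>A R x. 0)" if "F \<in> carrier ?K" for F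
    using that by (intro bexI[of _ "\<lambda>A R x. - F A R x"]) simp_all
  have "abelian_group ?K"
  proof (rule abelian_groupI; unfold koszul_simps)
    show "(\<lambda>A R x. F A R x + G A R x) \<in> carrier ?K" if "F \<in> carrier ?K" "G \<in> carrier ?K" for F G
      using that by (simp add: koszul_iff hom_fun_add)
    show "(\<lambda>A R x. 0) \<in> carrier ?K" by (simp add: koszul_iff hom_fun_zero)
  qed (use inv in \<open>auto simp: algebra_simps\<close>)
  moreover have "left_module_axioms \<Lambda> ?K"
  proof (rule left_module_axioms.intro; unfold koszul_simps)
    fix a b F G assume a: "a \<in> carrier (\<Lambda> :: ('k, ('k, 'p) interval_endo) module)" and F: "F \<in> carrier ?K"
    show "(\<lambda>A R x. \<Sum>U\<in>UNIV. coord a R U x * F A U x) \<in> carrier ?K" by (rule sm[OF a F])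
    show "(\<lambda>A R x. \<Sum>U\<in>UNIV. coord a R U x * (F A U x + G A U x)) = (\<lambda>A R x.
       (\<Sum>U\<in>UNIV. coord a R U x * F A U x) + (\<Sum>U\<in>UNIV. coord a R U x * G A U x))"
      by (simp add: algebra_simps sum.distrib)
    assume b: "b \<in> carrier (\<Lambda> :: ('k, ('k, 'p) interval_endo) module)"
    show "(\<lambda>A R x. \<Sum>U\<in>UNIV. coord (a \<oplus>\<^bsub>\<Lambda>\<^esub> b) R U x * F A U x) = (\<lambda>A R x.
       (\<Sum>U\<in>UNIV. coord a R U x * F A U x) + (\<Sum>U\<in>UNIV. coord b R U x * F A U x))"
      by (simp add: coord_add algebra_simps sum.distrib)
    show "(\<lambda>A R x. \<Sum>U\<in>UNIV. coord (a \<otimes>\<^bsub>\<Lambda>\<^esub> b) R U x * F A U x) = (\<lambda>A R x.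
       \<Sum>U\<in>UNIV. coord a R U x * (\<Sum>V\<in>UNIV. coord b U V x * F A V x))"
    proof (intro ext)
      fix A R x
      have "(\<Sum>U\<in>UNIV. coord (a \<otimes>\<^bsub>\<Lambda>\<^esub> b) R U x * F A U x) =
          (\<Sum>U\<in>UNIV. \<Sum>V\<in>UNIV. coord a R V x * (coord b V U x * F A U x))"
        by (simp add: coord_mult[OF a b] sum_distrib_right mult.assoc)
      also have "\<dots> = (\<Sum>V\<in>UNIV. \<Sum>U\<in>UNIV. coord a R V x * (coord b V U x * F A U x))"
        by (rule sum.swap)
      finally show "(\<Sum>U\<in>UNIV. coord (a \<otimes>\<^bsub>\<Lambda>\<^esub> b) R U x * F A U x) =
          (\<Sum>U\<in>UNIV. coord a R U x * (\<Sum>V\<in>UNIV. coord b U V x * F A V x))"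
        by (simp add: sum_distrib_left)
    qed
  next
    fix F assume F: "F \<in> carrier ?K"
    show "(\<lambda>A R x. \<Sum>U\<in>UNIV. coord (\<one>\<^bsub>\<Lambda>\<^esub> :: ('k, 'p) interval_endo) R U x * F A U x) = F"
    proof (intro ext)
      fix A R x
      have "(\<Sum>U\<in>UNIV. coord (\<one>\<^bsub>\<Lambda>\<^esub> :: ('k, 'p) interval_endo) R U x * F A U x) =
          (\<Sum>U\<in>UNIV. if U = R then F A R x else 0)"
        using koszul_zero[OF F, of A R x] hom_fun_supp[OF koszul_hom_fun[OF F], of x R A]
        by (intro sum.cong) (auto simp: coord_one)
      then show "(\<Sum>U\<in>UNIV. coord (\<one>\<^bsub>\<Lambda>\<^esub> :: ('k, 'p) interval_endo) R U x * F A U x) = F A R x" by simp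
    qed
  qed
  ultimately show ?thesis by (simp add: left_module_def ring_interval_algebra)
qed

text \<open>The algebra acts on the index \<open>R\<close> and the differential on the index
  \<open>A\<close>, so the two finite sums commute.\<close>

lemma lin_map_kdiff:
  "lin_map \<Lambda> (koszul T (Suc n)) (koszul T n :: (('k::field, 'p::{finite,order}) interval_endo, _) module) (kdiff T)"
proof (rule lin_mapI)
  fix F :: "'p set \<Rightarrow> 'p set \<Rightarrow> 'p \<Rightarrow> 'k"
  assume F: "F \<in> carrier (koszul T (Suc n) :: (('k, 'p) interval_endo, _) module)"
  show "kdiff T F \<in> carrier (koszul T n :: (('k, 'p) interval_endo, _) module)"
    unfolding koszul_iff
  proof (intro conjI allI impI)
    fix A R x
    have "(\<lambda>x. ksign m A * F (insert m A) R x) \<in> hom_fun R (T - A)" if m: "m \<in> minimal_elements T - A" for m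
    proof (cases "insert m A \<in> kidx T (Suc n)")
      case True
      then show ?thesis
        using hom_fun_Diff_mono[of A "insert m A" T "F (insert m A) R" R] koszul_hom_fun[OF F]
        by (auto simp: kidx_def intro: hom_fun_scale)
    next
      case False
      then have "F (insert m A) R x = 0" for x using koszul_zero[OF F] by blast
      then show ?thesis by (simp add: hom_fun_zero)
    qed
    then have "(\<lambda>x. \<Sum>m\<in>minimal_elements T - A. ksign m A * F (insert m A) R x) \<in> hom_fun R (T - A)"
      by (rule hom_fun_sum)
    then show "kdiff T F A R \<in> hom_fun R (T - A)" by (simp add: kdiff_def[abs_def])
    show "kdiff T F A R x = 0" if "A \<notin> kidx T n \<or> R \<notin> intervals"
      unfolding kdiff_def using that kidx_insert[of _ T A n]
      by (intro sum.neutral ballI) (auto simp: koszul_zero[OF F])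
  qed
  show "kdiff T (a \<odot>\<^bsub>koszul T (Suc n)\<^esub> F) = a \<odot>\<^bsub>koszul T n\<^esub> kdiff T F" for a :: "('k, 'p) interval_endo"
  proof (intro ext)
    fix A R x
    have "kdiff T (a \<odot>\<^bsub>koszul T (Suc n)\<^esub> F) A R x =
      (\<Sum>m\<in>minimal_elements T - A. \<Sum>U\<in>UNIV. coord a R U x * (ksign m A * F (insert m A) U x))"
      by (simp add: kdiff_def koszul_simps sum_distrib_left algebra_simps)
    also have "\<dots> = (\<Sum>U\<in>UNIV. \<Sum>m\<in>minimal_elements T - A. coord a R U x * (ksign m A * F (insert m A) U x))"
      by (rule sum.swap)
    finally show "kdiff T (a \<odot>\<^bsub>koszul T (Suc n)\<^esub> F) A R x = (a \<odot>\<^bsub>koszul T n\<^esub> kdiff T F) A R x"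
      by (simp add: kdiff_def koszul_simps sum_distrib_left)
  qed
qed (simp add: kdiff_def koszul_simps fun_eq_iff algebra_simps sum.distrib)

text \<open>Halves of the double sum are matched by exchanging the two removed elements; dividing
  by two is not possible in characteristic two.\<close>

lemma kdiff_kdiff:
  fixes F :: "'p::{finite,order} set \<Rightarrow> 'p set \<Rightarrow> 'p \<Rightarrow> 'k::field"
  shows "kdiff T (kdiff T F) A R x = 0"
proof -
  let ?M = "minimal_elements T - A"
  let ?f = "\<lambda>(m, n). ksign m A * (ksign n (insert m A) * F (insert n (insert m A)) R x)"
  let ?L = "{(m, n). m \<in> ?M \<and> n \<in> ?M \<and> elem_rank m < elem_rank n}"
  let ?G = "{(m, n). m \<in> ?M \<and> n \<in> ?M \<and> elem_rank n < elem_rank m}"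
  have "kdiff T (kdiff T F) A R x = (\<Sum>m\<in>?M. \<Sum>n\<in>?M - {m}. ?f (m, n))"
    unfolding kdiff_def sum_distrib_left by (intro sum.cong) auto
  also have "\<dots> = (\<Sum>q\<in>Sigma ?M (\<lambda>m. ?M - {m}). ?f q)"
    by (subst sum.Sigma) auto
  also have "Sigma ?M (\<lambda>m. ?M - {m}) = ?L \<union> ?G"
  proof (rule Set.set_eqI)
    fix q :: "'p \<times> 'p"
    have "fst q \<noteq> snd q \<longleftrightarrow> elem_rank (fst q) < elem_rank (snd q) \<or> elem_rank (snd q) < elem_rank (fst q)"
      using injD[OF inj_elem_rank, of "fst q" "snd q"]
      by (cases "elem_rank (fst q)" "elem_rank (snd q)" rule: linorder_cases) auto
    then show "q \<in> Sigma ?M (\<lambda>m. ?M - {m}) \<longleftrightarrow> q \<in> ?L \<union> ?G" by (cases q) auto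
  qed
  also have "(\<Sum>q\<in>?L \<union> ?G. ?f q) = (\<Sum>q\<in>?L. ?f q) + (\<Sum>q\<in>?G. ?f q)"
    by (rule sum.union_disjoint) auto
  also have "(\<Sum>q\<in>?G. ?f q) = (\<Sum>q\<in>?L. ?f (prod.swap q))"
    by (rule sum.reindex_bij_witness[of _ prod.swap prod.swap]) auto
  also have "\<dots> = (\<Sum>q\<in>?L. - ?f q)"
  proof (rule sum.cong[OF refl])
    fix q assume "q \<in> ?L"
    then obtain m n where q: "q = (m, n)" "m \<notin> A" "n \<notin> A" "m \<noteq> n" by auto
    then show "?f (prod.swap q) = - ?f q"
      using ksign_swap(2)[of n m A, where 'k = 'k] by (simp add: insert_commute[of m n] flip: mult.assoc)
  qed
  finally show ?thesis by (simp add: sum_negf)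
qed

subsection \<open>Exactness\<close>

text \<open>Depends on \<open>x\<close> only through its component in \<open>R \<inter> T\<close>,
  so comparable points there get the same element and \<open>khomotopy\<close> stays
  natural.\<close>

definition avoided_minimal :: "'p::order set \<Rightarrow> 'p set \<Rightarrow> 'p \<Rightarrow> 'p" where
  "avoided_minimal T R x = (SOME m. m \<in> minimal_elements T - component_of (R \<inter> T) x)"

text \<open>Where the component of \<open>x\<close> in \<open>R \<inter> T\<close> misses a minimal element \<open>m\<close> of \<open>T\<close>, the complex at
  \<open>x\<close> is a cone with apex \<open>m\<close>.\<close>

definition khomotopy ::
  "'p::{finite,order} set \<Rightarrow> ('p set \<Rightarrow> 'p set \<Rightarrow> 'p \<Rightarrow> 'k::field) \<Rightarrow> 'p set \<Rightarrow> 'p set \<Rightarrow> 'p \<Rightarrow> 'k" where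
  "khomotopy T F A R x = (let m = avoided_minimal T R x in
     if x \<in> R \<inter> T \<and> \<not> minimal_elements T \<subseteq> component_of (R \<inter> T) x \<and> m \<in> A
     then ksign m (A - {m}) * F (A - {m}) R x else 0)"

lemma avoided_minimal:
  assumes "\<not> minimal_elements T \<subseteq> component_of (R \<inter> T) x"
  shows "avoided_minimal T R x \<in> minimal_elements T" "avoided_minimal T R x \<notin> component_of (R \<inter> T) x"
proof -
  have "\<exists>m. m \<in> minimal_elements T - component_of (R \<inter> T) x" using assms by blast
  then have "avoided_minimal T R x \<in> minimal_elements T - component_of (R \<inter> T) x"
    unfolding avoided_minimal_def by (rule someI_ex)
  then show "avoided_minimal T R x \<in> minimal_elements T" "avoided_minimal T R x \<notin> component_of (R \<inter> T) x"
    by auto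
qed

lemma component_of_connected: "x \<in> U \<Longrightarrow> poset_convex U \<Longrightarrow> poset_connected (component_of U x)"
  using components_intervals[OF _ component_of_mem] by (auto simp: intervals_def)

text \<open>A nonzero value at \<open>x\<close> spreads over its component, thus to all minimal
  elements of \<open>T\<close>, and from there upwards to all of \<open>T\<close>, so that
  \<open>T\<close> would be contained in \<open>R\<close>.\<close>

lemma hom_fun_zero_at:
  fixes T :: "'p::{finite,order} set"
  assumes T: "T \<in> intervals" and R: "R \<in> intervals" and c: "c \<in> hom_fun R T" and "\<not> T \<subseteq> R"
    and x: "x \<in> R \<inter> T" and sub: "minimal_elements T \<subseteq> component_of (R \<inter> T) x"
  shows "c x = 0"
proof (rule ccontr)
  assume nz: "c x \<noteq> 0"
  have conv: "poset_convex (R \<inter> T)"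
    using intervals_convex[OF T] intervals_convex[OF R] unfolding poset_convex_def by blast
  have cs: "component_of (R \<inter> T) x \<subseteq> R \<inter> T" by (rule component_of_subset[OF x])
  have "T \<subseteq> R"
  proof
    fix t assume t: "t \<in> T"
    then obtain m where m: "m \<in> minimal_elements T" "m \<le> t" using exists_minimal_below by blast
    then have mc: "m \<in> component_of (R \<inter> T) x" using sub by blast
    have "c m = c x"
      using hom_fun_const[OF c component_of_connected[OF x conv] _ _ mc component_of_self] cs by blast
    moreover have "c m = c t" using hom_fun_eq[OF c _ t m(2)] mc cs by blast
    ultimately show "t \<in> R" using nz hom_fun_supp[OF c, of t] by metis
  qed
  then show False using assms(4) by simp
qed

lemma khomotopy_closed:
  fixes T :: "'p::{finite,order} set" and F :: "'p set \<Rightarrow> 'p set \<Rightarrow> 'p \<Rightarrow> 'k::field"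
  assumes F: "F \<in> carrier (koszul T n :: (('k, 'p) interval_endo, _) module)"
  shows "khomotopy T F \<in> carrier (koszul T (Suc n) :: (('k, 'p) interval_endo, _) module)"
  unfolding koszul_iff
proof (intro conjI allI impI)
  fix A R x
  show "khomotopy T F A R \<in> hom_fun R (T - A)"
  proof (rule hom_funI)
    fix x assume x: "x \<notin> R \<or> x \<notin> T - A"
    show "khomotopy T F A R x = 0"
    proof (rule ccontr)
      let ?m = "avoided_minimal T R x"
      assume "khomotopy T F A R x \<noteq> 0"
      then have *: "x \<in> R \<inter> T" "\<not> minimal_elements T \<subseteq> component_of (R \<inter> T) x" "F (A - {?m}) R x \<noteq> 0"
        by (auto simp: khomotopy_def Let_def split: if_splits)
      \<comment> \<open>The only doubtful case is a point removed by \<open>A\<close> but not by the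
        smaller set, that is, the avoided element itself. It cannot be \<open>x\<close>, because it
        is outside the component of \<open>x\<close>.\<close>
      then have "x \<in> A" "x \<notin> A - {?m}"
        using x hom_fun_supp[OF koszul_hom_fun[OF F], of x R "A - {?m}"] by auto
      then have "x = ?m" by auto
      then show False using avoided_minimal(2)[OF *(2)] component_of_self[of x "R \<inter> T"] by simp
    qed
  next
    fix x y assume xy: "x \<in> R" "y \<in> T - A" "x \<le> y"
    have eq: "F (A - {m}) R x = F (A - {m}) R y" for m
      using hom_fun_eq[OF koszul_hom_fun[OF F] xy(1) _ xy(3)] xy(2) by blast
    have s: "F (A - {m}) R z = 0" if "z \<notin> R \<inter> T" for z m
      using that hom_fun_supp[OF koszul_hom_fun[OF F], of z R "A - {m}"] by auto
    show "khomotopy T F A R x = khomotopy T F A R y"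
    proof (cases "x \<in> R \<inter> T \<and> y \<in> R \<inter> T")
      case True
      then have "component_of (R \<inter> T) y = component_of (R \<inter> T) x"
        using component_of_comparable[of x "R \<inter> T" y] xy(3) by blast
      then show ?thesis using True eq by (simp add: khomotopy_def Let_def avoided_minimal_def)
    next
      case False
      then have "F (A - {m}) R x = 0" "F (A - {m}) R y = 0" for m
        using eq[of m] s[of x m] s[of y m] by auto
      then show ?thesis by (simp add: khomotopy_def Let_def)
    qed
  qed
  let ?m = "avoided_minimal T R x"
  show "khomotopy T F A R x = 0" if 1: "A \<notin> kidx T (Suc n) \<or> R \<notin> intervals"
  proof (rule ccontr)
    assume "khomotopy T F A R x \<noteq> 0"
    then have *: "\<not> minimal_elements T \<subseteq> component_of (R \<inter> T) x" "?m \<in> A" "F (A - {?m}) R x \<noteq> 0"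
      by (auto simp: khomotopy_def Let_def split: if_splits)
    then have "A - {?m} \<in> kidx T n" "R \<in> intervals" using koszul_zero[OF F] by blast+
    then have "A \<in> kidx T (Suc n)"
      using kidx_insert[of ?m T "A - {?m}" n] avoided_minimal(1)[OF *(1)] *(2) by (simp add: insert_absorb)
    with 1 \<open>R \<in> intervals\<close> show False by simp
  qed
qed

text \<open>Any element of \<open>A\<close> is a point of \<open>T\<close> at which the entry
  vanishes, and for \<open>T \<subseteq> R\<close> one zero on \<open>T\<close> suffices.\<close>

lemma koszul_zero_above:
  fixes T :: "'p::{finite,order} set" and F :: "'p set \<Rightarrow> 'p set \<Rightarrow> 'p \<Rightarrow> 'k::field"
  assumes T: "T \<in> intervals" and F: "F \<in> carrier (koszul T n :: (('k, 'p) interval_endo, _) module)"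
    and "A \<noteq> {}" "T \<subseteq> R"
  shows "F A R x = 0"
proof (cases "A \<in> kidx T n")
  case True
  obtain m where m: "m \<in> A" using \<open>A \<noteq> {}\<close> by blast
  then have "m \<in> T" using True minimal_elements_subset by (auto simp: kidx_def)
  moreover have "F A R m = 0" using hom_fun_supp[OF koszul_hom_fun[OF F], of m R A] m by simp
  ultimately show ?thesis
    using hom_fun_vanish[OF intervals_connected[OF T] koszul_hom_fun_T[OF F] \<open>T \<subseteq> R\<close>] by blast
qed (use koszul_zero[OF F] in blast)

text \<open>The identity d h + h d = id on cycles. The cycle condition sits in \<open>above\<close>
  in degree 0 and in \<open>cyc\<close> in positive degrees, so one proof covers both; writing
  \<open>A - {m}\<close> avoids a predecessor of \<open>n\<close>.\<close>

lemma kdiff_khomotopy: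
  fixes T :: "'p::{finite,order} set" and F :: "'p set \<Rightarrow> 'p set \<Rightarrow> 'p \<Rightarrow> 'k::field"
  assumes T: "T \<in> intervals" and F: "F \<in> carrier (koszul T n :: (('k, 'p) interval_endo, _) module)"
    and above: "\<And>R x. T \<subseteq> R \<Longrightarrow> F {} R x = 0"
    and cyc: "\<And>m A R x. m \<in> A \<Longrightarrow> A \<in> kidx T n \<Longrightarrow> kdiff T F (A - {m}) R x = 0"
  shows "kdiff T (khomotopy T F) = F"
proof (intro ext)
  fix A R x
  let ?m = "avoided_minimal T R x"
  let ?P = "x \<in> R \<inter> T \<and> \<not> minimal_elements T \<subseteq> component_of (R \<inter> T) x"
  show "kdiff T (khomotopy T F) A R x = F A R x"
  proof (cases "?P \<and> A \<in> kidx T n \<and> R \<in> intervals")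
    case False
    have sub: "minimal_elements T \<subseteq> T" by (rule minimal_elements_subset)
    \<comment> \<open>Where the component contains all minimal elements there is no cone, but
      \<open>F\<close> itself vanishes: by \<open>above\<close> and \<open>koszul_zero_above\<close>
      if \<open>T \<subseteq> R\<close>, and by \<open>hom_fun_zero_at\<close> otherwise.\<close>
    have "F A' R x = 0" if "\<not> ?P \<or> R \<notin> intervals" for A'
    proof (cases "x \<in> R \<inter> T \<and> R \<in> intervals")
      case True
      then have *: "minimal_elements T \<subseteq> component_of (R \<inter> T) x" using that by blast
      show ?thesis
      proof (cases "T \<subseteq> R")
        case True
        then show ?thesis using above koszul_zero_above[OF T F] by (cases "A' = {}") auto
      next
        case F': False
        then show ?thesis using hom_fun_zero_at[OF T _ koszul_hom_fun_T[OF F] F' _ *] True by blast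
      qed
    next
      case False
      then show ?thesis using koszul_zero[OF F] hom_fun_supp[OF koszul_hom_fun_T[OF F], of x R] by auto
    qed
    moreover have "kdiff T (khomotopy T F) A R x = 0"
    proof (cases "A \<in> kidx T n \<and> R \<in> intervals")
      case True
      with False have "\<not> ?P" by blast
      then have "khomotopy T F A' R x = 0" for A' by (auto simp: khomotopy_def Let_def)
      then show ?thesis by (simp add: kdiff_def)
    next
      case False
      then show ?thesis
        using koszul_zero[OF lin_map_closed[OF lin_map_kdiff khomotopy_closed[OF F]]] by blast
    qed
    ultimately show ?thesis using False koszul_zero[OF F] by (cases "A \<in> kidx T n") auto
  next
    case True
    then have P: ?P and A: "A \<in> kidx T n" by auto
    note m = avoided_minimal[OF conjunct2[OF P]]
    have h: "khomotopy T F A' R x = (if ?m \<in> A' then ksign ?m (A' - {?m}) * F (A' - {?m}) R x else 0)" for A'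
      using P by (simp add: khomotopy_def Let_def)
    show ?thesis
    proof (cases "?m \<in> A")
      case False
      have "kdiff T (khomotopy T F) A R x =
          (\<Sum>m\<in>minimal_elements T - A. if m = ?m then ksign ?m A * (ksign ?m A * F A R x) else 0)"
        unfolding kdiff_def h using False by (intro sum.cong) auto
      also have "\<dots> = F A R x" using False m(1) by (simp add: ksign_square_mult)
      finally show ?thesis .
    next
      case True
      define B where "B = A - {?m}"
      have B: "?m \<notin> B" "A = insert ?m B" using True by (auto simp: B_def)
      let ?N = "minimal_elements T - A"
      have MB: "minimal_elements T - B = insert ?m ?N" using m(1) B by auto
      \<comment> \<open>The cycle condition at \<open>A\<close> without the apex expresses
        \<open>F A\<close> by the sets with one element exchanged for the apex; these are the terms
        that the homotopy produces.\<close>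
      have "0 = kdiff T F B R x" using cyc[OF True A] by (simp add: B_def)
      also have "\<dots> = ksign ?m B * F A R x + (\<Sum>n\<in>?N. ksign n B * F (insert n B) R x)"
        unfolding kdiff_def MB using True by (subst sum.insert) (auto simp: B(2))
      finally have 1: "(\<Sum>n\<in>?N. ksign n B * F (insert n B) R x) = - (ksign ?m B * F A R x)"
        by (simp add: eq_neg_iff_add_eq_0 add.commute)
      have "kdiff T (khomotopy T F) A R x =
          (\<Sum>n\<in>?N. - ksign ?m B * (ksign n B * F (insert n B) R x))"
        unfolding kdiff_def h
      proof (rule sum.cong[OF refl])
        fix n assume n: "n \<in> ?N"
        then have nm: "n \<noteq> ?m" "n \<notin> B" using True by (auto simp: B_def)
        then have i: "insert n A - {?m} = insert n B" using B by auto
        show "ksign n A * (if ?m \<in> insert n A then ksign ?m (insert n A - {?m}) *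
            F (insert n A - {?m}) R x else 0) = - ksign ?m B * (ksign n B * F (insert n B) R x)"
        proof -
          have "ksign n A * ksign ?m (insert n B) = - (ksign n B * ksign ?m B :: 'k)"
            unfolding B(2) using nm B by (intro ksign_swap(1)) auto
          then have "ksign n A * (ksign ?m (insert n B) * F (insert n B) R x) =
              - (ksign n B * ksign ?m B) * F (insert n B) R x"
            by (simp only: mult.assoc[symmetric])
          then show ?thesis unfolding i using True by (simp add: mult.assoc mult.left_commute)
        qed
      qed
      also have "\<dots> = - ksign ?m B * (\<Sum>n\<in>?N. ksign n B * F (insert n B) R x)"
        by (simp add: sum_distrib_left)
      also have "\<dots> = F A R x" unfolding 1 by (simp add: ksign_square_mult)
      finally show ?thesis .
    qed
  qed
qed

subsection \<open>Projectivity\<close>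

text \<open>The splitting of the entry at \<open>A\<close> along the components of
  \<open>T - A\<close>, read as a matrix and hence as an element of the algebra.\<close>

definition kpart ::
  "'p::{finite,order} set \<Rightarrow> ('p set \<Rightarrow> 'p set \<Rightarrow> 'p \<Rightarrow> 'k::field) \<Rightarrow> 'p set \<Rightarrow> 'p set \<Rightarrow> 'p set \<Rightarrow> 'p \<Rightarrow> 'k" where
  "kpart T F A R S x = (if S \<in> components (T - A) \<and> x \<in> S then F A R x else 0)"

lemma is_mat_kpart:
  fixes T :: "'p::{finite,order} set" and F :: "'p set \<Rightarrow> 'p set \<Rightarrow> 'p \<Rightarrow> 'k::field"
  assumes T: "T \<in> intervals" and F: "F \<in> carrier (koszul T n :: (('k, 'p) interval_endo, _) module)"
  shows "is_mat (kpart T F A)"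
  unfolding is_mat_def
proof (intro conjI allI impI)
  fix R S x
  show "kpart T F A R S \<in> hom_fun R S"
  proof (cases "S \<in> components (T - A)")
    case True
    then show ?thesis
      using hom_fun_component_restrict[OF koszul_hom_fun[OF F] True] by (simp add: kpart_def[abs_def])
  next
    case False
    then show ?thesis by (simp add: kpart_def[abs_def] hom_fun_zero)
  qed
  show "kpart T F A R S x = 0" if "R \<notin> intervals \<or> S \<notin> intervals"
  proof (cases "A \<in> kidx T n \<and> R \<in> intervals")
    case True
    then have "S \<notin> components (T - A)"
      using that components_intervals[OF convex_Diff_minimal[OF intervals_convex[OF T]], of A S]
      by (auto simp: kidx_def)
    then show ?thesis by (simp add: kpart_def)
  next
    case False
    then show ?thesis using koszul_zero[OF F] by (auto simp: kpart_def)
  qed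
qed

text \<open>The free module has one coordinate for each subset \<open>A\<close> of the poset. The
  embedding stores there the splitting \<open>kpart\<close>, and summing over the components of
  \<open>T - A\<close> retracts it; coordinates outside \<open>kidx T n\<close> are discarded by
  \<open>q\<close>.\<close>

lemma fg_projective_koszul:
  fixes T :: "'p::{finite,order} set"
  assumes T: "T \<in> intervals"
  shows "fg_projective \<Lambda> (koszul T n :: (('k::field, 'p) interval_endo, _) module)"
proof -
  let ?K = "koszul T n :: (('k, 'p) interval_endo, _) module"
  let ?N = "card (UNIV :: 'p set set)"
  let ?F = "free_module (\<Lambda> :: ('k, ('k, 'p) interval_endo) module) ?N"
  obtain idx where idx: "bij_betw idx {0..<?N} (UNIV :: 'p set set)"
    using ex_bij_betw_nat_finite[of "UNIV :: 'p set set"] by auto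
  define pos where "pos = inv_into {0..<?N} idx"
  have pos: "pos A < ?N" "idx (pos A) = A" for A
    using bij_betw_inv_into_right[OF idx, of A] bij_betwE[OF bij_betw_inv_into[OF idx]]
    by (auto simp: pos_def)
  define i where "i F = (\<lambda>j\<in>{..<?N}. of_mat (kpart T F (idx j)))"
    for F :: "'p set \<Rightarrow> 'p set \<Rightarrow> 'p \<Rightarrow> 'k"
  define q where "q v = (\<lambda>A R x. if A \<in> kidx T n
    then (\<Sum>S\<in>UNIV. if S \<in> components (T - A) then coord (v (pos A)) R S x else 0) else 0)"
    for v :: "nat \<Rightarrow> ('k, 'p) interval_endo"
  note mat = is_mat_kpart[OF T]
  have cK: "coord (of_mat (kpart T F A)) = kpart T F A" if "F \<in> carrier ?K" for F A
    by (rule coord_of_mat[OF mat[OF that]])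
  have mc: "of_mat (kpart T F A) \<in> carrier \<Lambda>" if "F \<in> carrier ?K" for F A
    by (rule of_mat_closed[OF mat[OF that]])
  interpret K: left_module "\<Lambda> :: ('k, ('k, 'p) interval_endo) module" ?K by (rule left_module_koszul)
  have li: "lin_map \<Lambda> ?K ?F i"
  proof (rule lin_mapI)
    fix F G a assume F: "F \<in> carrier ?K"
    show "i F \<in> carrier ?F" by (auto simp: i_def free_module_simps mc[OF F])
    show "i (F \<oplus>\<^bsub>?K\<^esub> G) = i F \<oplus>\<^bsub>?F\<^esub> i G" if G: "G \<in> carrier ?K"
    proof -
      have "of_mat (kpart T (F \<oplus>\<^bsub>?K\<^esub> G) A) = of_mat (kpart T F A) \<oplus>\<^bsub>\<Lambda>\<^esub> of_mat (kpart T G A)" for A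
        using F G K.M.a_closed[OF F G]
        by (intro coord_inj) (auto simp: mc cK fun_eq_iff coord_add kpart_def koszul_simps)
      then show ?thesis by (auto simp: i_def free_module_simps fun_eq_iff)
    qed
    show "i (a \<odot>\<^bsub>?K\<^esub> F) = a \<odot>\<^bsub>?F\<^esub> i F" if a: "a \<in> carrier \<Lambda>"
    proof -
      have "of_mat (kpart T (a \<odot>\<^bsub>?K\<^esub> F) A) = a \<otimes>\<^bsub>\<Lambda>\<^esub> of_mat (kpart T F A)" for A
        using F a K.smult_closed[OF a F]
        by (intro coord_inj) (auto simp: mc cK fun_eq_iff coord_mult kpart_def koszul_simps)
      then show ?thesis by (auto simp: i_def free_module_simps fun_eq_iff)
    qed
  qed
  have vc: "v (pos A) \<in> carrier \<Lambda>" if "v \<in> carrier ?F" for v A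
    using that pos(1)[of A] by (auto simp: free_module_simps)
  have lq: "lin_map \<Lambda> ?F ?K q"
  proof (rule lin_mapI)
    fix v w a assume v: "v \<in> carrier ?F"
    show "q v \<in> carrier ?K"
      unfolding koszul_iff
    proof (intro conjI allI impI)
      fix A R x
      have "(\<lambda>x. if S \<in> components (T - A) then coord (v (pos A)) R S x else 0) \<in> hom_fun R (T - A)" for S
        using hom_fun_component_mono[OF coord_hom_fun[OF vc[OF v]]] hom_fun_zero
        by (cases "S \<in> components (T - A)") auto
      then have "(\<lambda>x. \<Sum>S\<in>UNIV. if S \<in> components (T - A) then coord (v (pos A)) R S x else 0) \<in> hom_fun R (T - A)"
        by (rule hom_fun_sum)
      then show "q v A R \<in> hom_fun R (T - A)" 
        by (cases "A \<in> kidx T n") (simp_all add: q_def hom_fun_zero)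
      show "q v A R x = 0" if "A \<notin> kidx T n \<or> R \<notin> intervals"
        using that coord_zero[OF vc[OF v], of R x A] by (auto simp: q_def intro!: sum.neutral)
    qed
    show "q (v \<oplus>\<^bsub>?F\<^esub> w) = q v \<oplus>\<^bsub>?K\<^esub> q w" if w: "w \<in> carrier ?F"
      using pos(1)
      by (auto simp: q_def free_module_simps koszul_simps fun_eq_iff coord_add simp flip: sum.distrib
          intro!: sum.cong)
    show "q (a \<odot>\<^bsub>?F\<^esub> v) = a \<odot>\<^bsub>?K\<^esub> q v" if a: "a \<in> carrier \<Lambda>"
    proof (intro ext)
      fix A R x
      show "q (a \<odot>\<^bsub>?F\<^esub> v) A R x = (a \<odot>\<^bsub>?K\<^esub> q v) A R x"
      proof (cases "A \<in> kidx T n")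
        case True
        have "q (a \<odot>\<^bsub>?F\<^esub> v) A R x = (\<Sum>S\<in>UNIV. \<Sum>U\<in>UNIV. if S \<in> components (T - A)
            then coord a R U x * coord (v (pos A)) U S x else 0)"
          using True pos(1) by (auto simp: q_def free_module_simps coord_mult[OF a vc[OF v]] intro!: sum.cong)
        also have "\<dots> = (\<Sum>U\<in>UNIV. \<Sum>S\<in>UNIV. if S \<in> components (T - A)
            then coord a R U x * coord (v (pos A)) U S x else 0)"
          by (rule sum.swap)
        also have "\<dots> = (a \<odot>\<^bsub>?K\<^esub> q v) A R x"
          using True by (auto simp: koszul_simps q_def sum_distrib_left if_distrib intro!: sum.cong)
        finally show ?thesis .
      qed (simp add: q_def koszul_simps)
    qed
  qed
  have qi: "q (i F) = F" if F: "F \<in> carrier ?K" for F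
  proof (intro ext)
    fix A R x
    show "q (i F) A R x = F A R x"
    proof (cases "A \<in> kidx T n")
      case True
      have "q (i F) A R x = (\<Sum>S\<in>UNIV. if S \<in> components (T - A) \<and> x \<in> S then F A R x else 0)"
        using True pos by (auto simp: q_def i_def cK[OF F] kpart_def intro!: sum.cong)
      also have "\<dots> = F A R x"
        using hom_fun_supp[OF koszul_hom_fun[OF F], of x R A] by (intro sum_components) auto
      finally show ?thesis .
    qed (use koszul_zero[OF F] in \<open>auto simp: q_def\<close>)
  qed
  interpret FF: left_module "\<Lambda> :: ('k, ('k, 'p) interval_endo) module" ?F
    by (rule left_module_free_module[OF ring_interval_algebra])
  have mh: "restrict i (carrier ?K) \<in> mod_hom \<Lambda> ?K ?F" "restrict q (carrier ?F) \<in> mod_hom \<Lambda> ?F ?K"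
    using lin_map_cong[OF K.left_module_axioms li, of "restrict i (carrier ?K)"]
      lin_map_cong[OF FF.left_module_axioms lq, of "restrict q (carrier ?F)"]
    by (auto simp: mod_hom_iff)
  have "restrict q (carrier ?F) (restrict i (carrier ?K) F) = F" if "F \<in> carrier ?K" for F
    using that qi lin_map_closed[OF li] by simp
  then show ?thesis
    unfolding fg_projective_def
    by (intro conjI K.left_module_axioms exI[of _ ?N] bexI[OF _ mh(1)] bexI[OF _ mh(2)] ballI)
qed

subsection \<open>The resolution\<close>

definition kaug ::
  "'p::{finite,order} set \<Rightarrow> ('p set \<Rightarrow> 'p set \<Rightarrow> 'p \<Rightarrow> 'k::field) \<Rightarrow> ('k, 'p) interval_endo" where
  "kaug T F = of_mat (\<lambda>R Q x. if Q = T then F {} R x else 0)"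

context
  fixes T :: "'p::{finite,order} set"
  assumes T: "T \<in> intervals"
begin

lemma kidx_0: "kidx T 0 = {{}}"
  by (auto simp: kidx_def)

lemma coord_kaug:
  fixes F :: "'p set \<Rightarrow> 'p set \<Rightarrow> 'p \<Rightarrow> 'k::field"
  assumes F: "F \<in> carrier (koszul T 0 :: (('k, 'p) interval_endo, _) module)"
  shows "kaug T F \<in> carrier \<Lambda>" "coord (kaug T F) R Q x = (if Q = T then F {} R x else 0)"
    "kaug T F \<in> carrier (proj_module T)"
proof -
  have m: "is_mat (\<lambda>R Q x. if Q = T then F {} R x else 0)"
    unfolding is_mat_def
  proof (intro conjI allI impI)
    fix R Q x
    show "(\<lambda>x. if Q = T then F {} R x else 0) \<in> hom_fun R Q"
      using koszul_hom_fun_T[OF F, of "{}" R] hom_fun_zero by (cases "Q = T") auto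
    show "(if Q = T then F {} R x else 0) = 0" if "R \<notin> intervals \<or> Q \<notin> intervals"
      using that T koszul_zero[OF F, of "{}" R x] by auto
  qed
  show "kaug T F \<in> carrier \<Lambda>" "coord (kaug T F) R Q x = (if Q = T then F {} R x else 0)" for R Q x
    unfolding kaug_def by (rule of_mat_closed[OF m]) (simp add: coord_of_mat[OF m])
  then show "kaug T F \<in> carrier (proj_module T)" by (simp add: proj_module_iff[OF T])
qed

lemma lin_map_kaug: "lin_map \<Lambda> (koszul T 0) (proj_module T) (kaug T :: _ \<Rightarrow> ('k::field, 'p) interval_endo)"
proof -
  interpret K: left_module "\<Lambda> :: ('k, ('k, 'p) interval_endo) module" "koszul T 0" by (rule left_module_koszul)
  note s = proj_module_simps[OF T]
  show ?thesis
  proof (rule lin_mapI; (unfold s)?)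
    fix F G :: "'p set \<Rightarrow> 'p set \<Rightarrow> 'p \<Rightarrow> 'k" and a :: "('k, 'p) interval_endo"
    assume F: "F \<in> carrier (koszul T 0 :: (('k, 'p) interval_endo, _) module)"
    show "kaug T F \<in> carrier (proj_module T)" by (rule coord_kaug[OF F])
    show "kaug T (F \<oplus>\<^bsub>koszul T 0 :: (('k, 'p) interval_endo, _) module\<^esub> G) = kaug T F \<oplus>\<^bsub>\<Lambda>\<^esub> kaug T G"
      if G: "G \<in> carrier (koszul T 0 :: (('k, 'p) interval_endo, _) module)"
      using coord_kaug[OF F] coord_kaug[OF G] coord_kaug[OF K.M.a_closed[OF F G]]
      by (intro coord_inj) (auto simp: fun_eq_iff coord_add koszul_simps)
    show "kaug T (a \<odot>\<^bsub>koszul T 0\<^esub> F) = a \<otimes>\<^bsub>\<Lambda>\<^esub> kaug T F" if a: "a \<in> carrier \<Lambda>"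
      using coord_kaug[OF F] coord_kaug[OF K.smult_closed[OF a F]] a
      by (intro coord_inj) (auto simp: fun_eq_iff coord_mult koszul_simps)
  qed
qed

lemma kaug_surj:
  "(kaug T :: _ \<Rightarrow> ('k::field, 'p) interval_endo) ` carrier (koszul T 0 :: (('k, 'p) interval_endo, _) module)
    = carrier (proj_module T)"
proof
  show "(kaug T :: _ \<Rightarrow> ('k, 'p) interval_endo) ` carrier (koszul T 0 :: (('k, 'p) interval_endo, _) module)
    \<subseteq> carrier (proj_module T)" using coord_kaug(3) by blast
  show "carrier (proj_module T) \<subseteq>
    (kaug T :: _ \<Rightarrow> ('k, 'p) interval_endo) ` carrier (koszul T 0 :: (('k, 'p) interval_endo, _) module)"
  proof
    fix a :: "('k, 'p) interval_endo" assume "a \<in> carrier (proj_module T)"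
    then have a: "a \<in> carrier \<Lambda>" "\<And>R Q x. Q \<noteq> T \<Longrightarrow> coord a R Q x = 0" by (auto simp: proj_module_iff[OF T])
    let ?F = "\<lambda>A R x. if A = {} then coord a R T x else 0"
    have F: "?F \<in> carrier (koszul T 0 :: (('k, 'p) interval_endo, _) module)"
      unfolding koszul_iff
    proof (intro conjI allI impI)
      fix A R x
      show "(\<lambda>x. if A = {} then coord a R T x else 0) \<in> hom_fun R (T - A)"
        using coord_hom_fun[OF a(1), of R T] hom_fun_zero by (cases "A = {}") auto
      show "(if A = {} then coord a R T x else 0) = 0" if "A \<notin> kidx T 0 \<or> R \<notin> intervals"
        using that coord_zero[OF a(1), of R x T] by (auto simp: kidx_0)
    qed
    have "a = kaug T ?F"
      using coord_kaug[OF F] a by (intro coord_inj) (auto simp: fun_eq_iff)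
    then show "a \<in> kaug T ` carrier (koszul T 0 :: (('k, 'p) interval_endo, _) module)" using F by blast
  qed
qed

lemma kaug_in_std_kernel:
  fixes F :: "'p set \<Rightarrow> 'p set \<Rightarrow> 'p \<Rightarrow> 'k::field"
  assumes F: "F \<in> carrier (koszul T 0 :: (('k, 'p) interval_endo, _) module)"
  shows "kaug T F \<in> std_kernel T \<longleftrightarrow> (\<forall>R x. T \<subseteq> R \<longrightarrow> F {} R x = 0)"
  using coord_kaug[OF F] by (auto simp: std_kernel_def)

text \<open>Exactness comes from \<open>kdiff_khomotopy\<close>: a cycle is the boundary of its own
  cone. The differentials are quantified because module homomorphisms are extensional, whereas
  \<open>kdiff\<close> is defined on all families.\<close>

lemma koszul_resolution:
  "\<exists>d e. projective_resolution \<Lambda> (standard_module T)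
     (koszul T :: nat \<Rightarrow> (('k::field, 'p) interval_endo, _) module) d e \<and>
     (\<forall>n. \<forall>F\<in>carrier (koszul T (Suc n) :: (('k, 'p) interval_endo, _) module). d n F = kdiff T F)"
proof -
  let ?K = "koszul T :: nat \<Rightarrow> (('k, 'p) interval_endo, _) module"
  let ?P = "proj_module T :: (('k, 'p) interval_endo, _) module"
  let ?U = "std_kernel T :: ('k, 'p) interval_endo set"
  let ?M = "quotient_module ?P ?U"
  define d where "d n = restrict (kdiff T) (carrier (?K (Suc n)))" for n
  define e where "e = (\<lambda>F\<in>carrier (?K 0). ?U +>\<^bsub>?P\<^esub> kaug T F)"
  note lP = left_module_proj_module[OF T] and sU = submodule_std_kernel[OF T]
  note lK = left_module_koszul[of T]
  have d: "d n F = kdiff T F" if "F \<in> carrier (?K (Suc n))" for n F using that by (simp add: d_def)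
  have e: "e F = ?U +>\<^bsub>?P\<^esub> kaug T F" if "F \<in> carrier (?K 0)" for F using that by (simp add: e_def)
  have e0: "e F = \<zero>\<^bsub>?M\<^esub> \<longleftrightarrow> (\<forall>R x. T \<subseteq> R \<longrightarrow> F {} R x = 0)" if F: "F \<in> carrier (?K 0)" for F
    using quotient_eq_zero_iff[OF lP sU coord_kaug(3)[OF F]] kaug_in_std_kernel[OF F]
    by (simp add: e[OF F] quotient_module_simps)
  have dim: "d n ` carrier (?K (Suc n)) = kdiff T ` carrier (?K (Suc n))" for n
    using d by (intro image_cong) auto
  have dh: "d n \<in> mod_hom \<Lambda> (?K (Suc n)) (?K n)" for n
    using lin_map_cong[OF lK lin_map_kdiff, of n "d n"] d by (simp add: mod_hom_iff d_def)
  have eh: "e \<in> mod_hom \<Lambda> (?K 0) ?M"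
    using lin_map_cong[OF lK lin_map_compose[OF lin_map_kaug lin_map_quotient[OF lP sU]], of e] e
    by (simp add: mod_hom_iff e_def)
  have eim: "e ` carrier (?K 0) = carrier ?M"
  proof -
    have "e ` carrier (?K 0) = (\<lambda>x. ?U +>\<^bsub>?P\<^esub> x) ` kaug T ` carrier (?K 0)"
      unfolding image_image using e by (intro image_cong) auto
    then show ?thesis by (simp only: kaug_surj carrier_quotient_module)
  qed
  have "kdiff T ` carrier (?K (Suc 0)) = {F \<in> carrier (?K 0). e F = \<zero>\<^bsub>?M\<^esub>}"
  proof (intro equalityI subsetI)
    fix F assume "F \<in> kdiff T ` carrier (?K (Suc 0))"
    then obtain G where G: "G \<in> carrier (?K (Suc 0))" "F = kdiff T G" by blast
    then have F: "F \<in> carrier (?K 0)" using lin_map_closed[OF lin_map_kdiff] by blast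
    have "kdiff T G {} R x = 0" if "T \<subseteq> R" for R x
      unfolding kdiff_def using koszul_zero_above[OF T G(1) _ that] by (intro sum.neutral) auto
    then show "F \<in> {F \<in> carrier (?K 0). e F = \<zero>\<^bsub>?M\<^esub>}" using F e0[OF F] G(2) by simp
  next
    fix F assume "F \<in> {F \<in> carrier (?K 0). e F = \<zero>\<^bsub>?M\<^esub>}"
    then have F: "F \<in> carrier (?K 0)" and z: "\<And>R x. T \<subseteq> R \<Longrightarrow> F {} R x = 0" using e0 by auto
    have "kdiff T (khomotopy T F) = F" by (rule kdiff_khomotopy[OF T F z]) (auto simp: kidx_0)
    then show "F \<in> kdiff T ` carrier (?K (Suc 0))" using khomotopy_closed[OF F] by (metis image_eqI)
  qed
  moreover have "kdiff T ` carrier (?K (Suc (Suc n))) = {F \<in> carrier (?K (Suc n)). d n F = \<zero>\<^bsub>?K n\<^esub>}" for n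
  proof (intro equalityI subsetI)
    fix F assume "F \<in> kdiff T ` carrier (?K (Suc (Suc n)))"
    then obtain G where G: "G \<in> carrier (?K (Suc (Suc n)))" "F = kdiff T G" by blast
    then have F: "F \<in> carrier (?K (Suc n))" using lin_map_closed[OF lin_map_kdiff] by blast
    have "d n F = kdiff T (kdiff T G)" using d[OF F] by (simp only: G(2))
    then have "d n F = \<zero>\<^bsub>?K n\<^esub>" by (simp add: koszul_simps fun_eq_iff kdiff_kdiff)
    with F show "F \<in> {F \<in> carrier (?K (Suc n)). d n F = \<zero>\<^bsub>?K n\<^esub>}" by simp
  next
    fix F assume "F \<in> {F \<in> carrier (?K (Suc n)). d n F = \<zero>\<^bsub>?K n\<^esub>}"
    then have F: "F \<in> carrier (?K (Suc n))" and z: "kdiff T F = (\<lambda>A R x. 0)"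
      using d[of F n] by (auto simp: koszul_simps)
    have "F {} R x = 0" for R x using koszul_zero[OF F, of "{}" R x] by (simp add: kidx_def)
    then have "kdiff T (khomotopy T F) = F" by (intro kdiff_khomotopy[OF T F]) (simp_all add: z)
    then show "F \<in> kdiff T ` carrier (?K (Suc (Suc n)))" using khomotopy_closed[OF F] by (metis image_eqI)
  qed
  ultimately have "projective_resolution \<Lambda> ?M ?K d e"
    unfolding projective_resolution_def One_nat_def dim
    using fg_projective_koszul[OF T] dh eh eim by blast
  then show ?thesis using d unfolding standard_module_eq[OF T] by blast
qed

end

section \<open>Extensions of standard modules by simple modules\<close>

subsection \<open>Maps from the Koszul complex to a simple module\<close>

text \<open>The inclusions of the components of \<open>T - A\<close> into \<open>T - A\<close>,
  taken together; they generate the summand of the complex at \<open>A\<close>.\<close>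

definition kgen :: "'p::order set \<Rightarrow> 'p set \<Rightarrow> 'p set \<Rightarrow> 'p set \<Rightarrow> 'p \<Rightarrow> 'k::field" where
  "kgen T A A' R x = (if A' = A \<and> R \<in> components (T - A) \<and> x \<in> R then 1 else 0)"

text \<open>The indices whose summand contains a copy of P(C) and therefore admits nonzero maps to
  L(C).\<close>

definition kact :: "'p::order set \<Rightarrow> 'p set \<Rightarrow> nat \<Rightarrow> 'p set set" where
  "kact T C n = {A \<in> kidx T n. C \<in> components (T - A)}"

context
  fixes T C :: "'p::{finite,order} set"
  assumes T: "T \<in> intervals" and C: "C \<in> intervals"
begin

lemma kgen_closed:
  assumes A: "A \<in> kidx T n"
  shows "kgen T A \<in> carrier (koszul T n :: (('k::field, 'p) interval_endo, _) module)"
  unfolding koszul_iff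
proof (intro conjI allI impI)
  fix A' R x
  show "(kgen T A A' R :: 'p \<Rightarrow> 'k) \<in> hom_fun R (T - A')"
  proof (cases "A' = A \<and> R \<in> components (T - A)")
    case True
    then have "kgen T A A' R = (\<lambda>x. if x \<in> R then 1 else (0 :: 'k))" by (auto simp: kgen_def fun_eq_iff)
    then show ?thesis using True by (simp add: hom_fun_component_mono[OF hom_fun_id])
  next
    case False
    then have "kgen T A A' R = (\<lambda>x. 0 :: 'k)" by (auto simp: kgen_def fun_eq_iff)
    then show ?thesis by (simp add: hom_fun_zero)
  qed
  show "kgen T A A' R x = 0" if "A' \<notin> kidx T n \<or> R \<notin> intervals"
    using that A components_intervals[OF convex_Diff_minimal[OF intervals_convex[OF T]], of A R]
    by (auto simp: kgen_def kidx_def)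
qed

lemma kgen_point: "A \<in> kact T C n \<Longrightarrow> kgen T A A' C (point C) = (if A' = A then 1 else 0)"
  using point_mem[OF C] by (simp add: kgen_def kact_def)

text \<open>The component of \<open>F\<close> at \<open>A\<close> is \<open>b\<^sub>A \<cdot> kgen T A\<close>, where \<open>b\<^sub>A\<close> collects the restrictions of
  \<open>F A\<close> to the components of \<open>T - A\<close>.\<close>

lemma lin_map_koszul_expand:
  assumes f: "lin_map \<Lambda> (koszul T n) (kmod C :: (('k::field, 'p) interval_endo, 'k) module) f"
    and F: "F \<in> carrier (koszul T n :: (('k, 'p) interval_endo, _) module)"
  shows "f F = (\<Sum>A\<in>kact T C n. F A C (point C) * f (kgen T A))"
proof -
  let ?K = "koszul T n :: (('k, 'p) interval_endo, _) module"
  let ?N = "kmod C :: (('k, 'p) interval_endo, 'k) module"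
  let ?F = "\<lambda>J A R x. if A \<in> J then F A R x else 0"
  note mat = is_mat_kpart[OF T F]
  have FJ: "?F J \<in> carrier ?K" for J
    unfolding koszul_iff
  proof (intro conjI allI impI)
    fix A R x
    show "(\<lambda>x. if A \<in> J then F A R x else 0) \<in> hom_fun R (T - A)"
      using koszul_hom_fun[OF F, of A R] hom_fun_zero by (cases "A \<in> J") auto
    show "(if A \<in> J then F A R x else 0) = 0" if "A \<notin> kidx T n \<or> R \<notin> intervals"
      using koszul_zero[OF F that] by simp
  qed
  have "finite J \<Longrightarrow> J \<subseteq> kidx T n \<Longrightarrow>
    f (?F J) = (\<Sum>A\<in>J. if C \<in> components (T - A) then F A C (point C) * f (kgen T A) else 0)" for J
  proof (induction J rule: finite_induct)
    case empty
    then show ?case using lin_map_zero[OF left_module_koszul left_module_kmod[OF C] f] by (simp add: koszul_simps)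
  next
    case (insert A J)
    let ?b = "of_mat (kpart T F A)"
    have b: "?b \<in> carrier \<Lambda>" by (rule of_mat_closed[OF mat])
    have A: "A \<in> kidx T n" using insert by simp
    note g = kgen_closed[OF A]
    have bg: "(?b \<odot>\<^bsub>?K\<^esub> kgen T A) A' R x = (if A' = A then F A R x else 0)" for A' R x
    proof -
      have "(?b \<odot>\<^bsub>?K\<^esub> kgen T A) A' R x = (\<Sum>U\<in>UNIV. kpart T F A R U x * kgen T A A' U x)"
        by (simp add: koszul_simps coord_of_mat[OF mat])
      also have "\<dots> = (if A' = A then (\<Sum>U\<in>UNIV. if U \<in> components (T - A) \<and> x \<in> U then F A R x else 0) else 0)"
        by (auto simp: kpart_def kgen_def intro!: sum.cong)
      also have "\<dots> = (if A' = A then F A R x else 0)"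
        using hom_fun_supp[OF koszul_hom_fun[OF F], of x R A] by (subst sum_components) auto
      finally show ?thesis .
    qed
    have eq: "?F (insert A J) = ?F J \<oplus>\<^bsub>?K\<^esub> (?b \<odot>\<^bsub>?K\<^esub> kgen T A)"
      unfolding koszul_simps(2) bg using insert(2) by (auto simp: fun_eq_iff)
    have 1: "f (?F (insert A J)) = f (?F J) + coord ?b C C (point C) * f (kgen T A)"
      unfolding eq using lin_map_add[OF f FJ left_module.smult_closed[OF left_module_koszul b g]]
        lin_map_smult[OF f b g] by simp
    have 2: "coord ?b C C (point C) = (if C \<in> components (T - A) then F A C (point C) else 0)"
      using point_mem[OF C] by (simp add: coord_of_mat[OF mat] kpart_def)
    have J: "J \<subseteq> kidx T n" using insert by simp
    show ?case unfolding 1 2 sum.insert[OF insert(1,2)] insert(3)[OF J] by (simp add: add.commute)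
  qed
  from this[of "kidx T n"] have "f (?F (kidx T n)) =
    (\<Sum>A\<in>kidx T n. if C \<in> components (T - A) then F A C (point C) * f (kgen T A) else 0)" by simp
  also have "\<dots> = (\<Sum>A\<in>kact T C n. F A C (point C) * f (kgen T A))"
    unfolding kact_def by (rule sum.inter_filter[symmetric]) simp
  finally have "f (?F (kidx T n)) = (\<Sum>A\<in>kact T C n. F A C (point C) * f (kgen T A))" .
  moreover have "?F (kidx T n) = F" using koszul_zero[OF F] by (auto simp: fun_eq_iff)
  ultimately show ?thesis by (simp only:)
qed

lemma lin_map_koszul_eqI:
  assumes "lin_map \<Lambda> (koszul T n) (kmod C :: (('k::field, 'p) interval_endo, 'k) module) f"
    and "lin_map \<Lambda> (koszul T n) (kmod C :: (('k, 'p) interval_endo, 'k) module) g"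
    and "\<And>A. A \<in> kact T C n \<Longrightarrow> f (kgen T A) = g (kgen T A)"
    and "F \<in> carrier (koszul T n :: (('k, 'p) interval_endo, _) module)"
  shows "f F = g F"
  using assms by (simp add: lin_map_koszul_expand)

definition kfun :: "nat \<Rightarrow> ('p set \<Rightarrow> 'k::field) \<Rightarrow> ('p set \<Rightarrow> 'p set \<Rightarrow> 'p \<Rightarrow> 'k) \<Rightarrow> 'k" where
  "kfun n \<phi> F = (\<Sum>A\<in>kact T C n. F A C (point C) * \<phi> A)"

text \<open>As \<open>C\<close> is a component of \<open>T - A\<close>, an entry at \<open>A\<close>
  restricts to a morphism into I_C. In the action on row \<open>C\<close> all summands except the
  one through \<open>C\<close> itself are then loops and vanish.\<close>

lemma lin_map_kfun:
  "lin_map \<Lambda> (koszul T n) (kmod C :: (('k::field, 'p) interval_endo, 'k) module) (kfun n \<phi>)"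
proof (rule lin_mapI)
  fix F G :: "'p set \<Rightarrow> 'p set \<Rightarrow> 'p \<Rightarrow> 'k" and a :: "('k, 'p) interval_endo"
  show "kfun n \<phi> F \<in> carrier (kmod C :: (('k, 'p) interval_endo, 'k) module)" by simp
  show "kfun n \<phi> (F \<oplus>\<^bsub>koszul T n :: (('k, 'p) interval_endo, _) module\<^esub> G) =
    kfun n \<phi> F \<oplus>\<^bsub>kmod C :: (('k, 'p) interval_endo, 'k) module\<^esub> kfun n \<phi> G"
    by (simp add: kfun_def koszul_simps algebra_simps sum.distrib)
  assume a: "a \<in> carrier \<Lambda>" and F: "F \<in> carrier (koszul T n :: (('k, 'p) interval_endo, _) module)"
  have "(a \<odot>\<^bsub>koszul T n\<^esub> F) A C (point C) = coord a C C (point C) * F A C (point C)"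
    if A: "A \<in> kact T C n" for A
  proof -
    have CA: "C \<in> components (T - A)" using A by (simp add: kact_def)
    have "coord a C U (point C) * F A U (point C) = 0" if "U \<noteq> C" for U
    proof (cases "U \<in> intervals")
      case True
      show ?thesis
        using hom_fun_loop_zero[OF C True that coord_hom_fun[OF a]
          hom_fun_component_restrict[OF koszul_hom_fun[OF F] CA], of "point C"] point_mem[OF C]
        by simp
    next
      case False
      then show ?thesis using coord_zero'[OF a, of U "point C" C] by simp
    qed
    then have "(\<Sum>U\<in>UNIV. coord a C U (point C) * F A U (point C)) =
        (\<Sum>U\<in>UNIV. if U = C then coord a C C (point C) * F A C (point C) else 0)"
      by (intro sum.cong) auto
    then show ?thesis by (simp add: koszul_simps)
  qed
  then show "kfun n \<phi> (a \<odot>\<^bsub>koszul T n\<^esub> F) = a \<odot>\<^bsub>kmod C\<^esub> kfun n \<phi> F"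
    by (simp add: kfun_def sum_distrib_left mult.assoc)
qed

lemma kfun_kgen:
  assumes "A \<in> kact T C n"
  shows "kfun n \<phi> (kgen T A) = (\<phi> A :: 'k::field)"
proof -
  have "kfun n \<phi> (kgen T A) = (\<Sum>A'\<in>kact T C n. if A' = A then \<phi> A else 0)"
    unfolding kfun_def by (intro sum.cong) (auto simp: kgen_point[OF assms])
  then show ?thesis using assms by simp
qed

text \<open>The coboundary in the coordinates \<open>f (kgen T A)\<close>: this reduces the Hom
  complex to a cochain complex on the sets in \<open>kact\<close>.\<close>

lemma lin_map_kdiff_kgen:
  fixes f :: "_ \<Rightarrow> 'k::field"
  assumes f: "lin_map \<Lambda> (koszul T n) (kmod C :: (('k, 'p) interval_endo, 'k) module) f"
    and B: "B \<in> kact T C (Suc n)"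
  shows "f (kdiff T (kgen T B)) =
    (\<Sum>m\<in>B. if B - {m} \<in> kact T C n then ksign m (B - {m}) * f (kgen T (B - {m})) else 0)"
proof -
  have BK: "B \<in> kidx T (Suc n)" using B by (simp add: kact_def)
  note g = kgen_closed[OF BK, where 'k = 'k]
  let ?t = "\<lambda>(A, m). ksign m A * f (kgen T A)"
  let ?X = "{q \<in> Sigma (kact T C n) (\<lambda>A. minimal_elements T - A). insert (snd q) (fst q) = B}"
  have "f (kdiff T (kgen T B)) = (\<Sum>A\<in>kact T C n. kdiff T (kgen T B) A C (point C) * f (kgen T A))"
    by (rule lin_map_koszul_expand[OF f lin_map_closed[OF lin_map_kdiff g]])
  also have "\<dots> = (\<Sum>A\<in>kact T C n. \<Sum>m\<in>minimal_elements T - A.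
      if insert (snd (A, m)) (fst (A, m)) = B then ?t (A, m) else 0)"
    unfolding kdiff_def kgen_point[OF B] by (auto simp: sum_distrib_right intro!: sum.cong)
  also have "\<dots> = (\<Sum>q\<in>Sigma (kact T C n) (\<lambda>A. minimal_elements T - A).
      if insert (snd q) (fst q) = B then ?t q else 0)"
    by (subst sum.Sigma) (auto intro!: sum.cong)
  also have "\<dots> = (\<Sum>q\<in>?X. ?t q)" by (rule sum.inter_filter[symmetric]) simp
  \<comment> \<open>A pair with \<open>insert m A = B\<close> and \<open>m\<close> outside
    \<open>A\<close> is determined by \<open>m\<close>.\<close>
  also have "\<dots> = (\<Sum>m\<in>{m \<in> B. B - {m} \<in> kact T C n}. ksign m (B - {m}) * f (kgen T (B - {m})))"
    by (rule sum.reindex_bij_witness[where i = "\<lambda>m. (B - {m}, m)" and j = snd])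
      (use BK in \<open>auto simp: kidx_def insert_absorb Diff_insert_absorb\<close>)
  also have "\<dots> = (\<Sum>m\<in>B. if B - {m} \<in> kact T C n then ksign m (B - {m}) * f (kgen T (B - {m})) else 0)"
    by (rule sum.inter_filter) simp
  finally show ?thesis .
qed

subsection \<open>The components of \<open>T - A\<close>\<close>

text \<open>A component is a connected set closed under comparability in \<open>T - A\<close>.
  Upward closure is the upset condition, since a minimal element of \<open>T\<close> lies above no
  other point of \<open>T\<close>; downward closure says that all points of \<open>T - C\<close>
  below \<open>C\<close> were removed.\<close>

lemma components_Diff_iff:
  assumes A: "A \<subseteq> minimal_elements T"
  shows "C \<in> components (T - A) \<longleftrightarrow> relative_upset C T \<and> {x \<in> T - C. \<exists>c\<in>C. x \<le> c} \<subseteq> A \<and> A \<inter> C = {}"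
proof
  assume CA: "C \<in> components (T - A)"
  note sub = components_subset[OF CA] and cl = components_closed[OF CA]
  have "x \<in> C" if c: "c \<in> C" and x: "x \<in> T" "c \<le> x" for c x
  proof -
    have "x \<notin> A" using minimal_elementsD[of x T c] A sub c x by auto
    then show ?thesis using cl[OF c, of x] x by blast
  qed
  moreover have "{x \<in> T - C. \<exists>c\<in>C. x \<le> c} \<subseteq> A" using cl by blast
  ultimately show "relative_upset C T \<and> {x \<in> T - C. \<exists>c\<in>C. x \<le> c} \<subseteq> A \<and> A \<inter> C = {}"
    using sub by (auto simp: relative_upset_def)
next
  assume *: "relative_upset C T \<and> {x \<in> T - C. \<exists>c\<in>C. x \<le> c} \<subseteq> A \<and> A \<inter> C = {}"
  then have CT: "C \<subseteq> T - A" by (auto simp: relative_upset_def)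
  let ?c = "point C"
  have c: "?c \<in> C" by (rule point_mem[OF C])
  have "component_of (T - A) ?c = C"
  proof (intro equalityI subsetI)
    fix y assume "y \<in> component_of (T - A) ?c"
    then have "(?c, y) \<in> (comparable_in (T - A))\<^sup>*" by (simp add: component_of_def)
    then show "y \<in> C"
    proof (induction rule: rtrancl_induct)
      case (step y z)
      then have "y \<in> C" "z \<in> T - A" "y \<le> z \<or> z \<le> y" by (auto simp: comparable_in_def)
      then show ?case using * unfolding relative_upset_def by blast
    qed (rule c)
  next
    fix y assume "y \<in> C"
    then have "(?c, y) \<in> (comparable_in C)\<^sup>*"
      using intervals_connected[OF C] c unfolding poset_connected_iff component_of_def by blast
    moreover have "comparable_in C \<subseteq> comparable_in (T - A)" using CT by (auto simp: comparable_in_def)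
    ultimately show "y \<in> component_of (T - A) ?c"
      using rtrancl_mono unfolding component_of_def by blast
  qed
  then show "C \<in> components (T - A)" using component_of_mem[of ?c "T - A"] c CT by auto
qed

text \<open>A point of an upset is never below a point outside it, so removing \<open>C\<close>
  creates no new minimal elements.\<close>

lemma minimal_elements_Diff:
  assumes "relative_upset C T"
  shows "minimal_elements (T - C) = minimal_elements T - C"
  using assms by (auto simp: minimal_elements_def relative_upset_def)

text \<open>Take \<open>y\<close> maximal outside \<open>C\<close> between \<open>x\<close> and
  \<open>c\<close>, then \<open>z\<close> minimal in the half-open range from \<open>y\<close> to
  \<open>c\<close>; by maximality of \<open>y\<close> the point \<open>z\<close> has entered
  \<open>C\<close>.\<close>

lemma covering_chain:
  fixes c :: 'p
  assumes "x < c" "x \<notin> C" "c \<in> C"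
  shows "\<exists>y z. x \<le> y \<and> covered_by y z \<and> z \<le> c \<and> y \<notin> C \<and> z \<in> C"
proof -
  let ?Y = "{y. x \<le> y \<and> y < c \<and> y \<notin> C}"
  obtain y where y: "y \<in> ?Y" "\<forall>b\<in>?Y. y \<le> b \<longrightarrow> y = b"
    using finite_has_maximal[of ?Y] assms by auto
  let ?Z = "{z. y < z \<and> z \<le> c}"
  obtain z where z: "z \<in> ?Z" "\<forall>b\<in>?Z. b \<le> z \<longrightarrow> z = b"
    using finite_has_minimal[of ?Z] y by auto
  have "covered_by y z" using z by (force simp: covered_by_def)
  moreover have "z \<in> C" using y z assms(3) by (cases "z = c") (force simp: less_le)+
  ultimately show ?thesis using y z by auto
qed

text \<open>Trades the covering relation for the set of all points of \<open>T - C\<close> below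
  \<open>C\<close>. Each of them lies below a point of the lower boundary, so the two sets coincide
  as soon as one consists of minimal elements of \<open>T\<close>.\<close>

lemma extremal_lower_boundary_iff:
  assumes up: "relative_upset C T"
  shows "extremal_lower_boundary T C \<longleftrightarrow>
    {x \<in> T - C. \<exists>c\<in>C. x \<le> c} = minimal_elements T - C"
proof -
  let ?D = "{x \<in> T - C. \<exists>c\<in>C. x \<le> c}" and ?M = "minimal_elements T - C"
  have CT: "C \<subseteq> T" using up by (simp add: relative_upset_def)
  have LD: "lower_boundary T C \<subseteq> ?D" unfolding lower_boundary_def covered_by_def by (blast dest: less_imp_le)
  have chain: "\<exists>y\<in>lower_boundary T C. x \<le> y" if x: "x \<in> ?D" for x
  proof -
    obtain c where c: "c \<in> C" "x < c" "x \<in> T" "x \<notin> C" using x by (auto simp: less_le)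
    obtain y z where yz: "x \<le> y" "covered_by y z" "z \<le> c" "y \<notin> C" "z \<in> C"
      using covering_chain[OF c(2,4,1)] by blast
    have "y \<le> c" using yz by (auto simp: covered_by_def)
    then have "y \<in> T" using intervals_convex[OF T] c CT yz(1) unfolding poset_convex_def by blast
    then show ?thesis using yz by (auto simp: lower_boundary_def)
  qed
  show ?thesis
    unfolding extremal_lower_boundary_def minimal_elements_Diff[OF up]
  proof
    assume e: "lower_boundary T C = ?M"
    have "?D \<subseteq> ?M"
    proof
      fix x assume x: "x \<in> ?D"
      then obtain y where "y \<in> ?M" "x \<le> y" using chain e by blast
      then show "x \<in> ?M" using minimal_elementsD[of y T x] x by auto
    qed
    then show "?D = ?M" using LD e by blast
  next
    assume e: "?D = ?M"
    have "?M \<subseteq> lower_boundary T C"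
    proof
      fix x assume x: "x \<in> ?M"
      then obtain y where y: "y \<in> lower_boundary T C" "x \<le> y" using chain e by blast
      then have "y \<in> ?M" using LD e by blast
      then show "x \<in> lower_boundary T C"
        using y minimal_elementsD[of y T x] x minimal_elements_subset[of T] by auto
    qed
    then show "lower_boundary T C = ?M" using LD e by blast
  qed
qed

lemma kact_iff:
  "A \<in> kact T C n \<longleftrightarrow> relative_upset C T \<and> {x \<in> T - C. \<exists>c\<in>C. x \<le> c} \<subseteq> A \<and>
    A \<subseteq> minimal_elements T - C \<and> card A = n"
proof -
  have "A \<subseteq> minimal_elements T - C \<longleftrightarrow> A \<subseteq> minimal_elements T \<and> A \<inter> C = {}" by blast
  then show ?thesis using components_Diff_iff[of A] unfolding kact_def kidx_def by auto
qed

subsection \<open>Cohomology with values in a simple module\<close>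

context
  fixes d :: "nat \<Rightarrow> ('p set \<Rightarrow> 'p set \<Rightarrow> 'p \<Rightarrow> 'k::field) \<Rightarrow> 'p set \<Rightarrow> 'p set \<Rightarrow> 'p \<Rightarrow> 'k"
  assumes d: "\<And>n F. F \<in> carrier (koszul T (Suc n) :: (('k, 'p) interval_endo, _) module) \<Longrightarrow> d n F = kdiff T F"
begin

abbreviation (input) kcocyc where
  "kcocyc \<equiv> cocyc \<Lambda> (koszul T :: nat \<Rightarrow> (('k, 'p) interval_endo, _) module) d
     (kmod C :: (('k, 'p) interval_endo, 'k) module)"

abbreviation (input) kcobound where
  "kcobound \<equiv> cobound \<Lambda> (koszul T :: nat \<Rightarrow> (('k, 'p) interval_endo, _) module) d
     (kmod C :: (('k, 'p) interval_endo, 'k) module)"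

lemma kcocyc_kgen:
  assumes f: "kcocyc n f" and B: "B \<in> kact T C (Suc n)"
  shows "(\<Sum>m\<in>B. if B - {m} \<in> kact T C n then ksign m (B - {m}) * f (kgen T (B - {m})) else 0) = 0"
proof -
  have g: "kgen T B \<in> carrier (koszul T (Suc n) :: (('k, 'p) interval_endo, _) module)"
    using B by (intro kgen_closed) (simp add: kact_def)
  have l: "lin_map \<Lambda> (koszul T n) (kmod C :: (('k, 'p) interval_endo, 'k) module) f" and "f (d n (kgen T B)) = 0"
    using f g by (auto simp: cocyc_def)
  then show ?thesis using lin_map_kdiff_kgen[OF l B] d[OF g] by simp
qed

lemma kcobound_zero:
  assumes f: "kcocyc n f" and z: "\<And>A. A \<in> kact T C n \<Longrightarrow> f (kgen T A) = 0"
  shows "kcobound n f"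
proof -
  have "f F = 0" if "F \<in> carrier (koszul T n :: (('k, 'p) interval_endo, _) module)" for F
    using lin_map_koszul_expand[OF _ that, of f] f z by (simp add: cocyc_def)
  moreover have "lin_map \<Lambda> (koszul T m) (kmod C :: (('k, 'p) interval_endo, 'k) module) (\<lambda>F. 0)" for m
    by (rule lin_mapI) simp_all
  ultimately show ?thesis by (cases n) (auto simp: cobound_def)
qed

text \<open>The admissible sets \<open>A\<close> form the Boolean interval between the strict lower closure of \<open>C\<close>
  and \<open>minimal_elements T - C\<close>; an element \<open>m\<close> in the gap gives a contraction.\<close>

lemma kcocyc_kcobound:
  assumes f: "kcocyc n f" and m: "m \<in> minimal_elements T - C" "m \<notin> {x \<in> T - C. \<exists>c\<in>C. x \<le> c}"
  shows "kcobound n f"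
proof -
  let ?\<phi> = "\<lambda>A. f (kgen T A)"
  have ins: "insert m A \<in> kact T C (Suc j) \<longleftrightarrow> A \<in> kact T C j" if "m \<notin> A" for A j
    using that m by (auto simp: kact_iff)
  have fl: "lin_map \<Lambda> (koszul T n) (kmod C :: (('k, 'p) interval_endo, 'k) module) f"
    using f by (simp add: cocyc_def)
  \<comment> \<open>The cocycle condition at \<open>insert m B\<close>, solved for the term in which
    \<open>m\<close> is removed.\<close>
  have cocycle: "ksign m B * ?\<phi> B = - (\<Sum>k\<in>B. if insert m (B - {k}) \<in> kact T C n
      then ksign k (insert m (B - {k})) * ?\<phi> (insert m (B - {k})) else 0)"
    if B: "B \<in> kact T C n" "m \<notin> B" for B
  proof -
    have r: "insert m B - {k} = insert m (B - {k})" if "k \<in> B" for k using that B by auto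
    have "0 = (\<Sum>k\<in>insert m B. if insert m B - {k} \<in> kact T C n
        then ksign k (insert m B - {k}) * ?\<phi> (insert m B - {k}) else 0)"
      using kcocyc_kgen[OF f, of "insert m B"] B ins by simp
    also have "\<dots> = ksign m B * ?\<phi> B + (\<Sum>k\<in>B. if insert m B - {k} \<in> kact T C n
        then ksign k (insert m B - {k}) * ?\<phi> (insert m B - {k}) else 0)"
      using B by (subst sum.insert) auto
    also have "(\<Sum>k\<in>B. if insert m B - {k} \<in> kact T C n
        then ksign k (insert m B - {k}) * ?\<phi> (insert m B - {k}) else 0) =
      (\<Sum>k\<in>B. if insert m (B - {k}) \<in> kact T C n
        then ksign k (insert m (B - {k})) * ?\<phi> (insert m (B - {k})) else 0)"
      by (rule sum.cong[OF refl]) (simp only: r)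
    finally show ?thesis by (simp add: eq_neg_iff_add_eq_0)
  qed
  show ?thesis
  proof (cases n)
    case 0
    have "f (kgen T A) = 0" if A: "A \<in> kact T C n" for A
    proof -
      have "A = {}" using A by (simp add: 0 kact_iff)
      then have "ksign m {} * ?\<phi> A = 0" using cocycle[OF A] by simp
      then show ?thesis by (simp add: ksign_def)
    qed
    then show ?thesis by (rule kcobound_zero[OF f])
  next
    case (Suc l)
    \<comment> \<open>The contraction dual to adjoining \<open>m\<close>. Its coboundary at
      \<open>B\<close> is \<open>f\<close> again: if \<open>m \<in> B\<close>, only the term
      removing \<open>m\<close> survives, otherwise \<open>cocycle\<close> applies.\<close>
    define \<psi> where "\<psi> A = (if m \<in> A then 0 else ksign m A * ?\<phi> (insert m A))" for A
    let ?g = "kfun l \<psi>"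
    have gd: "lin_map \<Lambda> (koszul T n) (kmod C :: (('k, 'p) interval_endo, 'k) module) (\<lambda>F. ?g (kdiff T F))"
      unfolding Suc by (rule lin_map_compose[OF lin_map_kdiff lin_map_kfun])
    have "f (kgen T B) = ?g (kdiff T (kgen T B))" if B: "B \<in> kact T C n" for B
    proof -
      have "?g (kdiff T (kgen T B)) = (\<Sum>k\<in>B. if B - {k} \<in> kact T C l
          then ksign k (B - {k}) * ?g (kgen T (B - {k})) else 0)"
        by (rule lin_map_kdiff_kgen[OF lin_map_kfun B[unfolded Suc]])
      also have "\<dots> = (\<Sum>k\<in>B. if B - {k} \<in> kact T C l then ksign k (B - {k}) * \<psi> (B - {k}) else 0)"
        by (rule sum.cong[OF refl]) (simp add: kfun_kgen)
      also have "\<dots> = ?\<phi> B"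
      proof (cases "m \<in> B")
        case True
        have "B - {m} \<in> kact T C l" using ins[of "B - {m}" l] B True by (simp add: Suc insert_absorb)
        then have "(\<Sum>k\<in>B. if B - {k} \<in> kact T C l then ksign k (B - {k}) * \<psi> (B - {k}) else 0) =
            (\<Sum>k\<in>B. if k = m then ?\<phi> B else 0)"
          using True by (intro sum.cong) (auto simp: \<psi>_def ksign_square_mult insert_absorb)
        then show ?thesis using True by simp
      next
        case False
        have "(\<Sum>k\<in>B. if B - {k} \<in> kact T C l then ksign k (B - {k}) * \<psi> (B - {k}) else 0) =
          (\<Sum>k\<in>B. - ksign m B * (if insert m (B - {k}) \<in> kact T C n
            then ksign k (insert m (B - {k})) * ?\<phi> (insert m (B - {k})) else 0))"
        proof (rule sum.cong[OF refl])
          fix k assume k: "k \<in> B"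
          let ?E = "B - {k}"
          have E: "m \<notin> ?E" "k \<notin> ?E" "m \<noteq> k" "insert k ?E = B" using k False by auto
          have "ksign k ?E * (ksign m ?E * ?\<phi> (insert m ?E)) =
              - ksign m B * (ksign k (insert m ?E) * ?\<phi> (insert m ?E))"
            using ksign_swap(1)[of k m ?E, where 'k = 'k] E by (simp flip: mult.assoc)
          then show "(if ?E \<in> kact T C l then ksign k ?E * \<psi> ?E else 0) =
              - ksign m B * (if insert m ?E \<in> kact T C n
                then ksign k (insert m ?E) * ?\<phi> (insert m ?E) else 0)"
            using ins[OF E(1), of l] False by (simp add: Suc \<psi>_def)
        qed
        also have "\<dots> = - ksign m B * (\<Sum>k\<in>B. if insert m (B - {k}) \<in> kact T C n
            then ksign k (insert m (B - {k})) * ?\<phi> (insert m (B - {k})) else 0)"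
          by (simp only: sum_distrib_left)
        also have "\<dots> = ksign m B * (ksign m B * ?\<phi> B)" unfolding cocycle[OF B False] by simp
        finally show ?thesis by (simp add: ksign_square_mult)
      qed
      finally show ?thesis by simp
    qed
    then have "f F = ?g (kdiff T F)" if "F \<in> carrier (koszul T n :: (('k, 'p) interval_endo, _) module)" for F
      using lin_map_koszul_eqI[OF fl gd _ that] by blast
    then have "\<forall>F\<in>carrier (koszul T n :: (('k, 'p) interval_endo, _) module). f F = ?g (d l F)"
      using d[of _ l] by (auto simp: Suc)
    then show ?thesis using lin_map_kfun[of l \<psi>] unfolding cobound_def Suc by auto
  qed
qed

text \<open>Without admissible sets all maps vanish. With one, the Boolean interval must have a gap:
  if its ends agreed, its single member would force the excluded degree and the extremal
  boundary.\<close>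

lemma kcocyc_kcobound_unless:
  assumes f: "kcocyc n f"
    and not: "\<not> (relative_upset C T \<and> extremal_lower_boundary T C \<and> n = card (minimal_elements (T - C)))"
  shows "kcobound n f"
proof (cases "kact T C n = {}")
  case True
  then show ?thesis using kcobound_zero[OF f] by blast
next
  case False
  then obtain A where A: "A \<in> kact T C n" by blast
  let ?D = "{x \<in> T - C. \<exists>c\<in>C. x \<le> c}"
  have up: "relative_upset C T" using A by (simp add: kact_iff)
  have "?D \<noteq> minimal_elements T - C"
  proof
    assume e: "?D = minimal_elements T - C"
    then have "A = minimal_elements T - C" using A unfolding kact_iff by blast
    then have "n = card (minimal_elements (T - C))" using A minimal_elements_Diff[OF up] by (simp add: kact_iff)
    then show False using not up e extremal_lower_boundary_iff[OF up] by simp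
  qed
  then obtain m where "m \<in> minimal_elements T - C" "m \<notin> ?D" using A unfolding kact_iff by blast
  then show ?thesis by (rule kcocyc_kcobound[OF f])
qed

text \<open>Only \<open>minimal_elements T - C\<close> is admissible, in degree \<open>n\<close>
  alone, so every other Hom space is zero. The action \<open>s\<close> stays abstract so that
  \<open>scal\<close> can be inserted.\<close>

lemma cohomology_line_kmod:
  assumes up: "relative_upset C T" and ex: "extremal_lower_boundary T C"
    and n: "n = card (minimal_elements (T - C))"
    and s: "\<And>c y. s c y = c * y"
  shows "cohomology_line \<Lambda> (koszul T :: nat \<Rightarrow> (('k, 'p) interval_endo, _) module) d
     (kmod C :: (('k, 'p) interval_endo, 'k) module) s n"
proof -
  let ?N = "kmod C :: (('k, 'p) interval_endo, 'k) module"
  let ?M = "minimal_elements T - C"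
  have act: "kact T C j = (if j = n then {?M} else {})" for j
  proof -
    have "A \<in> kact T C j \<longleftrightarrow> A = ?M \<and> j = n" for A
      unfolding kact_iff iffD1[OF extremal_lower_boundary_iff[OF up] ex]
      using up n minimal_elements_Diff[OF up] by auto
    then show ?thesis by auto
  qed
  have zero: "f F = 0" if "lin_map \<Lambda> (koszul T j) ?N f" "j \<noteq> n"
    "F \<in> carrier (koszul T j :: (('k, 'p) interval_endo, _) module)" for f j F
    using lin_map_koszul_expand[OF that(1,3)] that(2) act by simp
  interpret K: left_module "\<Lambda> :: ('k, ('k, 'p) interval_endo) module" ?N by (rule left_module_kmod[OF C])
  let ?b = "kfun n (\<lambda>A. 1) :: _ \<Rightarrow> 'k"
  have bl: "lin_map \<Lambda> (koszul T n) ?N ?b" by (rule lin_map_kfun)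
  have coc: "kcocyc n f" if "lin_map \<Lambda> (koszul T n) ?N f" for f
    unfolding cocyc_def using that zero[OF lin_map_compose[OF lin_map_kdiff that]] d by simp
  have gM: "kgen T ?M \<in> carrier (koszul T n :: (('k, 'p) interval_endo, _) module)"
    using act[of n] by (intro kgen_closed) (auto simp: kact_def)
  have b1: "?b (kgen T ?M) = 1" using act[of n] by (subst kfun_kgen) auto
  have "\<not> kcobound n ?b"
  proof
    assume "kcobound n ?b"
    then show False
    proof (cases n)
      case 0
      then show False using \<open>kcobound n ?b\<close> gM b1 unfolding cobound_def by auto
    next
      case (Suc m)
      then obtain g where g: "lin_map \<Lambda> (koszul T m) ?N g"
        "\<And>F. F \<in> carrier (koszul T n :: (('k, 'p) interval_endo, _) module) \<Longrightarrow> ?b F = g (d m F)"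
        using \<open>kcobound n ?b\<close> unfolding cobound_def by auto
      have "?b (kgen T ?M) = g (kdiff T (kgen T ?M))"
        using g(2)[OF gM] d[of "kgen T ?M" m] gM by (simp add: Suc)
      \<comment> \<open>\<open>g\<close> starts in degree \<open>n - 1\<close>, where no set is
        admissible, so it is zero.\<close>
      also have "\<dots> = 0"
        using zero[OF g(1) _ lin_map_closed[OF lin_map_kdiff gM[unfolded Suc]]] Suc by simp
      finally show False using b1 by simp
    qed
  qed
  moreover have "\<exists>c. kcobound n (\<lambda>F. f F \<ominus>\<^bsub>?N\<^esub> s c (?b F))" if f: "kcocyc n f" for f
  proof
    have fl: "lin_map \<Lambda> (koszul T n) ?N f" using f by (simp add: cocyc_def)
    have "lin_map \<Lambda> (koszul T n) ?N (\<lambda>F. s (f (kgen T ?M)) (?b F))"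
      by (rule lin_mapI) (simp_all add: s lin_map_add[OF bl, simplified] lin_map_smult[OF bl, simplified] algebra_simps)
    then have l: "lin_map \<Lambda> (koszul T n) ?N (\<lambda>F. f F \<ominus>\<^bsub>?N\<^esub> s (f (kgen T ?M)) (?b F))"
      by (rule lin_map_diff[OF left_module_koszul K.left_module_axioms fl])
    show "kcobound n (\<lambda>F. f F \<ominus>\<^bsub>?N\<^esub> s (f (kgen T ?M)) (?b F))"
      by (rule kcobound_zero[OF coc[OF l]])
        (use act[of n] b1 in \<open>simp add: s K.M.diff_eq_zero_iff[simplified]\<close>)
  qed
  ultimately show ?thesis unfolding cohomology_line_def using coc[OF bl] by blast
qed

end

end

theorem theorem1p3:
  fixes T C :: "'p::{finite, order} set" and p :: nat
  assumes "poset_connected (UNIV :: 'p set)"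
    and "T \<in> intervals" and "C \<in> intervals"
  shows "let E = Ext (interval_algebra :: ('k::field, ('k, 'p) interval_endo) module) p
                   (standard_module T) (simple_top C)
         in if relative_upset C T \<and> extremal_lower_boundary T C \<and>
               p = card (minimal_elements (T - C))
            then has_dimension E 1
            else carrier E = {\<zero>\<^bsub>E\<^esub>}"
proof -
  note T = assms(2) and C = assms(3)
  let ?A = "\<Lambda> :: ('k, ('k, 'p) interval_endo) module"
  let ?K = "koszul T :: nat \<Rightarrow> (('k, 'p) interval_endo, _) module"
  let ?k = "kmod C :: (('k, 'p) interval_endo, 'k) module"
  let ?L = "simple_top C :: (('k, 'p) interval_endo, _) module"
  interpret scalar_algebra ?A by (rule scalar_algebra_interval_algebra)
  note lL = left_module_simple_top[OF C] and lk = left_module_kmod[OF C]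
  have lM: "left_module ?A (standard_module T)"
    unfolding standard_module_eq[OF T]
    by (rule left_module_quotient[OF left_module_proj_module[OF T] submodule_std_kernel[OF T]])
  obtain d e where res: "projective_resolution ?A (standard_module T) ?K d e"
    and d: "\<And>n F. F \<in> carrier (?K (Suc n)) \<Longrightarrow> d n F = kdiff T F"
    using koszul_resolution[OF T, where 'k = 'k] by blast
  \<comment> \<open>L(C) is exchanged for its model on the field; the two inverse maps carry
    cocycles and coboundaries back and forth.\<close>
  obtain \<alpha> \<beta> where \<alpha>: "lin_map ?A ?L ?k \<alpha>" and \<beta>: "lin_map ?A ?k ?L \<beta>"
    and \<beta>\<alpha>: "\<And>x. x \<in> carrier ?L \<Longrightarrow> \<beta> (\<alpha> x) = x" and \<alpha>\<beta>: "\<And>y. y \<in> carrier ?k \<Longrightarrow> \<alpha> (\<beta> y) = y"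
    using mod_iso_inverse[OF lL simple_top_iso_kmod[OF C]] by metis
  have scal_k: "scal ?k c y = c * y" for c y
    using point_mem[OF C] C by (simp add: scal_def coord_smult coord_one)
  show ?thesis
  proof (cases "relative_upset C T \<and> extremal_lower_boundary T C \<and> p = card (minimal_elements (T - C))")
    case False
    have "cobound ?A ?K d ?L p f" if f: "cocyc ?A ?K d ?L p f" for f
    proof -
      have "cobound ?A ?K d ?k p (\<lambda>x. \<alpha> (f x))"
        by (rule kcocyc_kcobound_unless[OF T C d cocyc_lin_map[OF lL lk \<alpha> f] False])
      then have "cobound ?A ?K d ?L p (\<lambda>x. \<beta> (\<alpha> (f x)))" by (rule cobound_lin_map[OF lk lL \<beta>])
      then show ?thesis by (rule cobound_cong) (rule \<beta>\<alpha>[OF cocyc_closed[OF f]])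
    qed
    then have "carrier (Ext ?A p (standard_module T) ?L) = {\<zero>\<^bsub>Ext ?A p (standard_module T) ?L\<^esub>}"
      by (rule Ext_vanishes[OF lL lM res])
    then show ?thesis unfolding Let_def if_not_P[OF False] .
  next
    case True
    have "cohomology_line ?A ?K d ?k (scal ?k) p"
      using True by (intro cohomology_line_kmod[OF T C d] scal_k) auto
    then obtain b where b: "cocyc ?A ?K d ?k p b" and nb: "\<not> cobound ?A ?K d ?k p b"
      and gen: "\<And>f. cocyc ?A ?K d ?k p f \<Longrightarrow> \<exists>c. cobound ?A ?K d ?k p (\<lambda>x. f x \<ominus>\<^bsub>?k\<^esub> scal ?k c (b x))"
      unfolding cohomology_line_def by blast
    let ?b = "\<lambda>x. \<beta> (b x)"
    have "cocyc ?A ?K d ?L p ?b" by (rule cocyc_lin_map[OF lk lL \<beta> b])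
    moreover have "\<not> cobound ?A ?K d ?L p ?b"
    proof
      assume "cobound ?A ?K d ?L p ?b"
      then have "cobound ?A ?K d ?k p (\<lambda>x. \<alpha> (\<beta> (b x)))" by (rule cobound_lin_map[OF lL lk \<alpha>])
      then have "cobound ?A ?K d ?k p b" by (rule cobound_cong) (rule \<alpha>\<beta>[OF cocyc_closed[OF b]])
      with nb show False ..
    qed
    moreover have "\<exists>c. cobound ?A ?K d ?L p (\<lambda>x. f x \<ominus>\<^bsub>?L\<^esub> scal ?L c (?b x))"
      if f: "cocyc ?A ?K d ?L p f" for f
    proof -
      obtain c where "cobound ?A ?K d ?k p (\<lambda>x. \<alpha> (f x) \<ominus>\<^bsub>?k\<^esub> scal ?k c (b x))"
        using gen[OF cocyc_lin_map[OF lL lk \<alpha> f]] by blast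
      then have "cobound ?A ?K d ?L p (\<lambda>x. \<beta> (\<alpha> (f x) \<ominus>\<^bsub>?k\<^esub> scal ?k c (b x)))"
        by (rule cobound_lin_map[OF lk lL \<beta>])
      then have "cobound ?A ?K d ?L p (\<lambda>x. f x \<ominus>\<^bsub>?L\<^esub> scal ?L c (?b x))"
      proof (rule cobound_cong)
        fix x assume x: "x \<in> carrier (?K p)"
        have fx: "f x \<in> carrier ?L" by (rule cocyc_closed[OF f x])
        have "\<beta> (\<alpha> (f x) \<ominus>\<^bsub>?k\<^esub> scal ?k c (b x)) = \<beta> (\<alpha> (f x)) \<ominus>\<^bsub>?L\<^esub> \<beta> (scal ?k c (b x))"
          by (rule lin_map_minus[OF lk lL \<beta>]) simp_all
        \<comment> \<open>Scalars act through elements of the algebra, so linearity of \<beta> over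
          the algebra includes them.\<close>
        also have "\<beta> (scal ?k c (b x)) = scal ?L c (\<beta> (b x))"
          unfolding scal_def by (rule lin_map_smult[OF \<beta> scalar_closed]) simp
        finally show "\<beta> (\<alpha> (f x) \<ominus>\<^bsub>?k\<^esub> scal ?k c (b x)) = f x \<ominus>\<^bsub>?L\<^esub> scal ?L c (\<beta> (b x))"
          by (simp only: \<beta>\<alpha>[OF fx])
      qed
      then show ?thesis ..
    qed
    ultimately have "cohomology_line ?A ?K d ?L (scal ?L) p" unfolding cohomology_line_def by blast
    then have "has_dimension (Ext ?A p (standard_module T) ?L) 1" by (rule Ext_line[OF lL lM res])
    then show ?thesis unfolding Let_def if_P[OF True] .
  qed
qed

end
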